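(* Let $\mathcal{H}_W$ be the convolution algebra of functions on $GL_{\ell+1}(\mathbb{R})$ spanned by the functions $$F_{v_\epsilon,v_{\epsilon'}}(g)=(v_\epsilon,\pi_W(g)v_{\epsilon'})\,F(g),\qquad \epsilon,\epsilon'\in\mathcal{P},\ |\epsilon|=|\epsilon'|,\ F\in\mathcal{H},$$ where $\mathcal{H}$ is the space of $O_{\ell+1}$-bi-invariant functions described in the context. Then the linear subspace of those $f\in\mathcal{H}_W$ that satisfy $$f(mgm^{-1})=f(g)\quad\text{for all } m\in M$$ is spanned by the functions $$F_{v_\epsilon}(g)=(v_\epsilon,\pi_W(g)v_\epsilon)\,F(g),\qquad \epsilon\in\mathcal{P},\ F\in\mathcal{H},$$ and it is a maximal commutative subalgebra of $\mathcal{H}_W$ with respect to convolution. Moreover, for all $\epsilon_1,\epsilon_2\in\mathcal{P}$ and $F,G\in\mathcal{H}$, $$F_{v_{\epsilon_1}}*G_{v_{\epsilon_2}}=\frac{\delta_{\epsilon_1,\epsilon_2}}{\dim W_{|\epsilon_1|}}\,(F*G)_{v_{\epsilon_1}} .$$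
   Context: Let $\ell\ge0$. $O_{\ell+1}\subset GL_{\ell+1}(\mathbb{R})$ is the orthogonal group and $M\subset O_{\ell+1}$ is the finite group of diagonal matrices with entries $\pm1$. Let $\mathcal{P}=\{0,1\}^{\ell+1}$ and $|\epsilon|=\sum_i\epsilon_i$. Let $W=\bigoplus_{k=0}^{\ell+1}W_k$, $W_k=\wedge^k\mathbb{C}^{\ell+1}$, with $\pi_W$ the natural representation of $GL_{\ell+1}(\mathbb{R})$ on $W$. With $e_1,\dots,e_{\ell+1}$ the standard basis of $\mathbb{C}^{\ell+1}$, $v_\epsilon\in W_{|\epsilon|}$ is the wedge product, in increasing order of index, of the $e_i$ with $\epsilon_i=1$, and $(\cdot,\cdot)$ is the inner product on $W$ for which $\{v_\epsilon\}_{\epsilon\in\mathcal{P}}$ is orthonormal. Convolution is $(f_1*f_2)(\tilde g)=\int_{GL_{\ell+1}(\mathbb{R})}d\mu(g)\,f_1(g)f_2(g^{-1}\tilde g)$ with Haar measure $d\mu(g)=|\det g|^{-(\ell+1)}\prod_{i,j}dg_{ij}$. $\mathcal{H}$ denotes the (commutative) spherical Hecke algebra: the space of $O_{\ell+1}$-bi-invariant functions $F$ ($F(k_1gk_2)=F(g)$ for $k_1,k_2\in O_{\ell+1}$) on $GL_{\ell+1}(\mathbb{R})$ such that $(v_\epsilon,\pi_W(g)v_{\epsilon'})F(g)$ belongs to $L^1(GL_{\ell+1}(\mathbb{R}),d\mu)$ for all $\epsilon,\epsilon'\in\mathcal{P}$, with convolution as product. Functions are identified when equal almost everywhere. A maximal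 commutative subalgebra is a commutative subalgebra not properly contained in another commutative subalgebra. *)

theory Defs
  imports "HOL-Analysis.Analysis" "HOL-Library.Function_Algebras"
begin

text \<open>
  Throughout, the finite linearly ordered type \<open>'n\<close> is the index set
  \<open>{1, ..., l + 1}\<close>, so \<open>CARD('n) = l + 1\<close>.
  An element \<open>\<epsilon>\<close> of \<open>{0,1}\<^sup>l\<^sup>+\<^sup>1\<close> is the set of those \<open>i\<close> with \<open>\<epsilon>\<^sub>i = 1\<close>,
  and \<open>|\<epsilon>|\<close> is its cardinality.
\<close>

subsection \<open>The exterior algebra\<close>

text \<open>
  The exterior algebra \<open>W\<close> of the space of complex vectors is given by its multiplication table:
  the coordinate at \<open>S\<close> belongs to \<open>e\<^sub>i \<and> e\<^sub>j \<and> ...\<close>, where \<open>i < j < ...\<close> enumerates \<open>S\<close>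
  (see \<open>ext_basis_eq_axis\<close> below).
\<close>

type_synonym 'n ext = "(complex, 'n set) vec"
type_synonym 'n cvec = "(complex, 'n) vec"
type_synonym 'n mat = "((real, 'n) vec, 'n) vec"
type_synonym 'n mat_fun = "'n mat \<Rightarrow> complex"

text \<open>The sign counts the transpositions needed to sort \<open>I\<close> followed by \<open>J\<close>.\<close>

definition wedge :: "('n::{finite,linorder}) ext \<Rightarrow> 'n ext \<Rightarrow> 'n ext" where
  "wedge x y = (\<chi> S. \<Sum>I\<in>Pow S.
     (-1) ^ card {(i, j). i \<in> I \<and> j \<in> S - I \<and> j < i} * x $ I * y $ (S - I))"

definition ext_vec :: "('n::{finite,linorder}) cvec \<Rightarrow> 'n ext" where
  "ext_vec u = (\<Sum>i\<in>UNIV. u $ i *s axis {i} 1)"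

definition wedge_list :: "('n::{finite,linorder}) cvec list \<Rightarrow> 'n ext" where
  "wedge_list us = foldr (\<lambda>u x. wedge (ext_vec u) x) us (axis {} 1)"

definition ext_power :: "nat \<Rightarrow> ('n::{finite,linorder}) ext set" where
  "ext_power k = vec.span {wedge_list us |us. length us = k}"

definition ext_basis :: "('n::{finite,linorder}) set \<Rightarrow> 'n ext" where
  "ext_basis \<epsilon> = wedge_list (map (\<lambda>i. axis i 1) (sorted_list_of_set \<epsilon>))"

definition complexify :: "('n::{finite,linorder}) mat \<Rightarrow> ((complex, 'n) vec, 'n) vec" where
  "complexify g = (\<chi> i j. complex_of_real (g $ i $ j))"

text \<open>
  The linear extension of
  \<open>e\<^sub>i \<and> e\<^sub>j \<and> ... \<mapsto> g e\<^sub>i \<and> g e\<^sub>j \<and> ...\<close>.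
\<close>

definition ext_rep :: "('n::{finite,linorder}) mat \<Rightarrow> 'n ext \<Rightarrow> 'n ext" where
  "ext_rep g x =
     (\<Sum>S\<in>UNIV. x $ S *s wedge_list (map (\<lambda>i. complexify g *v axis i 1) (sorted_list_of_set S)))"

definition ext_inner :: "('n::{finite,linorder}) ext \<Rightarrow> 'n ext \<Rightarrow> complex" where
  "ext_inner x y = (\<Sum>S\<in>UNIV. cnj (x $ S) * y $ S)"

lemma ext_vec_axis: "ext_vec (axis i 1) = axis {i} 1"
proof -
  have "ext_vec (axis i 1) = (\<Sum>j\<in>UNIV. if j = i then axis {i} 1 else 0)"
    unfolding ext_vec_def by (intro sum.cong) (auto simp: axis_def vec_eq_iff)
  then show ?thesis by simp
qed

lemma wedge_axis_less:
  assumes "\<And>j. j \<in> J \<Longrightarrow> i < j"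
  shows "wedge (axis {i} 1) (axis J 1) = axis (insert i J) 1"
proof -
  have "wedge (axis {i} 1) (axis J 1) $ S = axis (insert i J) 1 $ S" for S
  proof -
    have iJ: "i \<notin> J" using assms by blast
    have "wedge (axis {i} 1) (axis J 1) $ S =
      (\<Sum>I\<in>Pow S. if I = {i} then (if S - {i} = J then 1 else 0) else 0)"
      unfolding wedge_def vec_lambda_beta
    proof (intro sum.cong refl)
      fix I assume "I \<in> Pow S"
      show "(- 1) ^ card {(i, j). i \<in> I \<and> j \<in> S - I \<and> j < i} *
        axis {i} 1 $ I * axis J 1 $ (S - I) =
        (if I = {i} then if S - {i} = J then 1 else 0 else (0::complex))"
      proof (cases "I = {i} \<and> S - I = J")
        case True
        then have no_inv: "{(k, j). k \<in> I \<and> j \<in> S - I \<and> j < k} = {}"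
          using assms by (auto dest: less_asym)
        show ?thesis unfolding no_inv using True by auto
      next
        case False
        then show ?thesis by (auto simp: axis_def)
      qed
    qed
    also have "\<dots> = (if i \<in> S \<and> S - {i} = J then 1 else 0)"
      by simp
    also have "\<dots> = axis (insert i J) 1 $ S"
      using iJ by (auto simp: axis_def)
    finally show ?thesis .
  qed
  then show ?thesis by (simp add: vec_eq_iff)
qed

lemma wedge_list_axis:
  "sorted_wrt (<) is \<Longrightarrow> wedge_list (map (\<lambda>i. axis i 1) is) = axis (set is) 1"
proof (induction "is")
  case Nil
  show ?case by (simp add: wedge_list_def)
next
  case (Cons i "is")
  then have "wedge_list (map (\<lambda>i. axis i 1) (i # is)) = wedge (axis {i} 1) (axis (set is) 1)"
    by (simp add: wedge_list_def ext_vec_axis)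
  also have "\<dots> = axis (insert i (set is)) 1"
    using Cons.prems by (intro wedge_axis_less) simp
  finally show ?case by simp
qed

lemma ext_basis_eq_axis: "ext_basis \<epsilon> = axis \<epsilon> 1"
  unfolding ext_basis_def by (subst wedge_list_axis) auto

lemma ext_inner_ext_basis: "ext_inner (ext_basis \<epsilon>) (ext_basis \<epsilon>') = (if \<epsilon> = \<epsilon>' then 1 else 0)"
proof -
  have "ext_inner (ext_basis \<epsilon>) (ext_basis \<epsilon>') =
    (\<Sum>S\<in>UNIV. if S = \<epsilon> then (if \<epsilon> = \<epsilon>' then 1 else 0) else 0)"
    unfolding ext_inner_def ext_basis_eq_axis by (intro sum.cong) (auto simp: axis_def)
  then show ?thesis by simp
qed

lemma ext_rep_ext_basis:
  "ext_rep g (ext_basis \<epsilon>) =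
     wedge_list (map (\<lambda>i. complexify g *v axis i 1) (sorted_list_of_set \<epsilon>))"
proof -
  have "ext_rep g (ext_basis \<epsilon>) = (\<Sum>S\<in>UNIV. if S = \<epsilon>
    then wedge_list (map (\<lambda>i. complexify g *v axis i 1) (sorted_list_of_set \<epsilon>)) else 0)"
    unfolding ext_rep_def ext_basis_eq_axis by (intro sum.cong) (auto simp: axis_def vec_eq_iff)
  then show ?thesis by simp
qed


subsection \<open>Functions on the general linear group\<close>

text \<open>
  A function on the general linear group is a function on all matrices whose values at singular
  matrices are irrelevant: the underlying set of the measure space \<open>haar_GL\<close> is the group itself.
\<close>

definition GL :: "('n::finite) mat set" where
  "GL = {g. invertible g}"

definition haar_GL :: "('n::finite) mat measure" where
  "haar_GL = density (restrict_space lborel GL) (\<lambda>g. ennreal (1 / \<bar>det g\<bar> ^ CARD('n)))"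

definition conv ::
  "('n::finite) mat_fun \<Rightarrow> 'n mat_fun \<Rightarrow> 'n mat_fun" where
  "conv f1 f2 h = (LINT g|haar_GL. f1 g * f2 (matrix_inv g ** h))"

definition sign_diag :: "('n::finite) mat set" where
  "sign_diag = {m. (\<forall>i. m $ i $ i \<in> {1, -1}) \<and> (\<forall>i j. i \<noteq> j \<longrightarrow> m $ i $ j = 0)}"

interpretation cfun: vector_space "\<lambda>(c::complex) (f :: 'a \<Rightarrow> complex) x. c * f x"
  by unfold_locales (auto simp: fun_eq_iff algebra_simps)

text \<open>
  Functions that agree almost everywhere are identified by working only with sets of
  measurable functions that are saturated for this relation; a set of classes is represented by
  its union.
\<close>

definition ae_saturate :: "('n::finite) mat_fun set \<Rightarrow> 'n mat_fun set" where
  "ae_saturate A =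
     {f \<in> borel_measurable haar_GL. \<exists>h\<in>A. AE g in haar_GL. f g = h g}"

definition conv_subalgebra :: "('n::finite) mat_fun set \<Rightarrow> bool" where
  "conv_subalgebra A \<longleftrightarrow>
     ae_saturate A = A \<and> cfun.subspace A \<and> (\<forall>f1\<in>A. \<forall>f2\<in>A. conv f1 f2 \<in> A)"

definition conv_commutative :: "('n::finite) mat_fun set \<Rightarrow> bool" where
  "conv_commutative A \<longleftrightarrow>
     (\<forall>f1\<in>A. \<forall>f2\<in>A. AE g in haar_GL. conv f1 f2 g = conv f2 f1 g)"

definition maximal_commutative_subalgebra ::
  "('n::finite) mat_fun set \<Rightarrow> 'n mat_fun set \<Rightarrow> bool" where
  "maximal_commutative_subalgebra A B \<longleftrightarrow>
     A \<subseteq> B \<and> conv_subalgebra A \<and> conv_commutative A \<and>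
     \<not> (\<exists>A'. A \<subset> A' \<and> A' \<subseteq> B \<and> conv_subalgebra A' \<and> conv_commutative A')"


subsection \<open>The Hecke algebras\<close>

definition matrix_coeff ::
  "('n::{finite,linorder}) set \<Rightarrow> 'n set \<Rightarrow> 'n mat_fun" where
  "matrix_coeff \<epsilon> \<epsilon>' g = ext_inner (ext_basis \<epsilon>) (ext_rep g (ext_basis \<epsilon>'))"

text \<open>
  The elements of \<open>hecke\<close> are honestly bi-invariant representatives. Measurability is part of
  integrability, since the matrix coefficient for the empty set is 1.
\<close>

definition hecke :: "('n::{finite,linorder}) mat_fun set" where
  "hecke = {F.
     (\<forall>k1 k2. orthogonal_matrix k1 \<longrightarrow> orthogonal_matrix k2 \<longrightarrow>
        (\<forall>g\<in>GL. F (k1 ** g ** k2) = F g)) \<and>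
     (\<forall>\<epsilon> \<epsilon>'. integrable haar_GL (\<lambda>g. matrix_coeff \<epsilon> \<epsilon>' g * F g))}"

definition twist ::
  "('n::{finite,linorder}) mat_fun \<Rightarrow> 'n set \<Rightarrow> 'n set \<Rightarrow> 'n mat_fun" where
  "twist F \<epsilon> \<epsilon>' g = matrix_coeff \<epsilon> \<epsilon>' g * F g"

definition hecke_W :: "('n::{finite,linorder}) mat_fun set" where
  "hecke_W = ae_saturate
     (cfun.span {twist F \<epsilon> \<epsilon>' |F \<epsilon> \<epsilon>'. F \<in> hecke \<and> card \<epsilon> = card \<epsilon>'})"

definition hecke_W_M :: "('n::{finite,linorder}) mat_fun set" where
  "hecke_W_M = {f \<in> hecke_W.
     \<forall>m\<in>sign_diag. AE g in haar_GL. f (m ** g ** matrix_inv m) = f g}"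

end

theory Submission
  imports Defs
begin

text \<open>
  Averaging over the signed permutation matrices already supplies the Schur
  orthogonality relations for the exterior powers. Substituting \<open>g \<mapsto> g m\<close> with \<open>m\<close> a sign matrix
  multiplies \<open>F\<^bsub>v\<^sub>1,v\<^sub>2\<^esub> * G\<^bsub>v\<^sub>3,v\<^sub>4\<^esub>\<close> by the product of the characters of \<open>m\<close> on \<open>v\<^sub>2\<close> and \<open>v\<^sub>3\<close>, so it
  vanishes unless \<open>v\<^sub>2 = v\<^sub>3\<close>; substituting a permutation matrix shows that \<open>F\<^bsub>v\<^sub>1,v\<^sub>2\<^esub> * G\<^bsub>v\<^sub>2,v\<^sub>4\<^esub>\<close>
  does not depend on \<open>v\<^sub>2\<close>; and its sum over all \<open>v\<^sub>2\<close> is \<open>(F * G)\<^bsub>v\<^sub>1,v\<^sub>4\<^esub>\<close>, since the representation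
  is multiplicative. Commutativity of \<open>F * G\<close> is Gelfand's trick for the transpose.

  For maximality, suppose that \<open>\<Sum> F\<^bsub>\<epsilon>,\<epsilon>'\<^esub>\<close> commutes with \<open>G\<^bsub>\<epsilon>',\<epsilon>'\<^esub>\<close> for every \<open>G\<close>. Comparing matrix
  coefficients gives \<open>F\<^bsub>\<epsilon>,\<epsilon>'\<^esub> * G = 0\<close> for \<open>\<epsilon> \<noteq> \<epsilon>'\<close>, and letting \<open>G\<close> run through the normalised
  indicators of shrinking neighbourhoods of the orthogonal group yields \<open>F\<^bsub>\<epsilon>,\<epsilon>'\<^esub> = 0\<close>.
\<close>

subsection \<open>Lebesgue measure under linear maps\<close>

text \<open>Haar measure is given by a density, so its left invariance rests on the Jacobian of
  multiplication on matrix space; invariance on the right and under inversion is then deduced by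
  transposition and uniqueness. A convolution is an honest integral, with value 0 wherever its
  kernel is not integrable. Substitutions are valid at every point of the group, but additivity only
  almost everywhere; this decides which identities below are pointwise and which carry an
  exceptional null set. The approximate identity has to consist of bi-invariant functions, so its
  supports shrink to the whole orthogonal group and not to the identity matrix. It can therefore
  recover only right-invariant test functions. These suffice, because the set where the real part of
  \<open>F\<close> is positive is itself right invariant. The limit is taken weakly, by integrating
  \<open>conv F G\<close> against Lipschitz functions, which avoids convergence in the norm.\<close>

text \<open>
  Uniqueness of Haar measure by Tonelli's theorem, for an arbitrary operation: it is applied to
  addition, where it shows that a linear map scales Lebesgue measure by a constant, and to matrix
  multiplication, where it gives the invariance under inversion.
\<close>

lemma nn_integral_invariant_unique:
  fixes M N :: "'a measure"
  assumes "sigma_finite_measure M" "sigma_finite_measure N" and sets: "sets N = sets M"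
    and op[measurable]: "(\<lambda>(x, y). op x y) \<in> M \<Otimes>\<^sub>M M \<rightarrow>\<^sub>M M"
    and iv[measurable]: "iv \<in> M \<rightarrow>\<^sub>M M"
    and f[measurable]: "f \<in> borel_measurable M" and h[measurable]: "h \<in> borel_measurable M"
    and right: "\<And>y. y \<in> space M \<Longrightarrow> (\<integral>\<^sup>+x. h (op x y) \<partial>M) = (\<integral>\<^sup>+x. h x \<partial>M)"
    and left: "\<And>y. y \<in> space M \<Longrightarrow> (\<integral>\<^sup>+x. f (op (iv x) y) \<partial>M) = (\<integral>\<^sup>+x. f (iv x) \<partial>M)"
    and left': "\<And>x u. x \<in> space M \<Longrightarrow> u \<in> borel_measurable M \<Longrightarrow>
          (\<integral>\<^sup>+y. u (op (iv x) y) \<partial>N) = (\<integral>\<^sup>+y. u y \<partial>N)"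
    and cancel: "\<And>x y. x \<in> space M \<Longrightarrow> y \<in> space M \<Longrightarrow> op x (op (iv x) y) = y"
  shows "(\<integral>\<^sup>+y. f y \<partial>N) * (\<integral>\<^sup>+x. h x \<partial>M) = (\<integral>\<^sup>+y. h y \<partial>N) * (\<integral>\<^sup>+x. f (iv x) \<partial>M)"
proof -
  interpret M: sigma_finite_measure M by fact
  interpret N: sigma_finite_measure N by fact
  interpret P: pair_sigma_finite M N ..
  note [measurable_cong] = sets
  have space: "space N = space M" using sets by (rule sets_eq_imp_space_eq)
  \<comment> \<open>Both sides evaluate the double integral of \<open>f y * h (op x y)\<close>.
    Right invariance of \<open>M\<close> removes \<open>y\<close> from the inner integral of
    \<open>h\<close>; replacing \<open>y\<close> by \<open>op (iv x) y\<close> under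
    \<open>N\<close> instead moves \<open>x\<close> into \<open>f\<close>, where \<open>left\<close>
    integrates it out.\<close>
  have "(\<integral>\<^sup>+y. f y \<partial>N) * (\<integral>\<^sup>+x. h x \<partial>M) = (\<integral>\<^sup>+y. (\<integral>\<^sup>+x. f y * h (op x y) \<partial>M) \<partial>N)"
    by (subst nn_integral_multc[symmetric]) (auto intro!: nn_integral_cong simp: nn_integral_cmult right space)
  also have "\<dots> = (\<integral>\<^sup>+x. (\<integral>\<^sup>+y. f y * h (op x y) \<partial>N) \<partial>M)"
    by (rule P.Fubini') simp
  also have "\<dots> = (\<integral>\<^sup>+x. (\<integral>\<^sup>+y. f (op (iv x) y) * h y \<partial>N) \<partial>M)"
  proof (rule nn_integral_cong)
    fix x assume x[measurable]: "x \<in> space M"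
    have "(\<integral>\<^sup>+y. f y * h (op x y) \<partial>N) = (\<integral>\<^sup>+y. f (op (iv x) y) * h (op x (op (iv x) y)) \<partial>N)"
      using left'[OF x, of "\<lambda>y. f y * h (op x y)"] by simp
    also have "\<dots> = (\<integral>\<^sup>+y. f (op (iv x) y) * h y \<partial>N)"
      using x by (intro nn_integral_cong) (simp add: cancel space)
    finally show "(\<integral>\<^sup>+y. f y * h (op x y) \<partial>N) = (\<integral>\<^sup>+y. f (op (iv x) y) * h y \<partial>N)" .
  qed
  also have "\<dots> = (\<integral>\<^sup>+y. (\<integral>\<^sup>+x. f (op (iv x) y) * h y \<partial>M) \<partial>N)"
    by (rule P.Fubini'[symmetric]) simp
  also have "\<dots> = (\<integral>\<^sup>+y. h y \<partial>N) * (\<integral>\<^sup>+x. f (iv x) \<partial>M)"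
    by (subst nn_integral_multc[symmetric])
      (auto intro!: nn_integral_cong simp: nn_integral_multc left space mult.commute[of "h _"])
  finally show ?thesis .
qed

lemma nn_integral_lborel_translate:
  fixes f :: "'a::euclidean_space \<Rightarrow> ennreal"
  assumes [measurable]: "f \<in> borel_measurable borel"
  shows "(\<integral>\<^sup>+x. f (x + c) \<partial>lborel) = (\<integral>\<^sup>+x. f x \<partial>lborel)"
proof -
  have "(\<integral>\<^sup>+x. f (c + x) \<partial>lborel) = (\<integral>\<^sup>+x. f x \<partial>distr lborel borel ((+) c))"
    by (subst nn_integral_distr) auto
  then show ?thesis
    by (simp add: lborel_distr_plus add.commute)
qed

text \<open>The image of Lebesgue measure under \<open>T\<close> is again translation invariant, so
  uniqueness makes it a multiple of Lebesgue measure; comparison on the unit ball shows that the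
  factor is finite and positive. Its value is left open here and is later forced by algebraic
  relations.\<close>

lemma nn_integral_lborel_linear:
  fixes T :: "'a::euclidean_space \<Rightarrow> 'a"
  assumes T: "linear T" "inj T"
  shows "\<exists>s>0. \<forall>f\<in>borel_measurable borel.
    (\<integral>\<^sup>+x. f (T x) \<partial>lborel) = ennreal s * (\<integral>\<^sup>+x. f x \<partial>lborel)"
proof -
  obtain T' where T': "linear T'" "\<And>x. T' (T x) = x" "\<And>x. T (T' x) = x"
    using T linear_injective_isomorphism by blast
  have cont: "continuous_on A T" "continuous_on A T'" for A
    using T T' by (simp_all add: linear_continuous_on linear_linear)
  have [measurable]: "T \<in> borel \<rightarrow>\<^sub>M borel" "T' \<in> borel \<rightarrow>\<^sub>M borel"
    using cont by (simp_all add: borel_measurable_continuous_onI)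
  define N where "N = distr lborel borel T"
  have N: "(\<integral>\<^sup>+x. u x \<partial>N) = (\<integral>\<^sup>+x. u (T x) \<partial>lborel)" if "u \<in> borel_measurable borel" for u
    unfolding N_def by (rule nn_integral_distr) (use that in auto)
  have neg: "(\<integral>\<^sup>+x. u (- x) \<partial>lborel) = (\<integral>\<^sup>+x. u x \<partial>lborel)" if "u \<in> borel_measurable borel" for u :: "'a \<Rightarrow> ennreal"
    using that by (subst (2) lborel_affine[of "-1" 0]) (auto simp: nn_integral_density nn_integral_distr)
  have fin_vimage: "emeasure lborel (T -` ball 0 1) < \<infinity>"
  proof -
    have "T -` ball 0 1 \<subseteq> T' ` ball 0 1"
      using T'(2) by (auto intro!: image_eqI[where x = "T _"])
    then have "bounded (T -` ball 0 1)"
      using T' by (meson bounded_ball bounded_linear_image bounded_subset linear_linear)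
    then show ?thesis by (rule emeasure_bounded_finite)
  qed
  have open_vimage: "open (T -` ball 0 1)"
    using cont by (simp add: open_vimage)
  have pos: "emeasure lborel U > 0" if U: "open U" "0 \<in> U" for U :: "'a set"
  proof -
    obtain e where "e > 0" "ball (0::'a) e \<subseteq> U"
      using U by (meson open_contains_ball)
    then have "0 < emeasure lborel (ball (0::'a) e)"
      using content_ball_pos[of e "0::'a"] by (auto simp: measure_def zero_less_iff_neq_zero)
    also have "\<dots> \<le> emeasure lborel U"
      using U \<open>ball 0 e \<subseteq> U\<close> by (intro emeasure_mono) auto
    finally show ?thesis .
  qed
  have unique: "emeasure lborel (T -` ball 0 1) * (\<integral>\<^sup>+x. h x \<partial>lborel)
      = (\<integral>\<^sup>+x. h (T x) \<partial>lborel) * emeasure lborel (ball (0::'a) 1)"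
    if [measurable]: "h \<in> borel_measurable borel" for h
  proof -
    define B :: "'a \<Rightarrow> ennreal" where "B = indicator (ball 0 1)"
    have [measurable]: "B \<in> borel_measurable borel" by (simp add: B_def borel_measurable_indicator)
    have "(\<integral>\<^sup>+y. B y \<partial>N) * (\<integral>\<^sup>+x. h x \<partial>lborel)
      = (\<integral>\<^sup>+y. h y \<partial>N) * (\<integral>\<^sup>+x. B (- x :: 'a) \<partial>lborel)"
    proof (rule nn_integral_invariant_unique[where op = "(+)" and iv = uminus])
      show "sigma_finite_measure (lborel :: 'a measure)" by (rule lborel.sigma_finite_measure_axioms)
      show "sigma_finite_measure N"
      proof (rule sigma_finite_measure_distr)
        \<comment> \<open>Sigma-finiteness is pulled back along \<open>T'\<close>, whose image of
          \<open>N\<close> is Lebesgue measure itself.\<close>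
        have "distr N lborel T' = lborel"
          unfolding N_def by (subst distr_distr) (auto simp: o_def T' distr_id2)
        then show "sigma_finite_measure (distr N lborel T')"
          by (simp add: lborel.sigma_finite_measure_axioms)
      qed (simp add: N_def)
    next
      fix x :: 'a and u :: "'a \<Rightarrow> ennreal" assume "u \<in> borel_measurable lborel"
      then have [measurable]: "u \<in> borel_measurable borel" by simp
      have "(\<integral>\<^sup>+y. u (- x + y) \<partial>N) = (\<integral>\<^sup>+y. u (T (y + T' (- x))) \<partial>lborel)"
        using T T' by (subst N) (auto simp: linear_add algebra_simps)
      also have "\<dots> = (\<integral>\<^sup>+y. u (T y) \<partial>lborel)"
        by (rule nn_integral_lborel_translate) simp
      finally show "(\<integral>\<^sup>+y. u (- x + y) \<partial>N) = (\<integral>\<^sup>+y. u y \<partial>N)"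
        by (simp add: N)
    next
      fix y :: 'a
      have "(\<integral>\<^sup>+x. B (- x + y) \<partial>lborel) = (\<integral>\<^sup>+x. B (x + y) \<partial>lborel)"
        using neg[of "\<lambda>x. B (x + y)"] by simp
      then show "(\<integral>\<^sup>+x. B (- x + y) \<partial>lborel) = (\<integral>\<^sup>+x. B (- x) \<partial>lborel)"
        by (simp add: nn_integral_lborel_translate neg)
    qed (auto simp: N_def nn_integral_lborel_translate)
    moreover have "(\<integral>\<^sup>+x. B (- x :: 'a) \<partial>lborel) = emeasure lborel (ball (0::'a) 1)"
      by (subst neg) (auto simp: B_def borel_measurable_indicator)
    moreover have "(\<integral>\<^sup>+y. B y \<partial>N) = emeasure lborel (T -` ball 0 1)"
      by (simp add: B_def N_def emeasure_distr)
    ultimately show ?thesis by (simp add: N)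
  qed
  define a b where "a = measure lborel (T -` ball 0 1)" and "b = measure lborel (ball (0::'a) 1)"
  have ab: "emeasure lborel (T -` ball 0 1) = ennreal a" "emeasure lborel (ball (0::'a) 1) = ennreal b"
    unfolding a_def b_def using fin_vimage emeasure_lborel_ball_finite[of "0::'a" 1]
    by (simp_all add: emeasure_eq_ennreal_measure less_top)
  have ab_pos: "a > 0" "b > 0"
    using pos[OF open_vimage] pos[of "ball 0 1"] T by (auto simp: ab linear_0)
  show ?thesis
  proof (intro exI conjI ballI)
    show "a / b > 0" using ab_pos by simp
    fix f :: "'a \<Rightarrow> ennreal" assume f: "f \<in> borel_measurable borel"
    have "(\<integral>\<^sup>+x. f (T x) \<partial>lborel) = (\<integral>\<^sup>+x. f (T x) \<partial>lborel) * ennreal b * ennreal (1 / b)"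
      using ab_pos by (simp add: mult.assoc ennreal_mult'[symmetric])
    also have "\<dots> = ennreal a * (\<integral>\<^sup>+x. f x \<partial>lborel) * ennreal (1 / b)"
      using unique[OF f] by (simp add: ab)
    also have "\<dots> = ennreal (a / b) * (\<integral>\<^sup>+x. f x \<partial>lborel)"
      using ab_pos by (simp add: divide_inverse ennreal_mult' mult_ac)
    finally show "(\<integral>\<^sup>+x. f (T x) \<partial>lborel) = ennreal (a / b) * (\<integral>\<^sup>+x. f x \<partial>lborel)" .
  qed
qed

section \<open>Jacobians of matrix multiplication and transposition\<close>

lemma linear_matrix_mult_left: "linear (\<lambda>X::real^'n^'m. (A::real^'m^'k) ** X)"
  by (rule linearI) (simp_all add: matrix_add_ldistrib vec_eq_iff matrix_matrix_mult_def sum_distrib_left sum.distrib algebra_simps)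

lemma borel_measurable_matrix_mult_left [measurable]:
  "(\<lambda>X::real^'n^'m. (A::real^'m^'k) ** X) \<in> borel \<rightarrow>\<^sub>M borel"
  by (intro borel_measurable_continuous_onI linear_continuous_on)
    (simp add: linear_matrix_mult_left linear_linear)

lemma linear_transpose: "linear (transpose :: real^'n^'m \<Rightarrow> real^'m^'n)"
  by (rule linearI) (simp_all add: transpose_def vec_eq_iff)

lemma borel_measurable_transpose [measurable]:
  "(transpose :: real^'n^'m \<Rightarrow> real^'m^'n) \<in> borel \<rightarrow>\<^sub>M borel"
  by (intro borel_measurable_continuous_onI linear_continuous_on)
    (simp add: linear_transpose linear_linear)

lemma prod_Basis_matrix:
  "(\<Prod>b\<in>(Basis :: (real^'n^'m) set). h b) = (\<Prod>i\<in>UNIV. \<Prod>j\<in>UNIV. h (axis i (axis j 1)))"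
proof -
  have "bij_betw (\<lambda>(i, j). axis i (axis j 1)) UNIV (Basis :: (real^'n^'m) set)"
    by (auto simp: bij_betw_def inj_on_def axis_eq_axis Basis_vec_def image_iff)
  then show ?thesis
    by (subst prod.reindex_bij_betw[symmetric]) (auto simp: prod.cartesian_product case_prod_beta')
qed

text \<open>Each diagonal entry scales a whole row of \<open>X\<close>, hence occurs
  \<open>CARD('n)\<close> times in the standard basis of matrix space; this is the origin of the
  exponent. It is the only case in which the factor is computed from coordinates.\<close>

lemma nn_integral_lborel_diagonal_mult:
  fixes A :: "real^'n^'n"
  assumes "\<And>i j. i \<noteq> j \<Longrightarrow> A $ i $ j = 0" "det A \<noteq> 0" and [measurable]: "f \<in> borel_measurable borel"
  shows "ennreal (\<bar>det A\<bar> ^ CARD('n)) * (\<integral>\<^sup>+X. f (A ** X) \<partial>lborel) = (\<integral>\<^sup>+X. f (X::real^'n^'n) \<partial>lborel)"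
proof -
  define c where "c b = (A ** b) \<bullet> b" for b :: "real^'n^'n"
  have entry: "(A ** X) $ i $ j = A $ i $ i * X $ i $ j" for X :: "real^'n^'n" and i j
  proof -
    have "(A ** X) $ i $ j = (\<Sum>k\<in>UNIV. if k = i then A $ i $ i * X $ i $ j else 0)"
      unfolding matrix_matrix_mult_def vec_lambda_beta using assms by (intro sum.cong) auto
    then show ?thesis by simp
  qed
  have c: "c (axis i (axis j 1)) = A $ i $ i" for i j
  proof -
    have "c (axis i (axis j 1)) = (A ** axis i (axis j 1)) $ i $ j"
      by (simp add: c_def inner_axis)
    then show ?thesis unfolding entry by simp
  qed
  have det: "det A = (\<Prod>i\<in>UNIV. A $ i $ i)"
    using assms by (intro det_diagonal) auto
  have T: "A ** X = 0 + (\<Sum>b\<in>Basis. (c b * (X \<bullet> b)) *\<^sub>R b)" for X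
  proof (rule euclidean_eqI)
    fix b :: "real^'n^'n" assume b: "b \<in> Basis"
    then obtain i j where ij: "b = axis i (axis j 1)" by (auto simp: Basis_vec_def)
    have "(0 + (\<Sum>b\<in>Basis. (c b * (X \<bullet> b)) *\<^sub>R b)) \<bullet> b = c b * (X \<bullet> b)"
      using b by (simp add: inner_sum_left inner_Basis if_distrib cong: if_cong)
    also have "\<dots> = (A ** X) \<bullet> b"
      by (simp add: ij c inner_axis entry)
    finally show "(A ** X) \<bullet> b = (0 + (\<Sum>b\<in>Basis. (c b * (X \<bullet> b)) *\<^sub>R b)) \<bullet> b" ..
  qed
  have "c b \<noteq> 0" if b: "b \<in> Basis" for b
  proof -
    obtain i j where ij: "b = axis i (axis j 1)" using b by (auto simp: Basis_vec_def)
    show ?thesis using assms(2) by (simp add: ij c det)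
  qed
  then have "lborel = density (distr lborel borel (\<lambda>X. 0 + (\<Sum>b\<in>Basis. (c b * (X \<bullet> b)) *\<^sub>R b)))
      (\<lambda>_. (\<Prod>b\<in>Basis. \<bar>c b\<bar>))"
    by (rule lborel_affine_euclidean)
  also have "(\<lambda>X. 0 + (\<Sum>b\<in>Basis. (c b * (X \<bullet> b)) *\<^sub>R b)) = (\<lambda>X. A ** X)"
    by (rule ext) (rule T[symmetric])
  also have "(\<Prod>b\<in>Basis. \<bar>c b\<bar>) = \<bar>det A\<bar> ^ CARD('n)"
    by (simp add: prod_Basis_matrix c det abs_prod prod_power_distrib)
  finally have "(\<integral>\<^sup>+X. f X \<partial>lborel) = (\<integral>\<^sup>+X. f X \<partial>density (distr lborel borel (\<lambda>X. A ** X)) (\<lambda>_. \<bar>det A\<bar> ^ CARD('n)))"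
    by simp
  then show ?thesis
    by (simp add: nn_integral_density nn_integral_distr nn_integral_cmult)
qed

lemma nn_integral_lborel_matrix_mult:
  fixes A :: "real^'n^'n"
  assumes "det A \<noteq> 0" "f \<in> borel_measurable borel"
  shows "ennreal (\<bar>det A\<bar> ^ CARD('n)) * (\<integral>\<^sup>+X. f (A ** X) \<partial>lborel) = (\<integral>\<^sup>+X. f (X::real^'n^'n) \<partial>lborel)"
proof -
  \<comment> \<open>\<open>Q A t\<close>: the formula holds for \<open>A\<close> up to the factor \<open>t\<close>. This factor is multiplicative, so the
    relations \<open>S S = 1\<close> for a transposition \<open>S\<close> and \<open>D E = E E D\<close> for a shear \<open>E\<close>
    and a suitable diagonal \<open>D\<close> force it to be 1.\<close>
  define Q where "Q A t \<longleftrightarrow> t > 0 \<and> (\<forall>f\<in>borel_measurable borel.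
    ennreal (\<bar>det A\<bar> ^ CARD('n)) * (\<integral>\<^sup>+X. f (A ** X) \<partial>lborel) = ennreal t * (\<integral>\<^sup>+X. f (X :: real^'n^'n) \<partial>lborel))"
    for A :: "real^'n^'n" and t
  have ex: "\<exists>t. Q A t" if det: "det A \<noteq> 0" for A
  proof -
    obtain A' where A': "A' ** A = mat 1"
      using det by (metis invertible_def invertible_det_nz)
    have inj: "inj (\<lambda>X::real^'n^'n. A ** X)"
      by (rule injI) (metis A' matrix_mul_assoc matrix_mul_lid)
    obtain s where s: "s > 0" "\<And>f. f \<in> borel_measurable borel \<Longrightarrow>
      (\<integral>\<^sup>+X. f (A ** X) \<partial>lborel) = ennreal s * (\<integral>\<^sup>+X. f (X::real^'n^'n) \<partial>lborel)"
      using nn_integral_lborel_linear[OF linear_matrix_mult_left inj] by auto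
    then have "Q A (\<bar>det A\<bar> ^ CARD('n) * s)"
      unfolding Q_def
    proof (intro conjI ballI)
      fix f :: "real^'n^'n \<Rightarrow> ennreal" assume "f \<in> borel_measurable borel"
      then show "ennreal (\<bar>det A\<bar> ^ CARD('n)) * (\<integral>\<^sup>+X. f (A ** X) \<partial>lborel)
        = ennreal (\<bar>det A\<bar> ^ CARD('n) * s) * (\<integral>\<^sup>+X. f X \<partial>lborel)"
        using det s(1) by (simp add: s(2) ennreal_mult' mult.assoc)
    qed (use det s(1) in simp)
    then show ?thesis ..
  qed
  have Q_mult: "Q (A ** B) (t * u)" if "Q A t" "Q B u" for A B t u
  proof -
    have "ennreal (\<bar>det (A ** B)\<bar> ^ CARD('n)) * (\<integral>\<^sup>+X. f (A ** B ** X) \<partial>lborel) = ennreal (t * u) * (\<integral>\<^sup>+X. f X \<partial>lborel)"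
      if [measurable]: "f \<in> borel_measurable borel" for f :: "real^'n^'n \<Rightarrow> ennreal"
    proof -
      have "ennreal (\<bar>det (A ** B)\<bar> ^ CARD('n)) * (\<integral>\<^sup>+X. f (A ** B ** X) \<partial>lborel)
        = ennreal (\<bar>det A\<bar> ^ CARD('n)) * (ennreal (\<bar>det B\<bar> ^ CARD('n)) * (\<integral>\<^sup>+X. f (A ** (B ** X)) \<partial>lborel))"
        by (simp add: det_mul abs_mult power_mult_distrib ennreal_mult' mult.assoc matrix_mul_assoc)
      also have "(ennreal (\<bar>det B\<bar> ^ CARD('n)) * (\<integral>\<^sup>+X. f (A ** (B ** X)) \<partial>lborel)) = ennreal u * (\<integral>\<^sup>+X. f (A ** X) \<partial>lborel)"
        using \<open>Q B u\<close> unfolding Q_def by (auto dest!: bspec[where x = "\<lambda>X. f (A ** X)"])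
      also have "ennreal (\<bar>det A\<bar> ^ CARD('n)) * (ennreal u * (\<integral>\<^sup>+X. f (A ** X) \<partial>lborel))
        = ennreal u * (ennreal (\<bar>det A\<bar> ^ CARD('n)) * (\<integral>\<^sup>+X. f (A ** X) \<partial>lborel))"
        by (simp add: mult_ac)
      also have "ennreal (\<bar>det A\<bar> ^ CARD('n)) * (\<integral>\<^sup>+X. f (A ** X) \<partial>lborel) = ennreal t * (\<integral>\<^sup>+X. f X \<partial>lborel)"
        using \<open>Q A t\<close> unfolding Q_def by simp
      finally show ?thesis
        using \<open>Q A t\<close> by (simp add: Q_def ennreal_mult' mult_ac)
    qed
    then show ?thesis using that by (simp add: Q_def)
  qed
  have unique: "t = u" if "Q A t" "Q A u" for A t u
  proof -
    have "ennreal t * emeasure lborel (ball (0::real^'n^'n) 1) = ennreal u * emeasure lborel (ball (0::real^'n^'n) 1)"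
      using that unfolding Q_def by (metis borel_measurable_indicator nn_integral_indicator borel_open open_ball sets_lborel)
    moreover have "emeasure lborel (ball (0::real^'n^'n) 1) = ennreal (measure lborel (ball (0::real^'n^'n) 1))"
      using emeasure_lborel_ball_finite[of "0::real^'n^'n" 1] by (simp add: emeasure_eq_ennreal_measure less_top)
    moreover have "measure lborel (ball (0::real^'n^'n) 1) > 0" by (rule content_ball_pos) simp
    ultimately show ?thesis using that by (simp add: Q_def flip: ennreal_mult')
  qed
  have diag: "Q A 1" if "\<And>i j. i \<noteq> j \<Longrightarrow> A $ i $ j = 0" "det A \<noteq> 0" for A
    using nn_integral_lborel_diagonal_mult[OF that] by (simp add: Q_def)
  have "det A \<noteq> 0 \<longrightarrow> Q A 1"
  proof (induction A rule: induct_matrix_elementary)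
    case (1 A B)
    then show ?case using Q_mult[of A 1 B 1] by (simp add: det_mul)
  next
    case (2 A i)
    then show ?case using det_zero_row by blast
  next
    case (3 A)
    then show ?case using diag by blast
  next
    case (4 m n)
    let ?S = "(\<chi> i j. mat 1 $ i $ Transposition.transpose m n j) :: real^'n^'n"
    show ?case
    proof
      assume "det ?S \<noteq> 0"
      then obtain t where t: "Q ?S t" using ex by blast
      have "A ** ?S = (\<chi> i j. A $ i $ Transposition.transpose m n j)" for A :: "real^'n^'n"
        by (simp add: matrix_matrix_mult_def mat_def vec_eq_iff if_distrib cong: if_cong)
      from this[of ?S] have "?S ** ?S = mat 1"
        by (simp add: vec_eq_iff)
      then have "Q (mat 1) (t * t)" using Q_mult[OF t t] by simp
      moreover have "Q (mat 1) 1" by (rule diag) (simp add: mat_def, simp)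
      ultimately have "t * t = 1" using unique by blast
      then have "t = 1" using t by (simp add: Q_def square_eq_1_iff)
      then show "Q ?S 1" using t by simp
    qed
  next
    case (5 m n c)
    let ?E = "(\<chi> i j. if i = m \<and> j = n then c else of_bool (i = j)) :: real^'n^'n"
    let ?D = "(\<chi> i j. if i = j then if i = m then 2 else 1 else 0) :: real^'n^'n"
    show ?case
    proof
      assume "det ?E \<noteq> 0"
      then obtain t where t: "Q ?E t" using ex by blast
      have "det ?D = (\<Prod>i\<in>UNIV. if i = m then 2 else 1)"
        by (subst det_diagonal) auto
      then have D: "Q ?D 1" by (intro diag) auto
      have entry: "?E $ i $ k = of_bool (i = k) + (if i = m \<and> k = n then c else 0)" for i k
        using 5 by auto
      have E: "(?E ** X) $ i $ j = X $ i $ j + (if i = m then c * X $ n $ j else 0)" for X :: "real^'n^'n" and i j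
      proof -
        have "(?E ** X) $ i $ j = (\<Sum>k\<in>UNIV. (if k = i then X $ i $ j else 0) + (if k = n then if i = m then c * X $ n $ j else 0 else 0))"
          unfolding matrix_matrix_mult_def vec_lambda_beta[of "\<lambda>i. \<chi> j. _ i j"]
          using 5 by (subst vec_lambda_beta) (auto intro!: sum.cong)
        then show ?thesis by (simp add: sum.distrib)
      qed
      have D': "(?D ** X) $ i $ j = (if i = m then 2 else 1) * X $ i $ j" for X :: "real^'n^'n" and i j
      proof -
        have "(?D ** X) $ i $ j = (\<Sum>k\<in>UNIV. if k = i then (if i = m then 2 else 1) * X $ i $ j else 0)"
          unfolding matrix_matrix_mult_def vec_lambda_beta by (intro sum.cong) auto
        then show ?thesis by simp
      qed
      \<comment> \<open>Doubling row \<open>m\<close> after adding \<open>c\<close> times row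
        \<open>n\<close> to it amounts to doubling it first and adding that multiple twice; row
        \<open>n\<close> is untouched since \<open>m\<close> and \<open>n\<close> differ.\<close>
      have "?D ** ?E = ?E ** (?E ** ?D)"
        unfolding vec_eq_iff E D' using 5 by auto
      then have "Q (?D ** ?E) (t * (t * 1))" using Q_mult[OF t Q_mult[OF t D]] by simp
      moreover have "Q (?D ** ?E) (1 * t)" using Q_mult[OF D t] .
      ultimately have "t * (t * 1) = 1 * t" by (rule unique)
      then have "t = 1" using t by (simp add: Q_def)
      then show "Q ?E 1" using t by simp
    qed
  qed
  then show ?thesis using assms by (simp add: Q_def)
qed

text \<open>Transposition is an involution, so the square of its scaling factor is 1.\<close>

lemma nn_integral_lborel_transpose:
  fixes f :: "real^'n^'n \<Rightarrow> ennreal"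
  assumes [measurable]: "f \<in> borel_measurable borel"
  shows "(\<integral>\<^sup>+X. f (transpose X) \<partial>lborel) = (\<integral>\<^sup>+X. f X \<partial>lborel)"
proof -
  have inj: "inj (transpose :: real^'n^'n \<Rightarrow> _)"
    by (metis injI transpose_transpose)
  obtain s where s: "s > 0" "\<And>f. f \<in> borel_measurable borel \<Longrightarrow>
    (\<integral>\<^sup>+X. f (transpose X) \<partial>lborel) = ennreal s * (\<integral>\<^sup>+X. f (X::real^'n^'n) \<partial>lborel)"
    using nn_integral_lborel_linear[OF linear_transpose inj] by auto
  define B :: "real^'n^'n \<Rightarrow> ennreal" where "B = indicator (ball 0 1)"
  have [measurable]: "B \<in> borel_measurable borel" by (simp add: B_def borel_measurable_indicator)
  have fin: "(\<integral>\<^sup>+X. B X \<partial>lborel) = ennreal (measure lborel (ball (0::real^'n^'n) 1))"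
    using emeasure_lborel_ball_finite[of "0::real^'n^'n" 1] by (simp add: B_def emeasure_eq_ennreal_measure less_top)
  have "(\<integral>\<^sup>+X. B X \<partial>lborel) = ennreal s * (ennreal s * (\<integral>\<^sup>+X. B X \<partial>lborel))"
    using s(2)[of "\<lambda>X. B (transpose X)"] s(2)[of B] by simp
  then have "s * s = 1"
    using s(1) content_ball_pos[of 1 "0::real^'n^'n"] by (simp add: fin flip: ennreal_mult')
  then have "s = 1" using s(1) by (simp add: square_eq_1_iff)
  then show ?thesis using s(2) by simp
qed

subsection \<open>Haar measure on the general linear group\<close>

lemma GL_det: "g \<in> GL \<longleftrightarrow> det g \<noteq> 0" for g :: "real^'n^'n"
  by (simp add: GL_def invertible_det_nz)

lemma continuous_on_det [continuous_intros]:
  fixes f :: "'a::topological_space \<Rightarrow> real^'n^'n"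
  assumes "continuous_on S f"
  shows "continuous_on S (\<lambda>x. det (f x))"
  unfolding det_def using assms by (intro continuous_intros)

lemma borel_measurable_det [measurable]: "det \<in> borel_measurable (borel :: (real^'n^'n) measure)"
  by (intro borel_measurable_continuous_onI continuous_intros)

lemma continuous_on_matrix_mult [continuous_intros]:
  fixes f :: "'a::topological_space \<Rightarrow> real^'n^'m" and g :: "'a \<Rightarrow> real^'k^'n"
  assumes "continuous_on S f" "continuous_on S g"
  shows "continuous_on S (\<lambda>x. f x ** g x)"
  unfolding matrix_matrix_mult_def using assms by (intro continuous_intros)

lemma open_GL: "open (GL :: (real^'n^'n) set)"
proof -
  have "closed {g :: real^'n^'n. det g = 0}"
    by (intro closed_Collect_eq continuous_intros)
  moreover have "GL = - {g :: real^'n^'n. det g = 0}" by (auto simp: GL_det)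
  ultimately show ?thesis by (metis open_Compl)
qed

lemma matrix_inv_GL:
  fixes g :: "real^'n^'n"
  assumes "g \<in> GL"
  shows "g ** matrix_inv g = mat 1" "matrix_inv g ** g = mat 1" "matrix_inv g \<in> GL"
proof -
  have "g ** matrix_inv g = mat 1 \<and> matrix_inv g ** g = mat 1"
    using assms someI_ex[of "\<lambda>A. g ** A = mat 1 \<and> A ** g = mat 1"]
    by (simp add: GL_def invertible_def matrix_inv_def)
  then show "g ** matrix_inv g = mat 1" "matrix_inv g ** g = mat 1" "matrix_inv g \<in> GL"
    by (auto simp: GL_def invertible_def)
qed

lemma matrix_inv_unique_GL:
  fixes g h :: "real^'n^'n"
  assumes "g ** h = mat 1"
  shows "matrix_inv g = h"
proof -
  have "g \<in> GL"
    using assms by (metis GL_def invertible_def matrix_left_right_inverse mem_Collect_eq)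
  then show ?thesis
    using assms by (metis matrix_inv_GL(2) matrix_mul_assoc matrix_mul_lid matrix_mul_rid)
qed

lemma GL_mult: "g \<in> GL \<Longrightarrow> h \<in> GL \<Longrightarrow> g ** h \<in> GL" for g h :: "real^'n^'n"
  by (simp add: GL_det det_mul)

lemma matrix_inv_mult_GL:
  fixes g h :: "real^'n^'n"
  assumes "g \<in> GL" "h \<in> GL"
  shows "matrix_inv (g ** h) = matrix_inv h ** matrix_inv g"
  by (rule matrix_inv_unique_GL)
    (metis assms matrix_inv_GL(1) matrix_mul_assoc matrix_mul_lid)

text \<open>Cramer's rule writes each entry of the inverse as a quotient of determinants.\<close>

lemma continuous_on_matrix_inv: "continuous_on GL (matrix_inv :: real^'n^'n \<Rightarrow> _)"
proof -
  have cramer_inv: "matrix_inv g $ i $ j = det (\<chi> k l. if l = i then axis j 1 $ k else g $ k $ l) / det g"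
    if "g \<in> GL" for g :: "real^'n^'n" and i j
  proof -
    have "g *v (matrix_inv g *v axis j 1) = axis j 1"
      using that by (simp add: matrix_vector_mul_assoc matrix_inv_GL)
    then have "matrix_inv g *v axis j 1 = (\<chi> i. det (\<chi> k l. if l = i then axis j 1 $ k else g $ k $ l) / det g)"
      using that by (subst cramer[symmetric]) (simp_all add: GL_det)
    then show ?thesis
      by (metis (no_types, lifting) column_def matrix_vector_mul_component matrix_vector_mult_basis vec_lambda_beta)
  qed
  have "continuous_on GL (\<lambda>g::real^'n^'n. \<chi> i j. det (\<chi> k l. if l = i then axis j 1 $ k else g $ k $ l) / det g)"
  proof (intro continuous_intros continuous_on_vec_lambda)
    fix i j k l :: 'n
    show "continuous_on GL (\<lambda>x. if l = i then axis j 1 $ k else x $ k $ l)"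
      by (cases "l = i") (auto intro!: continuous_intros)
  qed (auto simp: GL_det)
  then show ?thesis
    by (rule continuous_on_eq) (simp add: cramer_inv vec_eq_iff)
qed

lemma space_haar_GL [simp]: "space haar_GL = GL"
  by (simp add: haar_GL_def space_restrict_space)

lemma sets_haar_GL: "sets haar_GL = sets (restrict_space borel GL)"
  by (simp add: haar_GL_def sets_restrict_space)

lemma measurable_from_haar_GL:
  "f \<in> haar_GL \<rightarrow>\<^sub>M N \<longleftrightarrow> f \<in> restrict_space borel GL \<rightarrow>\<^sub>M N"
  by (simp only: measurable_cong_sets[OF sets_haar_GL refl])

lemma measurable_to_haar_GL:
  "f \<in> N \<rightarrow>\<^sub>M haar_GL \<longleftrightarrow> f \<in> N \<rightarrow>\<^sub>M restrict_space borel GL"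
  by (simp only: measurable_cong_sets[OF refl sets_haar_GL])

lemma measurable_haar_GL_continuous:
  "continuous_on GL f \<Longrightarrow> f \<in> borel_measurable haar_GL"
  by (simp add: measurable_from_haar_GL measurable_to_haar_GL borel_measurable_continuous_on_restrict)

lemma nn_integral_haar_GL:
  assumes "f \<in> borel_measurable haar_GL"
  shows "(\<integral>\<^sup>+g. f g \<partial>haar_GL) =
    (\<integral>\<^sup>+g. f g * indicator GL g * ennreal (1 / \<bar>det g\<bar> ^ CARD('n)) \<partial>(lborel :: (real^'n^'n) measure))"
proof -
  have "(\<integral>\<^sup>+g. f g \<partial>haar_GL) = (\<integral>\<^sup>+g. ennreal (1 / \<bar>det g\<bar> ^ CARD('n)) * f g \<partial>restrict_space lborel GL)"
    unfolding haar_GL_def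
  proof (rule nn_integral_density)
    show "(\<lambda>g::real^'n^'n. ennreal (1 / \<bar>det g\<bar> ^ CARD('n))) \<in> borel_measurable (restrict_space lborel GL)"
      by (rule measurable_restrict_space1) simp
    show "f \<in> borel_measurable (restrict_space lborel GL)"
      using assms by (simp add: haar_GL_def)
  qed
  also have "\<dots> = (\<integral>\<^sup>+g. ennreal (1 / \<bar>det g\<bar> ^ CARD('n)) * f g * indicator GL g \<partial>lborel)"
    by (rule nn_integral_restrict_space) (simp add: open_GL)
  finally show ?thesis by (simp add: mult_ac)
qed

text \<open>The Jacobian of left multiplication cancels the factor that the density acquires from
  \<open>det (a ** g)\<close>.\<close>

lemma nn_integral_haar_GL_left:
  fixes f :: "real^'n^'n \<Rightarrow> ennreal"
  assumes f: "f \<in> borel_measurable haar_GL" and a: "a \<in> GL"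
  shows "(\<integral>\<^sup>+g. f (a ** g) \<partial>haar_GL) = (\<integral>\<^sup>+g. f g \<partial>haar_GL)"
proof -
  define F where "F g = f g * indicator GL g * ennreal (1 / \<bar>det g\<bar> ^ CARD('n))" for g
  have [measurable]: "(\<lambda>g. f g * indicator GL g) \<in> borel_measurable borel"
    using f by (simp add: measurable_from_haar_GL borel_measurable_restrict_space_iff_ennreal borel_open open_GL)
  have F[measurable]: "F \<in> borel_measurable borel"
    unfolding F_def by measurable
  have [measurable]: "(\<lambda>g. a ** g) \<in> haar_GL \<rightarrow>\<^sub>M haar_GL"
    unfolding measurable_from_haar_GL measurable_to_haar_GL using a
    by (intro measurable_restrict_space2 borel_measurable_continuous_on_restrict continuous_intros)
      (auto simp: space_restrict_space GL_mult)
  note f[measurable]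
  have "(\<integral>\<^sup>+g. f (a ** g) \<partial>haar_GL) = (\<integral>\<^sup>+g. f (a ** g) * indicator GL g * ennreal (1 / \<bar>det g\<bar> ^ CARD('n)) \<partial>lborel)"
    by (rule nn_integral_haar_GL) simp
  also have "\<dots> = (\<integral>\<^sup>+g. ennreal (\<bar>det a\<bar> ^ CARD('n)) * F (a ** g) \<partial>lborel)"
    using a by (intro nn_integral_cong)
      (auto simp: F_def GL_det det_mul abs_mult power_mult_distrib indicator_def mult_ac
        simp flip: ennreal_mult' intro!: arg_cong2[where f = "(*)"])
  also have "\<dots> = ennreal (\<bar>det a\<bar> ^ CARD('n)) * (\<integral>\<^sup>+g. F (a ** g) \<partial>lborel)"
    by (rule nn_integral_cmult) simp
  also have "\<dots> = (\<integral>\<^sup>+g. F g \<partial>lborel)"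
    using a by (intro nn_integral_lborel_matrix_mult) (auto simp: GL_det)
  also have "\<dots> = (\<integral>\<^sup>+g. f g \<partial>haar_GL)"
    by (simp add: nn_integral_haar_GL F_def)
  finally show ?thesis .
qed

lemma nn_integral_haar_GL_transpose:
  fixes f :: "real^'n^'n \<Rightarrow> ennreal"
  assumes f: "f \<in> borel_measurable haar_GL"
  shows "(\<integral>\<^sup>+g. f (transpose g) \<partial>haar_GL) = (\<integral>\<^sup>+g. f g \<partial>haar_GL)"
proof -
  define F where "F g = f g * indicator GL g * ennreal (1 / \<bar>det g\<bar> ^ CARD('n))" for g
  have [measurable]: "(\<lambda>g. f g * indicator GL g) \<in> borel_measurable borel"
    using f by (simp add: measurable_from_haar_GL borel_measurable_restrict_space_iff_ennreal borel_open open_GL)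
  have F[measurable]: "F \<in> borel_measurable borel"
    unfolding F_def by measurable
  have [measurable]: "transpose \<in> haar_GL \<rightarrow>\<^sub>M (haar_GL :: (real^'n^'n) measure)"
    unfolding measurable_from_haar_GL measurable_to_haar_GL
    by (intro measurable_restrict_space2 measurable_restrict_space1 borel_measurable_transpose)
      (auto simp: space_restrict_space GL_det)
  note f[measurable]
  have "(\<integral>\<^sup>+g. f (transpose g) \<partial>haar_GL) = (\<integral>\<^sup>+g. f (transpose g) * indicator GL g * ennreal (1 / \<bar>det g\<bar> ^ CARD('n)) \<partial>lborel)"
    by (rule nn_integral_haar_GL) simp
  also have "\<dots> = (\<integral>\<^sup>+g. F (transpose g) \<partial>lborel)"
    by (intro nn_integral_cong) (auto simp: F_def GL_det indicator_def)
  also have "\<dots> = (\<integral>\<^sup>+g. F g \<partial>lborel)"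
    by (rule nn_integral_lborel_transpose) simp
  also have "\<dots> = (\<integral>\<^sup>+g. f g \<partial>haar_GL)"
    by (simp add: nn_integral_haar_GL F_def f)
  finally show ?thesis .
qed

lemma measurable_GL_mult [measurable]:
  fixes f g :: "'a \<Rightarrow> real^'n^'n"
  assumes "f \<in> M \<rightarrow>\<^sub>M haar_GL" "g \<in> M \<rightarrow>\<^sub>M haar_GL"
  shows "(\<lambda>x. f x ** g x) \<in> M \<rightarrow>\<^sub>M haar_GL"
proof -
  have fg: "f \<in> borel_measurable M" "g \<in> borel_measurable M" "f \<in> space M \<rightarrow> GL" "g \<in> space M \<rightarrow> GL"
    using assms by (auto simp: measurable_to_haar_GL measurable_restrict_space2_iff)
  have "(\<lambda>x. (f x, g x)) \<in> M \<rightarrow>\<^sub>M borel"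
    using fg by simp
  moreover have "(\<lambda>(x, y). x ** y) \<in> borel_measurable (borel :: ((real^'n^'n) \<times> (real^'n^'n)) measure)"
    by (intro borel_measurable_continuous_onI) (auto simp: case_prod_beta' intro!: continuous_intros)
  ultimately have "(\<lambda>x. f x ** g x) \<in> borel_measurable M"
    using measurable_compose[of "\<lambda>x. (f x, g x)" M borel "\<lambda>(x, y). x ** y" borel] by simp
  then show ?thesis
    using fg by (auto simp: measurable_to_haar_GL measurable_restrict_space2_iff intro!: GL_mult)
qed

lemma measurable_GL_inv [measurable]: "matrix_inv \<in> haar_GL \<rightarrow>\<^sub>M (haar_GL :: (real^'n^'n) measure)"
  unfolding measurable_from_haar_GL measurable_to_haar_GL
  by (intro measurable_restrict_space2 borel_measurable_continuous_on_restrict continuous_on_matrix_inv)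
    (auto simp: space_restrict_space matrix_inv_GL)

lemma measurable_GL_transpose [measurable]: "transpose \<in> haar_GL \<rightarrow>\<^sub>M (haar_GL :: (real^'n^'n) measure)"
  unfolding measurable_from_haar_GL measurable_to_haar_GL
  by (intro measurable_restrict_space2 measurable_restrict_space1 borel_measurable_transpose)
    (auto simp: space_restrict_space GL_det)

text \<open>Unimodularity: transposition preserves the measure and turns right multiplication into
  left multiplication.\<close>

lemma nn_integral_haar_GL_right:
  fixes f :: "real^'n^'n \<Rightarrow> ennreal"
  assumes f[measurable]: "f \<in> borel_measurable haar_GL" and a: "a \<in> GL"
  shows "(\<integral>\<^sup>+g. f (g ** a) \<partial>haar_GL) = (\<integral>\<^sup>+g. f g \<partial>haar_GL)"
proof -
  have [measurable]: "a \<in> space haar_GL" "transpose a \<in> space haar_GL" using a by (auto simp: GL_det)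
  have "(\<integral>\<^sup>+g. f (g ** a) \<partial>haar_GL) = (\<integral>\<^sup>+g. f (transpose g ** a) \<partial>haar_GL)"
    by (rule nn_integral_haar_GL_transpose[symmetric]) simp
  also have "\<dots> = (\<integral>\<^sup>+g. f (transpose (transpose a ** g)) \<partial>haar_GL)"
    by (simp add: matrix_transpose_mul)
  also have "\<dots> = (\<integral>\<^sup>+g. f (transpose g) \<partial>haar_GL)"
    by (rule nn_integral_haar_GL_left[where f = "\<lambda>g. f (transpose g)"]) (use a in \<open>auto simp: GL_det\<close>)
  also have "\<dots> = (\<integral>\<^sup>+g. f g \<partial>haar_GL)"
    by (rule nn_integral_haar_GL_transpose) simp
  finally show ?thesis .
qed

lemma sigma_finite_haar_GL: "sigma_finite_measure (haar_GL :: (real^'n^'n) measure)"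
proof -
  interpret restrict_lborel: sigma_finite_measure "restrict_space lborel (GL :: (real^'n^'n) set)"
    by (rule sigma_finite_measure_restrict_space) (auto simp: open_GL lborel.sigma_finite_measure_axioms)
  show ?thesis
    unfolding haar_GL_def
    by (subst restrict_lborel.sigma_finite_iff_density_finite) (auto intro!: measurable_restrict_space1)
qed

lemma emeasure_haar_GL_bounded:
  fixes U :: "(real^'n^'n) set"
  assumes "U \<in> sets borel" "bounded U" "c > 0" "\<And>g. g \<in> U \<Longrightarrow> \<bar>det g\<bar> \<ge> c"
  shows "emeasure haar_GL U < \<infinity>"
proof -
  have UGL: "U \<subseteq> GL" using assms by (force simp: GL_det)
  then have U: "U \<in> sets haar_GL"
    using assms by (auto simp: sets_haar_GL sets_restrict_space_iff open_GL)
  have "emeasure haar_GL U = (\<integral>\<^sup>+g. indicator U g \<partial>haar_GL)" using U by simp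
  also have "\<dots> = (\<integral>\<^sup>+g. indicator U g * indicator GL g * ennreal (1 / \<bar>det g\<bar> ^ CARD('n)) \<partial>lborel)"
    using U by (intro nn_integral_haar_GL) simp
  also have "\<dots> \<le> (\<integral>\<^sup>+g. ennreal (1 / c ^ CARD('n)) * indicator U g \<partial>lborel)"
    using assms by (intro nn_integral_mono)
      (auto simp: indicator_def intro!: ennreal_leI divide_left_mono power_mono mult_pos_pos zero_less_power dest: less_le_trans)
  also have "\<dots> = ennreal (1 / c ^ CARD('n)) * emeasure lborel U"
    using assms by (simp add: nn_integral_cmult_indicator)
  also have "\<dots> < \<infinity>"
    using emeasure_bounded_finite[OF assms(2)] by (simp add: ennreal_mult_less_top)
  finally show ?thesis .
qed

lemma AE_haar_GL_iff:
  fixes P :: "real^'n^'n \<Rightarrow> bool"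
  shows "(AE g in haar_GL. P g) \<longleftrightarrow> (AE g in lborel. g \<in> GL \<longrightarrow> P g)"
proof -
  have "(AE g in haar_GL. P g) \<longleftrightarrow> (AE g in restrict_space lborel GL. 0 < ennreal (1 / \<bar>det g\<bar> ^ CARD('n)) \<longrightarrow> P g)"
    unfolding haar_GL_def by (rule AE_density) (auto intro!: measurable_restrict_space1)
  also have "\<dots> \<longleftrightarrow> (AE g in lborel. g \<in> GL \<longrightarrow> 0 < ennreal (1 / \<bar>det g\<bar> ^ CARD('n)) \<longrightarrow> P g)"
    by (rule AE_restrict_space_iff) (simp add: open_GL)
  also have "\<dots> \<longleftrightarrow> (AE g in lborel. g \<in> GL \<longrightarrow> P g)"
    by (intro AE_cong) (auto simp: GL_det)
  finally show ?thesis .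
qed

lemma emeasure_haar_GL_open:
  fixes U :: "(real^'n^'n) set"
  assumes U: "open U" "a \<in> U" "U \<subseteq> GL"
  shows "emeasure haar_GL U > 0"
proof (rule ccontr)
  assume "\<not> emeasure haar_GL U > 0"
  then have "U \<in> null_sets haar_GL"
    using U by (auto simp: null_sets_def sets_haar_GL sets_restrict_space_iff open_GL)
  then have "AE g in lborel. g \<in> GL \<longrightarrow> g \<notin> U"
    by (simp add: AE_not_in flip: AE_haar_GL_iff)
  then have "AE g in lborel. g \<notin> U"
    using U by (auto elim!: eventually_mono)
  then have "U \<in> null_sets lborel"
    using U by (subst AE_iff_null_sets) auto
  then have "negligible U"
    unfolding negligible_iff_null_sets by (rule null_sets_completionI)
  then show False
    using open_not_negligible[of U] U by auto
qed

text \<open>Right invariance makes the image of Haar measure under inversion left invariant, so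
  uniqueness reduces the claim to finding one constant.\<close>

lemma nn_integral_haar_GL_inv:
  fixes f :: "real^'n^'n \<Rightarrow> ennreal"
  assumes f[measurable]: "f \<in> borel_measurable haar_GL"
  shows "(\<integral>\<^sup>+g. f (matrix_inv g) \<partial>haar_GL) = (\<integral>\<^sup>+g. f g \<partial>haar_GL)"
proof -
  define N where "N = distr haar_GL (haar_GL :: (real^'n^'n) measure) matrix_inv"
  have N: "(\<integral>\<^sup>+g. u g \<partial>N) = (\<integral>\<^sup>+g. u (matrix_inv g) \<partial>haar_GL)" if [measurable]: "u \<in> borel_measurable haar_GL" for u
    unfolding N_def by (rule nn_integral_distr) auto
  have inv_inv: "matrix_inv (matrix_inv g) = g" if "g \<in> GL" for g :: "real^'n^'n"
    using that by (intro matrix_inv_unique_GL) (simp add: matrix_inv_GL)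
  have "isCont det (mat 1 :: real^'n^'n)"
    using continuous_on_det[OF continuous_on_id, of "UNIV :: (real^'n^'n) set"] by (simp add: continuous_on_eq_continuous_at)
  then obtain e where e: "e > 0" "\<And>g::real^'n^'n. dist g (mat 1) < e \<Longrightarrow> dist (det g) (det (mat 1 :: real^'n^'n)) < 1/2"
    by (metis continuous_at_eps_delta half_gt_zero zero_less_one dist_commute)
  \<comment> \<open>The determinant stays near 1 on this ball, so the density is bounded and
    \<open>U\<close> has finite measure; being open, it has positive measure. Both facts are needed
    to cancel \<open>emeasure haar_GL U\<close> at the end.\<close>
  define U where "U = ball (mat 1 :: real^'n^'n) e"
  have det_U: "\<bar>det g\<bar> \<ge> 1/2" if "g \<in> U" for g
  proof -
    have "\<bar>det g - 1\<bar> < 1/2"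
      using e(2)[of g] that by (auto simp: U_def dist_real_def dist_commute)
    then show ?thesis by linarith
  qed
  have U_GL: "U \<subseteq> GL" using det_U by (force simp: GL_det)
  have fin: "emeasure haar_GL U < \<infinity>"
    by (rule emeasure_haar_GL_bounded[where c = "1/2"]) (use det_U in \<open>auto simp: U_def\<close>)
  have pos: "emeasure haar_GL U > 0"
    by (rule emeasure_haar_GL_open[of _ "mat 1"]) (use e U_GL in \<open>auto simp: U_def\<close>)
  have [measurable]: "U \<in> sets haar_GL"
    using U_GL by (auto simp: U_def sets_haar_GL sets_restrict_space_iff open_GL)
  \<comment> \<open>Composing the indicator with inversion makes both comparison integrals equal to
    \<open>emeasure haar_GL U\<close>, so the constant is 1 although \<open>U\<close> may fail to be
    closed under inversion.\<close>
  define B where "B g = (indicator U (matrix_inv g) :: ennreal)" for g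
  have [measurable]: "B \<in> borel_measurable haar_GL"
    unfolding B_def by measurable
  have "(\<integral>\<^sup>+g. B g \<partial>N) * (\<integral>\<^sup>+g. f g \<partial>haar_GL) = (\<integral>\<^sup>+g. f g \<partial>N) * (\<integral>\<^sup>+g. B (matrix_inv g) \<partial>haar_GL)"
  proof (rule nn_integral_invariant_unique[where op = "(**)"])
    show "sigma_finite_measure N"
    proof (rule sigma_finite_measure_distr)
      have "distr N haar_GL matrix_inv = distr haar_GL (haar_GL :: (real^'n^'n) measure) (\<lambda>g. matrix_inv (matrix_inv g))"
        unfolding N_def by (subst distr_distr) (auto simp: o_def)
      also have "\<dots> = distr haar_GL haar_GL (\<lambda>g. g)"
        by (rule distr_cong) (simp_all add: inv_inv)
      finally have "distr N haar_GL matrix_inv = distr haar_GL haar_GL (\<lambda>g::real^'n^'n. g)" .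
      then show "sigma_finite_measure (distr N haar_GL matrix_inv)"
        by (simp add: distr_id2 sigma_finite_haar_GL)
    qed (simp add: N_def)
    fix x :: "real^'n^'n" and u :: "real^'n^'n \<Rightarrow> ennreal"
    assume x: "x \<in> space haar_GL" and u[measurable]: "u \<in> borel_measurable haar_GL"
    then have [measurable]: "matrix_inv x \<in> space haar_GL" "x \<in> space haar_GL" by (auto simp: matrix_inv_GL)
    have "(\<integral>\<^sup>+g. u (matrix_inv x ** g) \<partial>N) = (\<integral>\<^sup>+g. u (matrix_inv (g ** x)) \<partial>haar_GL)"
      using x by (subst N) (auto intro!: nn_integral_cong simp: matrix_inv_mult_GL)
    also have "\<dots> = (\<integral>\<^sup>+g. u g \<partial>N)"
      using x by (subst nn_integral_haar_GL_right[where f = "\<lambda>g. u (matrix_inv g)"]) (auto simp: N)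
    finally show "(\<integral>\<^sup>+g. u (matrix_inv x ** g) \<partial>N) = (\<integral>\<^sup>+g. u g \<partial>N)" .
  next
    fix y :: "real^'n^'n" assume y: "y \<in> space haar_GL"
    then have [measurable]: "matrix_inv y \<in> space haar_GL" "y \<in> space haar_GL" by (auto simp: matrix_inv_GL)
    have "(\<integral>\<^sup>+x. B (matrix_inv x ** y) \<partial>haar_GL) = (\<integral>\<^sup>+x. B (matrix_inv (matrix_inv y ** x)) \<partial>haar_GL)"
      using y by (intro nn_integral_cong) (simp add: matrix_inv_mult_GL matrix_inv_GL inv_inv)
    also have "\<dots> = (\<integral>\<^sup>+x. B (matrix_inv x) \<partial>haar_GL)"
      using y by (intro nn_integral_haar_GL_left[where f = "\<lambda>x. B (matrix_inv x)"]) (auto simp: matrix_inv_GL)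
    finally show "(\<integral>\<^sup>+x. B (matrix_inv x ** y) \<partial>haar_GL) = (\<integral>\<^sup>+x. B (matrix_inv x) \<partial>haar_GL)" .
  qed (auto simp: sigma_finite_haar_GL N_def nn_integral_haar_GL_right matrix_mul_assoc matrix_inv_GL)
  moreover have "(\<integral>\<^sup>+g. B (matrix_inv g) \<partial>haar_GL) = (\<integral>\<^sup>+g. indicator U g \<partial>haar_GL)"
    by (intro nn_integral_cong) (simp add: B_def inv_inv)
  ultimately have "emeasure haar_GL U * (\<integral>\<^sup>+g. f g \<partial>haar_GL) = emeasure haar_GL U * (\<integral>\<^sup>+g. f (matrix_inv g) \<partial>haar_GL)"
    by (simp add: N mult.commute)
  then show ?thesis
    using fin pos by (auto simp: ennreal_mult_cancel_left)
qed

subsection \<open>Matrix coefficients of the exterior algebra\<close>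

lemma ext_vec_nth: "ext_vec u $ S = (\<Sum>i\<in>UNIV. if S = {i} then u $ i else 0)"
  unfolding ext_vec_def by (simp add: axis_def if_distrib cong: if_cong)

text \<open>When the left factor is a vector, only singletons contribute, and the inversions are the
  elements of \<open>S\<close> below the chosen index, as in a Laplace expansion.\<close>

lemma wedge_ext_vec_nth:
  "wedge (ext_vec u) x $ S = (\<Sum>i\<in>S. (-1) ^ card {j \<in> S. j < i} * u $ i * x $ (S - {i}))"
proof -
  let ?f = "\<lambda>I. (-1) ^ card {(i, j). i \<in> I \<and> j \<in> S - I \<and> j < i} * ext_vec u $ I * x $ (S - I)"
  have "wedge (ext_vec u) x $ S = (\<Sum>I\<in>Pow S. ?f I)"
    by (simp add: wedge_def)
  also have "\<dots> = (\<Sum>I\<in>(\<lambda>i. {i}) ` S. ?f I)"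
  proof (rule sum.mono_neutral_right)
    show "\<forall>I\<in>Pow S - (\<lambda>i. {i}) ` S. ?f I = 0"
    proof
      fix I assume "I \<in> Pow S - (\<lambda>i. {i}) ` S"
      then have "I \<noteq> {i}" for i by auto
      then show "?f I = 0" by (simp add: ext_vec_nth)
    qed
  qed auto
  also have "\<dots> = (\<Sum>i\<in>S. ?f {i})"
    by (subst sum.reindex) auto
  also have "\<dots> = (\<Sum>i\<in>S. (-1) ^ card {j \<in> S. j < i} * u $ i * x $ (S - {i}))"
  proof (rule sum.cong)
    fix i assume "i \<in> S"
    have "{(k, j). k \<in> {i} \<and> j \<in> S - {i} \<and> j < k} = Pair i ` {j \<in> S. j < i}" by auto
    then have "card {(k, j). k \<in> {i} \<and> j \<in> S - {i} \<and> j < k} = card {j \<in> S. j < i}"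
      by (simp add: card_image inj_on_def)
    then show "?f {i} = (-1) ^ card {j \<in> S. j < i} * u $ i * x $ (S - {i})"
      by (simp add: ext_vec_nth)
  qed simp
  finally show ?thesis .
qed

lemma wedge_ext_vec_linear:
  "wedge (ext_vec (u + v)) x = wedge (ext_vec u) x + wedge (ext_vec v) x"
  "wedge (ext_vec (c *s u)) x = c *s wedge (ext_vec u) x"
  "wedge (ext_vec u) (x + y) = wedge (ext_vec u) x + wedge (ext_vec u) y"
  "wedge (ext_vec u) (c *s x) = c *s wedge (ext_vec u) x"
  "wedge (ext_vec u) 0 = 0"
  by (simp_all add: vec_eq_iff wedge_ext_vec_nth sum.distrib sum_distrib_left algebra_simps)

lemma wedge_ext_vec_sum:
  "wedge (ext_vec (\<Sum>i\<in>A. v i)) x = (\<Sum>i\<in>A. wedge (ext_vec (v i)) x)"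
  "wedge (ext_vec u) (\<Sum>i\<in>A. y i) = (\<Sum>i\<in>A. wedge (ext_vec u) (y i))"
proof -
  have "wedge (ext_vec 0) x = 0"
    by (simp add: vec_eq_iff wedge_ext_vec_nth)
  then show "wedge (ext_vec (\<Sum>i\<in>A. v i)) x = (\<Sum>i\<in>A. wedge (ext_vec (v i)) x)"
    by (induction A rule: infinite_finite_induct) (simp_all add: wedge_ext_vec_linear)
  show "wedge (ext_vec u) (\<Sum>i\<in>A. y i) = (\<Sum>i\<in>A. wedge (ext_vec u) (y i))"
    by (induction A rule: infinite_finite_induct) (simp_all add: wedge_ext_vec_linear)
qed

text \<open>Both composites expand over ordered pairs of distinct indices in \<open>S\<close>.
  Removing the smaller index first lowers the rank of the larger one by one, whereas removing the
  larger first leaves the rank of the smaller alone; hence the two orders carry opposite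
  signs.\<close>

lemma wedge_ext_vec_anticommute:
  "wedge (ext_vec u) (wedge (ext_vec v) x) = - wedge (ext_vec v) (wedge (ext_vec u) x)"
proof -
  define \<sigma> where "\<sigma> S i j = (-1 :: complex) ^ (card {k \<in> S. k < i} + card {k \<in> S - {i}. k < j})"
    for S :: "'a set" and i j
  have \<sigma>: "\<sigma> S i j = - \<sigma> S j i" if less: "i < j" and S: "i \<in> S" "j \<in> S" for S i j
  proof -
    have "{k \<in> S. k < j} = insert i {k \<in> S - {i}. k < j}" "{k \<in> S - {j}. k < i} = {k \<in> S. k < i}"
      using less S by auto
    then show ?thesis by (simp add: \<sigma>_def add.commute)
  qed
  have expand: "wedge (ext_vec u) (wedge (ext_vec v) x) $ S =
    (\<Sum>i\<in>S. \<Sum>j\<in>S. if i = j then 0 else \<sigma> S i j * (u $ i * v $ j * x $ (S - {i, j})))" for u v S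
  proof -
    have "wedge (ext_vec u) (wedge (ext_vec v) x) $ S =
      (\<Sum>i\<in>S. \<Sum>j\<in>S - {i}. \<sigma> S i j * (u $ i * v $ j * x $ (S - {i, j})))"
      by (auto simp: wedge_ext_vec_nth sum_distrib_left \<sigma>_def power_add mult_ac Diff_insert2[symmetric]
          insert_commute intro!: sum.cong)
    also have "\<dots> = (\<Sum>i\<in>S. \<Sum>j\<in>S. if i = j then 0 else \<sigma> S i j * (u $ i * v $ j * x $ (S - {i, j})))"
      by (intro sum.cong sum.mono_neutral_cong_left) auto
    finally show ?thesis .
  qed
  have "wedge (ext_vec u) (wedge (ext_vec v) x) $ S = - wedge (ext_vec v) (wedge (ext_vec u) x) $ S" for S
  proof -
    have "wedge (ext_vec u) (wedge (ext_vec v) x) $ S =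
      (\<Sum>j\<in>S. \<Sum>i\<in>S. if i = j then 0 else \<sigma> S i j * (u $ i * v $ j * x $ (S - {i, j})))"
      unfolding expand by (rule sum.swap)
    also have "\<dots> = (\<Sum>j\<in>S. \<Sum>i\<in>S. - (if j = i then 0 else \<sigma> S j i * (v $ j * u $ i * x $ (S - {j, i}))))"
    proof (intro sum.cong refl)
      fix i j assume S: "i \<in> S" "j \<in> S"
      show "(if i = j then 0 else \<sigma> S i j * (u $ i * v $ j * x $ (S - {i, j}))) =
        - (if j = i then 0 else \<sigma> S j i * (v $ j * u $ i * x $ (S - {j, i})))"
        using \<sigma>[of i j S] \<sigma>[of j i S] S by (cases i j rule: linorder_cases) (auto simp: insert_commute)
    qed
    finally show ?thesis by (simp add: expand sum_negf)
  qed
  then show ?thesis by (simp add: vec_eq_iff)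
qed

lemma wedge_ext_vec_self: "wedge (ext_vec u) (wedge (ext_vec u) x) = 0"
proof -
  have "2 *s wedge (ext_vec u) (wedge (ext_vec u) x) = 0"
    using wedge_ext_vec_anticommute[of u u x] by (simp add: vec_eq_iff)
  then show ?thesis by (simp add: vec_eq_iff)
qed

lemma wedge_axis_axis:
  "wedge (ext_vec (axis i 1)) (axis S 1) =
    (if i \<in> S then 0 else (-1) ^ card {j \<in> S. j < i} *s axis (insert i S) 1)"
proof -
  have "wedge (ext_vec (axis i 1)) (axis S 1) $ T =
    (if i \<in> S then 0 else (-1) ^ card {j \<in> S. j < i} *s axis (insert i S) 1) $ T" for T
  proof -
    have "wedge (ext_vec (axis i 1)) (axis S 1) $ T =
      (\<Sum>k\<in>T. if k = i then if T - {i} = S then (-1) ^ card {j \<in> T. j < i} else 0 else 0)"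
      unfolding wedge_ext_vec_nth by (intro sum.cong) (auto simp: axis_def)
    also have "\<dots> = (if i \<in> T \<and> T - {i} = S then (-1) ^ card {j \<in> T. j < i} else 0)"
      by simp
    also have "\<dots> = (if i \<in> S then 0 else (-1) ^ card {j \<in> S. j < i} *s axis (insert i S) 1) $ T"
    proof (cases "i \<in> T \<and> T - {i} = S")
      case True
      then have "{j \<in> T. j < i} = {j \<in> S. j < i}" by auto
      moreover have "i \<notin> S" "insert i S = T" using True by auto
      ultimately show ?thesis using True by simp
    next
      case False
      then show ?thesis by (auto simp: axis_def)
    qed
    finally show ?thesis .
  qed
  then show ?thesis by (simp add: vec_eq_iff)
qed

lemma complexify_axis: "complexify g *v axis j 1 = (\<chi> i. complex_of_real (g $ i $ j))"
  by (simp add: complexify_def matrix_vector_mult_def vec_eq_iff axis_def if_distrib cong: if_cong)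

lemma wedge_list_simps [simp]:
  "wedge_list [] = axis {} 1"
  "wedge_list (u # us) = wedge (ext_vec u) (wedge_list us)"
  by (simp_all add: wedge_list_def)

lemma wedge_list_nth_eq_0:
  "card S \<noteq> length us \<Longrightarrow> wedge_list us $ S = 0"
proof (induction us arbitrary: S)
  case Nil
  then show ?case by (auto simp: axis_def)
next
  case (Cons u us)
  have "wedge_list us $ (S - {i}) = 0" if "i \<in> S" for i
  proof (rule Cons.IH)
    have "card S = Suc (card (S - {i}))" using that by (intro card.remove) auto
    then show "card (S - {i}) \<noteq> length us" using Cons.prems by simp
  qed
  then show ?case by (simp add: wedge_ext_vec_nth)
qed

lemma wedge_list_axis_distinct:
  "distinct is \<Longrightarrow> \<exists>c. wedge_list (map (\<lambda>i. axis i 1) is) = c *s axis (set is) 1"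
proof (induction "is")
  case Nil
  show ?case by (auto intro!: exI[of _ 1] simp: vec_eq_iff)
next
  case (Cons i "is")
  then obtain c where c: "wedge_list (map (\<lambda>i. axis i 1) is) = c *s axis (set is) 1" by auto
  have "wedge_list (map (\<lambda>i. axis i 1) (i # is)) =
    (c * (-1) ^ card {j \<in> set is. j < i}) *s axis (set (i # is)) 1"
    using Cons.prems by (simp add: c wedge_ext_vec_linear wedge_axis_axis vector_smult_assoc)
  then show ?case by blast
qed

lemma wedge_list_scaled_axis:
  "distinct is \<Longrightarrow> wedge_list (map (\<lambda>i. c i *s axis i 1) is) =
    (\<Prod>i\<in>set is. c i) *s wedge_list (map (\<lambda>i. axis i 1) is)"
  by (induction "is") (simp_all add: wedge_ext_vec_linear mult.commute)

section \<open>Functoriality of the exterior powers\<close>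

text \<open>Its coordinates are the minors of \<open>g\<close> in the columns
  \<open>S\<close>.\<close>

definition wedge_image :: "('n::{finite,linorder}) mat \<Rightarrow> 'n set \<Rightarrow> 'n ext" where
  "wedge_image g S = wedge_list (map (\<lambda>i. complexify g *v axis i 1) (sorted_list_of_set S))"

lemma wedge_image_empty: "wedge_image g {} = axis {} 1"
  by (simp add: wedge_image_def)

lemma wedge_image_insert:
  assumes "\<And>j. j \<in> S \<Longrightarrow> i < j"
  shows "wedge_image g (insert i S) = wedge (ext_vec (complexify g *v axis i 1)) (wedge_image g S)"
proof -
  have "sorted_list_of_set (insert i S) = i # sorted_list_of_set S"
    using assms by (intro sorted_list_of_set_unique[THEN iffD1]) (auto simp: card_insert_if)
  then show ?thesis by (simp add: wedge_image_def)
qed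

lemma ext_rep_eq: "ext_rep g x = (\<Sum>S\<in>UNIV. x $ S *s wedge_image g S)"
  by (simp add: ext_rep_def wedge_image_def)

lemma ext_rep_linear:
  "ext_rep g (x + y) = ext_rep g x + ext_rep g y"
  "ext_rep g (c *s x) = c *s ext_rep g x"
  "ext_rep g 0 = 0"
  by (simp_all add: ext_rep_eq vec_eq_iff sum.distrib sum_distrib_left algebra_simps)

lemma ext_rep_sum: "ext_rep g (\<Sum>i\<in>A. x i) = (\<Sum>i\<in>A. ext_rep g (x i))"
  by (induction A rule: infinite_finite_induct) (simp_all add: ext_rep_linear)

lemma ext_rep_axis: "ext_rep g (axis S 1) = wedge_image g S"
  using ext_rep_ext_basis[of g S] by (simp add: ext_basis_eq_axis wedge_image_def)

text \<open>Since \<open>ext_rep\<close> is defined on sorted products only, a vector wedged on the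
  left has to be sorted into place. The induction adds a new minimum \<open>s\<close> to
  \<open>S\<close>: for \<open>i < s\<close> the product is already sorted, for \<open>i = s\<close>
  both sides vanish, and for \<open>s < i\<close> anticommuting moves \<open>i\<close> past
  \<open>s\<close>.\<close>

lemma ext_rep_wedge_axis:
  "ext_rep g (wedge (ext_vec (axis i 1)) (axis S 1)) =
    wedge (ext_vec (complexify g *v axis i 1)) (wedge_image g S)"
proof -
  have "finite S" by simp
  then show ?thesis
  proof (induction S rule: finite_linorder_min_induct)
    case empty
    have "wedge (ext_vec (axis i 1)) (axis {} 1) = axis {i} 1"
      by (simp add: wedge_axis_axis vec_eq_iff)
    then show ?case
      using wedge_image_insert[of "{}" i g] by (simp add: ext_rep_axis)
  next
    case (insert s S)
    have S: "axis (insert s S) 1 = wedge (ext_vec (axis s 1)) (axis S 1)"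
      using insert.hyps by (simp add: ext_vec_axis wedge_axis_less)
    have image_S: "wedge_image g (insert s S) = wedge (ext_vec (complexify g *v axis s 1)) (wedge_image g S)"
      using insert.hyps by (simp add: wedge_image_insert)
    consider "i < s" | "i = s" | "s < i" by (rule linorder_cases)
    then show ?case
    proof cases
      case 1
      then have less: "\<And>j. j \<in> insert s S \<Longrightarrow> i < j" using insert.hyps by force
      then show ?thesis
        by (simp only: ext_vec_axis wedge_axis_less[OF less] ext_rep_axis wedge_image_insert[OF less])
    next
      case 2
      then show ?thesis
        unfolding S image_S by (simp add: wedge_ext_vec_self ext_rep_linear)
    next
      case 3
      \<comment> \<open>As \<open>s\<close> lies below all remaining indices, the product with
        \<open>s\<close> in front is sorted, up to the scalar from sorting \<open>i\<close> into
        \<open>S\<close>; if \<open>i\<close> already occurs in \<open>S\<close>, both sides are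
        0.\<close>
      have pull: "ext_rep g (wedge (ext_vec (axis s 1)) (wedge (ext_vec (axis i 1)) (axis S 1))) =
        wedge (ext_vec (complexify g *v axis s 1)) (ext_rep g (wedge (ext_vec (axis i 1)) (axis S 1)))"
      proof (cases "i \<in> S")
        case True
        then show ?thesis by (simp add: wedge_axis_axis wedge_ext_vec_linear ext_rep_linear)
      next
        case False
        have less: "\<And>j. j \<in> insert i S \<Longrightarrow> s < j" using insert.hyps 3 by force
        have "wedge (ext_vec (axis s 1)) (axis (insert i S) 1) = axis (insert s (insert i S)) 1"
          by (simp only: ext_vec_axis wedge_axis_less[OF less])
        then show ?thesis
          using False
          by (simp only: wedge_axis_axis[of i S] if_False wedge_ext_vec_linear ext_rep_linear ext_rep_axis
              wedge_image_insert[OF less])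
      qed
      have "ext_rep g (wedge (ext_vec (axis i 1)) (axis (insert s S) 1)) =
        - ext_rep g (wedge (ext_vec (axis s 1)) (wedge (ext_vec (axis i 1)) (axis S 1)))"
        unfolding S wedge_ext_vec_anticommute[of "axis i 1" "axis s 1"]
        using ext_rep_linear(2)[of g "-1"] by (simp add: vec.scale_minus_left)
      also have "\<dots> = wedge (ext_vec (complexify g *v axis i 1)) (wedge_image g (insert s S))"
        unfolding pull insert.IH image_S
        by (subst (2) wedge_ext_vec_anticommute) simp
      finally show ?thesis .
    qed
  qed
qed

lemma vec_eq_sum_axis: "x = (\<Sum>i\<in>UNIV. x $ i *s axis i 1)" for x :: "('a::ring_1)^'n"
  by (simp add: vec_eq_iff axis_def if_distrib cong: if_cong)

lemma ext_rep_wedge: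
  "ext_rep g (wedge (ext_vec u) x) = wedge (ext_vec (complexify g *v u)) (ext_rep g x)"
proof -
  have "ext_rep g (wedge (ext_vec u) x) =
    ext_rep g (wedge (ext_vec (\<Sum>i\<in>UNIV. u $ i *s axis i 1)) (\<Sum>S\<in>UNIV. x $ S *s axis S 1))"
    by (simp flip: vec_eq_sum_axis)
  also have "\<dots> = (\<Sum>S\<in>UNIV. \<Sum>i\<in>UNIV. x $ S *s (u $ i *s wedge (ext_vec (complexify g *v axis i 1)) (wedge_image g S)))"
    by (simp only: wedge_ext_vec_sum ext_rep_sum wedge_ext_vec_linear ext_rep_linear ext_rep_wedge_axis vec.scale_sum_right)
  also have "\<dots> = wedge (ext_vec (complexify g *v (\<Sum>i\<in>UNIV. u $ i *s axis i 1))) (ext_rep g x)"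
    by (simp add: ext_rep_eq wedge_ext_vec_sum wedge_ext_vec_linear vec.scale_sum_right
        vec.linear_sum[OF matrix_vector_mul_linear_gen] vec.linear_scale[OF matrix_vector_mul_linear_gen])
  finally show ?thesis by (simp flip: vec_eq_sum_axis)
qed

lemma ext_rep_wedge_list: "ext_rep g (wedge_list us) = wedge_list (map (\<lambda>u. complexify g *v u) us)"
  by (induction us) (simp_all add: ext_rep_wedge ext_rep_axis wedge_image_empty)

lemma complexify_mult: "complexify (g ** h) = complexify g ** complexify h"
  by (simp add: complexify_def matrix_matrix_mult_def vec_eq_iff)

lemma wedge_image_mult: "wedge_image (g ** h) S = ext_rep g (wedge_image h S)"
  unfolding wedge_image_def ext_rep_wedge_list by (simp add: complexify_mult matrix_vector_mul_assoc o_def)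

lemma matrix_coeff_eq: "matrix_coeff \<epsilon> \<epsilon>' g = wedge_image g \<epsilon>' $ \<epsilon>"
proof -
  have "matrix_coeff \<epsilon> \<epsilon>' g = (\<Sum>S\<in>UNIV. if S = \<epsilon> then wedge_image g \<epsilon>' $ \<epsilon> else 0)"
    unfolding matrix_coeff_def ext_inner_def ext_basis_eq_axis ext_rep_axis
    by (intro sum.cong) (auto simp: axis_def)
  then show ?thesis by simp
qed

text \<open>This is the Cauchy-Binet formula for minors.\<close>

lemma matrix_coeff_mult:
  "matrix_coeff \<epsilon> \<epsilon>' (g ** h) = (\<Sum>S\<in>UNIV. matrix_coeff \<epsilon> S g * matrix_coeff S \<epsilon>' h)"
  by (simp add: matrix_coeff_eq wedge_image_mult ext_rep_eq mult.commute)

lemma matrix_coeff_eq_0: "card \<epsilon> \<noteq> card \<epsilon>' \<Longrightarrow> matrix_coeff \<epsilon> \<epsilon>' g = 0"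
  by (simp add: matrix_coeff_eq wedge_image_def wedge_list_nth_eq_0)

lemma continuous_on_matrix_coeff: "continuous_on A (matrix_coeff \<epsilon> \<epsilon>')"
proof -
  have "continuous_on A (\<lambda>g. wedge_list (map (\<lambda>i. complexify g *v axis i 1) is) $ S)"
    for "is" and S :: "'a set"
  proof (induction "is" arbitrary: S)
    case Nil
    show ?case by (simp add: continuous_on_const)
  next
    case (Cons i "is")
    have "continuous_on A (\<lambda>g. (complexify g *v axis i 1) $ k)" for k :: 'a
      unfolding complexify_axis by (simp, intro continuous_intros)
    then show ?case
      unfolding list.map wedge_list_simps wedge_ext_vec_nth
      by (intro continuous_on_sum continuous_on_mult continuous_on_const Cons.IH)
  qed
  then show ?thesis
    unfolding matrix_coeff_eq[abs_def] wedge_image_def by simp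
qed

lemma matrix_coeff_sign_diag:
  assumes "m \<in> sign_diag"
  shows "matrix_coeff \<epsilon> \<epsilon>' m = (if \<epsilon> = \<epsilon>' then \<Prod>i\<in>\<epsilon>. complex_of_real (m $ i $ i) else 0)"
proof -
  have "complexify m *v axis i 1 = complex_of_real (m $ i $ i) *s axis i 1" for i
    using assms unfolding complexify_axis by (auto simp: vec_eq_iff sign_diag_def axis_def)
  then have "wedge_image m \<epsilon>' = (\<Prod>i\<in>\<epsilon>'. complex_of_real (m $ i $ i)) *s axis \<epsilon>' 1"
    unfolding wedge_image_def by (simp add: wedge_list_scaled_axis wedge_list_axis)
  then show ?thesis by (simp add: matrix_coeff_eq axis_def)
qed

lemma matrix_coeff_1: "matrix_coeff \<epsilon> \<epsilon>' (mat 1) = (if \<epsilon> = \<epsilon>' then 1 else 0)"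
proof -
  have "(mat 1 :: 'a mat) \<in> sign_diag" by (simp add: sign_diag_def mat_def)
  from matrix_coeff_sign_diag[OF this] show ?thesis by (simp add: mat_def)
qed

definition perm_matrix :: "('n::finite \<Rightarrow> 'n) \<Rightarrow> 'n mat" where
  "perm_matrix \<sigma> = (\<chi> i j. if i = \<sigma> j then 1 else 0)"

lemma orthogonal_perm_matrix: "bij \<sigma> \<Longrightarrow> orthogonal_matrix (perm_matrix \<sigma>)"
  unfolding orthogonal_matrix
  by (auto simp: perm_matrix_def transpose_def matrix_matrix_mult_def mat_def vec_eq_iff
      if_distrib[where f = "\<lambda>x. x * _"] inj_eq[OF bij_is_inj] cong: if_cong)

lemma matrix_coeff_perm_matrix:
  assumes "bij \<sigma>" "\<epsilon> \<noteq> \<sigma> ` \<epsilon>'"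
  shows "matrix_coeff \<epsilon> \<epsilon>' (perm_matrix \<sigma>) = 0"
proof -
  have "complexify (perm_matrix \<sigma>) *v axis i 1 = axis (\<sigma> i) 1" for i
    unfolding complexify_axis by (auto simp: perm_matrix_def vec_eq_iff axis_def)
  then have *: "wedge_image (perm_matrix \<sigma>) \<epsilon>' = wedge_list (map (\<lambda>i. axis i 1) (map \<sigma> (sorted_list_of_set \<epsilon>')))"
    by (simp add: wedge_image_def o_def)
  have "distinct (map \<sigma> (sorted_list_of_set \<epsilon>'))"
    using assms(1) by (auto simp: distinct_map bij_def intro: inj_on_subset)
  from wedge_list_axis_distinct[OF this] obtain c where
    "wedge_image (perm_matrix \<sigma>) \<epsilon>' = c *s axis (\<sigma> ` \<epsilon>') 1"
    unfolding * by auto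
  then show ?thesis using assms(2) by (simp add: matrix_coeff_eq axis_def)
qed

lemma dim_ext_power: "vec.dim (ext_power k :: 'n::{finite,linorder} ext set) = card {S :: 'n set. card S = k}"
proof -
  let ?B = "(\<lambda>S. axis S 1) ` {S :: 'n set. card S = k} :: 'n ext set"
  have "(ext_power k :: 'n ext set) = vec.span ?B"
    unfolding ext_power_def vec.span_eq
  proof (intro conjI)
    show "{wedge_list us |us. length us = k} \<subseteq> vec.span ?B"
    proof (intro subsetI, elim CollectE exE conjE)
      fix x and us :: "'n cvec list" assume x: "x = wedge_list us" and k: "length us = k"
      have "wedge_list us = (\<Sum>S\<in>UNIV. wedge_list us $ S *s axis S 1)" by (rule vec_eq_sum_axis)
      also have "\<dots> \<in> vec.span ?B"
      proof (rule vec.span_sum)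
        fix S :: "'n set"
        show "wedge_list us $ S *s axis S 1 \<in> vec.span ?B"
        proof (cases "card S = k")
          case True
          then show ?thesis by (intro vec.span_scale vec.span_base) auto
        next
          case False
          then show ?thesis using k by (simp add: wedge_list_nth_eq_0 vec.span_zero)
        qed
      qed
      finally show "x \<in> vec.span ?B" unfolding x .
    qed
    show "?B \<subseteq> vec.span {wedge_list us |us. length us = k}"
    proof clarify
      fix S :: "'n set"
      have "axis S 1 = wedge_list (map (\<lambda>i. axis i 1) (sorted_list_of_set S))"
        by (subst wedge_list_axis) auto
      then have "axis S 1 \<in> {wedge_list us |us. length us = card S}"
        by (auto intro!: exI[of _ "map (\<lambda>i. axis i 1) (sorted_list_of_set S)"])
      then show "axis S 1 \<in> vec.span {wedge_list us |us. length us = card S}"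
        by (rule vec.span_base)
    qed
  qed
  moreover have "vec.independent ?B"
    by (rule vec.independent_mono[OF independent_cart_basis]) (auto simp: cart_basis_def)
  ultimately have "vec.dim (ext_power k :: 'n ext set) = card ?B"
    by (simp add: vec.dim_eq_card_independent)
  also have "\<dots> = card {S :: 'n set. card S = k}"
    by (rule card_image) (simp add: inj_on_def axis_eq_axis)
  finally show ?thesis .
qed

subsection \<open>Convolution\<close>

text \<open>Equality of the image measure makes a substitution available at once for complex
  integrals, integrability and almost-everywhere statements.\<close>

definition haar_preserving :: "(real^'n^'n \<Rightarrow> real^'n^'n) \<Rightarrow> bool" where
  "haar_preserving T \<longleftrightarrow> T \<in> haar_GL \<rightarrow>\<^sub>M haar_GL \<and> distr haar_GL haar_GL T = haar_GL"

lemma haar_preservingI: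
  assumes [measurable]: "T \<in> haar_GL \<rightarrow>\<^sub>M haar_GL"
    and T: "\<And>f. f \<in> borel_measurable haar_GL \<Longrightarrow> (\<integral>\<^sup>+g. f (T g) \<partial>haar_GL) = (\<integral>\<^sup>+g. f g \<partial>haar_GL)"
  shows "haar_preserving T"
  unfolding haar_preserving_def
proof (intro conjI measure_eqI)
  fix A assume "A \<in> sets (distr haar_GL haar_GL T)"
  then have A[measurable]: "A \<in> sets haar_GL" by simp
  have "emeasure (distr haar_GL haar_GL T) A = (\<integral>\<^sup>+g. indicator A g \<partial>distr haar_GL haar_GL T)" by simp
  also have "\<dots> = (\<integral>\<^sup>+g. indicator A (T g) \<partial>haar_GL)"
    by (rule nn_integral_distr) auto
  also have "\<dots> = (\<integral>\<^sup>+g. indicator A g \<partial>haar_GL)"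
    by (rule T) auto
  finally show "emeasure (distr haar_GL haar_GL T) A = emeasure haar_GL A" by simp
qed auto

lemma haar_preserving_comp:
  assumes "haar_preserving S" "haar_preserving T"
  shows "haar_preserving (\<lambda>g. S (T g))"
proof -
  have [measurable]: "S \<in> haar_GL \<rightarrow>\<^sub>M haar_GL" "T \<in> haar_GL \<rightarrow>\<^sub>M haar_GL"
    using assms by (auto simp: haar_preserving_def)
  have "distr haar_GL haar_GL (\<lambda>g. S (T g)) = distr (distr haar_GL haar_GL T) haar_GL S"
    by (simp add: distr_distr o_def)
  then show ?thesis using assms by (simp add: haar_preserving_def)
qed

lemma haar_preserving_maps:
  fixes a :: "real^'n^'n"
  shows "a \<in> GL \<Longrightarrow> haar_preserving (\<lambda>g. a ** g)"
    and "a \<in> GL \<Longrightarrow> haar_preserving (\<lambda>g. g ** a)"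
    and "haar_preserving (matrix_inv :: real^'n^'n \<Rightarrow> _)"
    and "haar_preserving (transpose :: real^'n^'n \<Rightarrow> _)"
proof -
  show "haar_preserving (\<lambda>g. a ** g)" if a: "a \<in> GL"
  proof -
    have [measurable]: "a \<in> space haar_GL" using a by simp
    show ?thesis by (rule haar_preservingI) (simp_all add: nn_integral_haar_GL_left a)
  qed
  show "haar_preserving (\<lambda>g. g ** a)" if a: "a \<in> GL"
  proof -
    have [measurable]: "a \<in> space haar_GL" using a by simp
    show ?thesis by (rule haar_preservingI) (simp_all add: nn_integral_haar_GL_right a)
  qed
  show "haar_preserving (matrix_inv :: real^'n^'n \<Rightarrow> _)"
    by (rule haar_preservingI) (simp_all add: nn_integral_haar_GL_inv)
  show "haar_preserving (transpose :: real^'n^'n \<Rightarrow> _)"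
    by (rule haar_preservingI) (simp_all add: nn_integral_haar_GL_transpose)
qed

lemma haar_preserving_inv_mult:
  fixes h :: "real^'n^'n"
  assumes "h \<in> GL"
  shows "haar_preserving (\<lambda>g. matrix_inv g ** h)"
  using haar_preserving_comp[OF haar_preserving_maps(2)[OF assms] haar_preserving_maps(3)] .

lemma haar_preserving_measurable: "haar_preserving T \<Longrightarrow> T \<in> haar_GL \<rightarrow>\<^sub>M haar_GL"
  by (simp add: haar_preserving_def)

lemma haar_preserving_AE:
  assumes "haar_preserving T" "AE g in haar_GL. P g"
  shows "AE g in haar_GL. P (T g)"
proof (rule AE_distrD[where f = T and M' = haar_GL])
  show "T \<in> haar_GL \<rightarrow>\<^sub>M haar_GL"
    using assms(1) by (simp add: haar_preserving_def)
  have "distr haar_GL haar_GL T = haar_GL"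
    using assms(1) by (simp add: haar_preserving_def)
  then show "AE g in distr haar_GL haar_GL T. P g"
    using assms(2) by presburger
qed

lemma haar_preserving_integral:
  fixes f :: "real^'n^'n \<Rightarrow> 'a::{banach, second_countable_topology}"
  assumes "haar_preserving T" "f \<in> borel_measurable haar_GL"
  shows "(LINT g|haar_GL. f (T g)) = (LINT g|haar_GL. f g)"
  using assms integral_distr[of T haar_GL haar_GL f] by (simp add: haar_preserving_def)

lemma haar_preserving_integrable:
  fixes f :: "real^'n^'n \<Rightarrow> 'a::{banach, second_countable_topology}"
  assumes "haar_preserving T" "integrable haar_GL f"
  shows "integrable haar_GL (\<lambda>g. f (T g))"
  using assms integrable_distr[of T haar_GL haar_GL f] by (simp add: haar_preserving_def)

lemma conv_eq_preserving:
  assumes T: "haar_preserving T" and h: "h \<in> GL"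
    and [measurable]: "f1 \<in> borel_measurable haar_GL" "f2 \<in> borel_measurable haar_GL"
  shows "conv f1 f2 h = (LINT g|haar_GL. f1 (T g) * f2 (matrix_inv (T g) ** h))"
proof -
  have [measurable]: "(\<lambda>g. matrix_inv g ** h) \<in> haar_GL \<rightarrow>\<^sub>M haar_GL"
    using h by (intro haar_preserving_measurable haar_preserving_inv_mult)
  show ?thesis
    unfolding conv_def by (rule haar_preserving_integral[OF T, symmetric]) simp
qed

text \<open>The map sending \<open>g\<close> to \<open>matrix_inv g ** h\<close> pulls null sets
  back to null sets, so changing the factors on null sets does not affect the convolution at any
  point \<open>h\<close> of the group.\<close>

lemma conv_cong_AE:
  fixes f1 f2 :: "('n::finite) mat_fun"
  assumes "AE g in haar_GL. f1 g = k1 g" "AE g in haar_GL. f2 g = k2 g" and h: "h \<in> GL"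
    and [measurable]: "f1 \<in> borel_measurable haar_GL" "f2 \<in> borel_measurable haar_GL"
      "k1 \<in> borel_measurable haar_GL" "k2 \<in> borel_measurable haar_GL"
  shows "conv f1 f2 h = conv k1 k2 h"
proof -
  have [measurable]: "(\<lambda>g. matrix_inv g ** h) \<in> haar_GL \<rightarrow>\<^sub>M haar_GL"
    using h by (intro haar_preserving_measurable haar_preserving_inv_mult)
  have "AE g in haar_GL. f2 (matrix_inv g ** h) = k2 (matrix_inv g ** h)"
    using haar_preserving_AE[OF haar_preserving_inv_mult[OF h] assms(2)] .
  then show ?thesis
    unfolding conv_def using assms(1) by (intro integral_cong_AE) (auto elim: eventually_elim2)
qed

lemma measurable_conv_kernel [measurable]:
  fixes f1 f2 :: "('n::finite) mat_fun"
  assumes [measurable]: "f1 \<in> borel_measurable haar_GL" "f2 \<in> borel_measurable haar_GL"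
  shows "(\<lambda>(g, h). f1 g * f2 (matrix_inv g ** h)) \<in> borel_measurable (haar_GL \<Otimes>\<^sub>M haar_GL)"
  by measurable

lemma borel_measurable_conv [measurable]:
  fixes f1 f2 :: "('n::finite) mat_fun"
  assumes [measurable]: "f1 \<in> borel_measurable haar_GL" "f2 \<in> borel_measurable haar_GL"
  shows "conv f1 f2 \<in> borel_measurable haar_GL"
proof -
  interpret sigma_finite_measure "haar_GL :: 'n mat measure" by (rule sigma_finite_haar_GL)
  show ?thesis
    unfolding conv_def[abs_def] by (rule borel_measurable_lebesgue_integral) measurable
qed

text \<open>The case of Young's inequality for two integrable functions: by left invariance the norm
  of the inner integrand integrates to a value independent of \<open>g\<close>, so Fubini's
  criterion applies.\<close>

lemma
  fixes f1 f2 :: "('n::finite) mat_fun"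
  assumes f: "integrable haar_GL f1" "integrable haar_GL f2"
  shows integrable_conv: "integrable haar_GL (conv f1 f2)"
    and AE_integrable_conv_kernel: "AE h in haar_GL. integrable haar_GL (\<lambda>g. f1 g * f2 (matrix_inv g ** h))"
    and integrable_conv_kernel: "integrable (haar_GL \<Otimes>\<^sub>M haar_GL) (\<lambda>(g, h). f1 g * f2 (matrix_inv g ** h))"
proof -
  interpret sigma_finite_measure "haar_GL :: 'n mat measure" by (rule sigma_finite_haar_GL)
  interpret P: pair_sigma_finite "haar_GL :: 'n mat measure" "haar_GL :: 'n mat measure" ..
  have [measurable]: "f1 \<in> borel_measurable haar_GL" "f2 \<in> borel_measurable haar_GL" using f by auto
  have inner: "integrable haar_GL (\<lambda>h. f2 (matrix_inv g ** h))"
    "(LINT h|haar_GL. norm (f2 (matrix_inv g ** h))) = (LINT h|haar_GL. norm (f2 h))" if "g \<in> GL" for g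
    using haar_preserving_integrable[OF haar_preserving_maps(1) f(2), OF matrix_inv_GL(3)[OF that]]
      haar_preserving_integral[OF haar_preserving_maps(1), OF matrix_inv_GL(3)[OF that], of "\<lambda>h. norm (f2 h)"]
    by auto
  show int: "integrable (haar_GL \<Otimes>\<^sub>M haar_GL) (\<lambda>(g, h). f1 g * f2 (matrix_inv g ** h))"
  proof (rule P.Fubini_integrable)
    have "integrable haar_GL (\<lambda>g. norm (f1 g) * (LINT h|haar_GL. norm (f2 h)))"
      using f by auto
    then show "integrable haar_GL (\<lambda>g. LINT h|haar_GL. norm ((\<lambda>(g, h). f1 g * f2 (matrix_inv g ** h)) (g, h)))"
      by (rule Bochner_Integration.integrable_cong[THEN iffD1, rotated -1]) (simp_all add: norm_mult inner)
    show "AE g in haar_GL. integrable haar_GL (\<lambda>h. (\<lambda>(g, h). f1 g * f2 (matrix_inv g ** h)) (g, h))"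
      by (rule AE_I2) (simp add: inner)
  qed simp
  show "integrable haar_GL (conv f1 f2)"
    using P.integrable_snd[of "\<lambda>g h. f1 g * f2 (matrix_inv g ** h)"] int by (simp add: conv_def[abs_def])
  show "AE h in haar_GL. integrable haar_GL (\<lambda>g. f1 g * f2 (matrix_inv g ** h))"
    using P.AE_integrable_snd[of "\<lambda>g h. f1 g * f2 (matrix_inv g ** h)"] int by simp
qed

text \<open>Additivity of the integral requires every single kernel to be integrable at
  \<open>h\<close>, which is known only for almost every \<open>h\<close>.\<close>

lemma conv_sum_AE:
  fixes f k :: "'i \<Rightarrow> ('n::finite) mat_fun"
  assumes "finite A" "finite B" "\<And>i. i \<in> A \<Longrightarrow> integrable haar_GL (f i)" "\<And>j. j \<in> B \<Longrightarrow> integrable haar_GL (k j)"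
  shows "AE h in haar_GL. conv (\<lambda>g. \<Sum>i\<in>A. f i g) (\<lambda>g. \<Sum>j\<in>B. k j g) h = (\<Sum>i\<in>A. \<Sum>j\<in>B. conv (f i) (k j) h)"
proof -
  have "AE h in haar_GL. \<forall>i\<in>A. \<forall>j\<in>B. integrable haar_GL (\<lambda>g. f i g * k j (matrix_inv g ** h))"
    using assms by (intro AE_finite_allI AE_integrable_conv_kernel)
  then show ?thesis
  proof (rule eventually_mono)
    fix h assume *: "\<forall>i\<in>A. \<forall>j\<in>B. integrable haar_GL (\<lambda>g. f i g * k j (matrix_inv g ** h))"
    have "conv (\<lambda>g. \<Sum>i\<in>A. f i g) (\<lambda>g. \<Sum>j\<in>B. k j g) h =
      (LINT g|haar_GL. (\<Sum>i\<in>A. \<Sum>j\<in>B. f i g * k j (matrix_inv g ** h)))"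
      unfolding conv_def by (simp add: sum_product)
    also have "\<dots> = (\<Sum>i\<in>A. \<Sum>j\<in>B. conv (f i) (k j) h)"
      unfolding conv_def using * by (subst Bochner_Integration.integral_sum; simp)
    finally show "conv (\<lambda>g. \<Sum>i\<in>A. f i g) (\<lambda>g. \<Sum>j\<in>B. k j g) h = (\<Sum>i\<in>A. \<Sum>j\<in>B. conv (f i) (k j) h)" .
  qed
qed

lemma orthogonal_GL:
  fixes k :: "real^'n^'n"
  assumes "orthogonal_matrix k"
  shows "k \<in> GL" "matrix_inv k = transpose k" "orthogonal_matrix (matrix_inv k)"
proof -
  show inv: "matrix_inv k = transpose k"
    using assms by (intro matrix_inv_unique_GL) (simp add: orthogonal_matrix_def)
  show "k \<in> GL"
    using assms by (auto simp: GL_def invertible_def orthogonal_matrix_def)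
  show "orthogonal_matrix (matrix_inv k)"
    using assms by (simp add: inv)
qed

lemma sign_diag_mult_self: "m \<in> sign_diag \<Longrightarrow> m ** m = mat 1"
proof -
  assume m: "m \<in> sign_diag"
  have "(m ** m) $ i $ j = mat 1 $ i $ j" for i j
  proof -
    have "(m ** m) $ i $ j = (\<Sum>k\<in>UNIV. if k = i then m $ i $ i * m $ i $ j else 0)"
      unfolding matrix_matrix_mult_def vec_lambda_beta
      using m by (intro sum.cong) (auto simp: sign_diag_def)
    also have "\<dots> = mat 1 $ i $ j"
    proof -
      have "m $ i $ i = 1 \<or> m $ i $ i = -1" using m by (auto simp: sign_diag_def)
      then have "m $ i $ i * m $ i $ i = 1" by auto
      then show ?thesis using m by (cases "i = j") (auto simp: sign_diag_def mat_def)
    qed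
    finally show ?thesis .
  qed
  then show ?thesis by (simp add: vec_eq_iff)
qed

lemma sign_diag_orthogonal:
  assumes "m \<in> sign_diag"
  shows "orthogonal_matrix m" "matrix_inv m = m" "m \<in> GL"
proof -
  have "transpose m $ i $ j = m $ i $ j" for i j
    using assms by (cases "i = j") (auto simp: sign_diag_def transpose_def)
  then have "transpose m = m" by (simp add: vec_eq_iff)
  then show "orthogonal_matrix m" by (simp add: orthogonal_matrix sign_diag_mult_self[OF assms])
  then show "m \<in> GL" by (rule orthogonal_GL)
  show "matrix_inv m = m"
    by (rule matrix_inv_unique_GL) (rule sign_diag_mult_self[OF assms])
qed

lemma heckeD:
  assumes "F \<in> hecke"
  shows "\<And>k1 k2 g. orthogonal_matrix k1 \<Longrightarrow> orthogonal_matrix k2 \<Longrightarrow> g \<in> GL \<Longrightarrow> F (k1 ** g ** k2) = F g"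
    and "\<And>k g. orthogonal_matrix k \<Longrightarrow> g \<in> GL \<Longrightarrow> F (k ** g) = F g"
    and "\<And>k g. orthogonal_matrix k \<Longrightarrow> g \<in> GL \<Longrightarrow> F (g ** k) = F g"
    and "integrable haar_GL (twist F \<epsilon> \<epsilon>')"
    and "integrable haar_GL F"
proof -
  show 1: "F (k1 ** g ** k2) = F g" if "orthogonal_matrix k1" "orthogonal_matrix k2" "g \<in> GL" for k1 k2 g
    using assms that by (auto simp: hecke_def)
  show "F (k ** g) = F g" if "orthogonal_matrix k" "g \<in> GL" for k g
    using 1[OF that(1) orthogonal_matrix_id that(2)] by simp
  show "F (g ** k) = F g" if "orthogonal_matrix k" "g \<in> GL" for k g
    using 1[OF orthogonal_matrix_id that] by simp
  show int: "integrable haar_GL (twist F \<epsilon> \<epsilon>')" for \<epsilon> \<epsilon>'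
    using assms by (simp add: hecke_def twist_def[abs_def])
  have "twist F {} {} = F"
    by (rule ext) (simp add: twist_def matrix_coeff_eq wedge_image_empty)
  with int[of "{}" "{}"] show "integrable haar_GL F" by simp
qed

lemma measurable_hecke: "F \<in> hecke \<Longrightarrow> F \<in> borel_measurable haar_GL"
  using heckeD(5) by (rule borel_measurable_integrable)

lemma measurable_twist: "F \<in> hecke \<Longrightarrow> twist F \<epsilon> \<epsilon>' \<in> borel_measurable haar_GL"
  using heckeD(4) by (rule borel_measurable_integrable)

lemma twist_eq_0: "card \<epsilon> \<noteq> card \<epsilon>' \<Longrightarrow> twist F \<epsilon> \<epsilon>' = (\<lambda>_. 0)"
  by (rule ext) (simp add: twist_def matrix_coeff_eq_0)

section \<open>Schur orthogonality relations\<close>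

text \<open>Replacing \<open>g\<close> by \<open>g ** k\<close> puts \<open>k\<close> on the right
  of the first argument and its inverse on the left of the second. The Hecke functions absorb both,
  so only the matrix coefficients register the change. Sign matrices and permutation matrices are
  substituted for \<open>k\<close> below.\<close>

lemma conv_twist_orthogonal:
  assumes FG: "F \<in> hecke" "G \<in> hecke" and k: "orthogonal_matrix k" and h: "h \<in> GL"
  shows "conv (twist F \<epsilon>1 \<epsilon>2) (twist G \<epsilon>3 \<epsilon>4) h =
    (LINT g|haar_GL. (\<Sum>S\<in>UNIV. matrix_coeff S \<epsilon>2 k * matrix_coeff \<epsilon>1 S g) * F g *
      ((\<Sum>S\<in>UNIV. matrix_coeff \<epsilon>3 S (matrix_inv k) * matrix_coeff S \<epsilon>4 (matrix_inv g ** h)) * G (matrix_inv g ** h)))"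
proof -
  have "conv (twist F \<epsilon>1 \<epsilon>2) (twist G \<epsilon>3 \<epsilon>4) h =
    (LINT g|haar_GL. twist F \<epsilon>1 \<epsilon>2 (g ** k) * twist G \<epsilon>3 \<epsilon>4 (matrix_inv (g ** k) ** h))"
    by (intro conv_eq_preserving haar_preserving_maps measurable_twist FG h orthogonal_GL k)
  also have "\<dots> = (LINT g|haar_GL. (\<Sum>S\<in>UNIV. matrix_coeff S \<epsilon>2 k * matrix_coeff \<epsilon>1 S g) * F g *
      ((\<Sum>S\<in>UNIV. matrix_coeff \<epsilon>3 S (matrix_inv k) * matrix_coeff S \<epsilon>4 (matrix_inv g ** h)) * G (matrix_inv g ** h)))"
  proof (rule Bochner_Integration.integral_cong[OF refl])
    fix g :: "'a mat" assume "g \<in> space haar_GL"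
    then have g: "g \<in> GL" "matrix_inv g ** h \<in> GL" by (auto intro: GL_mult matrix_inv_GL h)
    have "matrix_inv (g ** k) ** h = matrix_inv k ** (matrix_inv g ** h)"
      by (simp add: matrix_inv_mult_GL g orthogonal_GL k matrix_mul_assoc)
    then show "twist F \<epsilon>1 \<epsilon>2 (g ** k) * twist G \<epsilon>3 \<epsilon>4 (matrix_inv (g ** k) ** h) =
      (\<Sum>S\<in>UNIV. matrix_coeff S \<epsilon>2 k * matrix_coeff \<epsilon>1 S g) * F g *
      ((\<Sum>S\<in>UNIV. matrix_coeff \<epsilon>3 S (matrix_inv k) * matrix_coeff S \<epsilon>4 (matrix_inv g ** h)) * G (matrix_inv g ** h))"
      by (simp add: twist_def matrix_coeff_mult heckeD(2)[OF FG(2) orthogonal_GL(3)[OF k] g(2)]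
          heckeD(3)[OF FG(1) k g(1)] mult.commute)
  qed
  finally show ?thesis .
qed

lemma conv_twist_neq:
  assumes FG: "F \<in> hecke" "G \<in> hecke" and h: "h \<in> GL" and neq: "\<epsilon>2 \<noteq> \<epsilon>3"
  shows "conv (twist F \<epsilon>1 \<epsilon>2) (twist G \<epsilon>3 \<epsilon>4) h = 0"
proof -
  obtain i where i: "i \<in> \<epsilon>2 \<longleftrightarrow> i \<notin> \<epsilon>3" using neq by blast
  \<comment> \<open>A single sign suffices, at an index lying in exactly one of
    \<open>\<epsilon>2\<close> and \<open>\<epsilon>3\<close>: the substitution then negates the
    convolution. Negation commutes with the integral even where the kernel is not integrable, so the
    result holds at every \<open>h\<close>.\<close>
  define m :: "'a mat" where "m = (\<chi> j k. if j = k then if j = i then -1 else 1 else 0)"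
  have m: "m \<in> sign_diag" by (simp add: m_def sign_diag_def)
  have coeff: "matrix_coeff S T m = (if S = T then if i \<in> S then -1 else 1 else 0)" for S T
  proof -
    have "(\<Prod>j\<in>S. complex_of_real (m $ j $ j)) = (\<Prod>j\<in>S. if j = i then -1 else 1)"
      by (intro prod.cong) (auto simp: m_def)
    also have "\<dots> = (if i \<in> S then -1 else 1)" by simp
    finally show ?thesis by (cases "S = T") (simp_all add: matrix_coeff_sign_diag[OF m])
  qed
  have "conv (twist F \<epsilon>1 \<epsilon>2) (twist G \<epsilon>3 \<epsilon>4) h =
    (LINT g|haar_GL. - (twist F \<epsilon>1 \<epsilon>2 g * twist G \<epsilon>3 \<epsilon>4 (matrix_inv g ** h)))"
    unfolding conv_twist_orthogonal[OF FG sign_diag_orthogonal(1)[OF m] h] sign_diag_orthogonal(2)[OF m]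
  proof (rule Bochner_Integration.integral_cong[OF refl])
    fix g :: "'a mat"
    have "(\<Sum>S\<in>UNIV. matrix_coeff S \<epsilon>2 m * matrix_coeff \<epsilon>1 S g) = (if i \<in> \<epsilon>2 then -1 else 1) * matrix_coeff \<epsilon>1 \<epsilon>2 g"
      "(\<Sum>S\<in>UNIV. matrix_coeff \<epsilon>3 S m * matrix_coeff S \<epsilon>4 (matrix_inv g ** h)) =
        (if i \<in> \<epsilon>3 then -1 else 1) * matrix_coeff \<epsilon>3 \<epsilon>4 (matrix_inv g ** h)"
      by (simp_all add: coeff if_distrib[where f = "\<lambda>x. x * _"] cong: if_cong)
    then show "(\<Sum>S\<in>UNIV. matrix_coeff S \<epsilon>2 m * matrix_coeff \<epsilon>1 S g) * F g *
      ((\<Sum>S\<in>UNIV. matrix_coeff \<epsilon>3 S m * matrix_coeff S \<epsilon>4 (matrix_inv g ** h)) * G (matrix_inv g ** h)) =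
      - (twist F \<epsilon>1 \<epsilon>2 g * twist G \<epsilon>3 \<epsilon>4 (matrix_inv g ** h))"
      using i by (auto simp: twist_def)
  qed
  also have "\<dots> = - conv (twist F \<epsilon>1 \<epsilon>2) (twist G \<epsilon>3 \<epsilon>4) h"
    by (simp add: conv_def)
  finally show ?thesis by simp
qed

lemma perm_matrix_inv: "bij \<sigma> \<Longrightarrow> matrix_inv (perm_matrix \<sigma>) = perm_matrix (inv \<sigma>)"
  unfolding orthogonal_GL(2)[OF orthogonal_perm_matrix]
  by (auto simp: perm_matrix_def transpose_def vec_eq_iff bij_inv_eq_iff)

text \<open>The Cauchy-Binet sum for the product of the matrix with its inverse has just one nonzero
  term, and that product is the identity.\<close>

lemma matrix_coeff_perm_matrix_inv:
  assumes \<sigma>: "bij \<sigma>"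
  shows "matrix_coeff (\<sigma> ` S) S (perm_matrix \<sigma>) * matrix_coeff S (\<sigma> ` S) (matrix_inv (perm_matrix \<sigma>)) = 1"
proof -
  let ?k = "perm_matrix \<sigma>"
  have k: "orthogonal_matrix ?k" using \<sigma> by (rule orthogonal_perm_matrix)
  have "1 = matrix_coeff (\<sigma> ` S) (\<sigma> ` S) (?k ** matrix_inv ?k)"
    by (simp add: matrix_inv_GL orthogonal_GL(1)[OF k] matrix_coeff_1)
  also have "\<dots> = (\<Sum>T\<in>UNIV. if T = S then matrix_coeff (\<sigma> ` S) S ?k * matrix_coeff S (\<sigma> ` S) (matrix_inv ?k) else 0)"
    unfolding matrix_coeff_mult
  proof (rule sum.cong)
    fix T
    show "matrix_coeff (\<sigma> ` S) T ?k * matrix_coeff T (\<sigma> ` S) (matrix_inv ?k) =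
      (if T = S then matrix_coeff (\<sigma> ` S) S ?k * matrix_coeff S (\<sigma> ` S) (matrix_inv ?k) else 0)"
      using matrix_coeff_perm_matrix[OF \<sigma>, of "\<sigma> ` S" T] \<sigma> by (auto simp: inj_image_eq_iff bij_is_inj)
  qed simp
  finally show ?thesis by simp
qed

text \<open>The permutation matrix and its inverse each contribute one sign, and these two signs
  multiply to 1.\<close>

lemma conv_twist_perm:
  assumes FG: "F \<in> hecke" "G \<in> hecke" and h: "h \<in> GL" and \<sigma>: "bij \<sigma>"
  shows "conv (twist F \<epsilon>1 S) (twist G S \<epsilon>4) h = conv (twist F \<epsilon>1 (\<sigma> ` S)) (twist G (\<sigma> ` S) \<epsilon>4) h"
proof -
  let ?k = "perm_matrix \<sigma>"
  have k: "orthogonal_matrix ?k" using \<sigma> by (rule orthogonal_perm_matrix)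
  have coeff: "matrix_coeff T S ?k = 0" "matrix_coeff S T (matrix_inv ?k) = 0" if "T \<noteq> \<sigma> ` S" for S T
  proof -
    show "matrix_coeff T S ?k = 0" using \<sigma> that by (rule matrix_coeff_perm_matrix)
    have "S \<noteq> inv \<sigma> ` T"
      using that \<sigma> by (metis bij_def image_f_inv_f)
    then show "matrix_coeff S T (matrix_inv ?k) = 0"
      using \<sigma> by (simp add: perm_matrix_inv matrix_coeff_perm_matrix bij_imp_bij_inv)
  qed
  have "conv (twist F \<epsilon>1 S) (twist G S \<epsilon>4) h =
    (LINT g|haar_GL. twist F \<epsilon>1 (\<sigma> ` S) g * twist G (\<sigma> ` S) \<epsilon>4 (matrix_inv g ** h))"
    unfolding conv_twist_orthogonal[OF FG k h]
  proof (rule Bochner_Integration.integral_cong[OF refl])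
    fix g :: "'a mat"
    have "(\<Sum>T\<in>UNIV. matrix_coeff T S ?k * matrix_coeff \<epsilon>1 T g) =
      (\<Sum>T\<in>UNIV. if T = \<sigma> ` S then matrix_coeff T S ?k * matrix_coeff \<epsilon>1 T g else 0)"
      by (intro sum.cong) (auto simp: coeff)
    moreover have "(\<Sum>T\<in>UNIV. matrix_coeff S T (matrix_inv ?k) * matrix_coeff T \<epsilon>4 (matrix_inv g ** h)) =
      (\<Sum>T\<in>UNIV. if T = \<sigma> ` S then matrix_coeff S T (matrix_inv ?k) * matrix_coeff T \<epsilon>4 (matrix_inv g ** h) else 0)"
      by (intro sum.cong) (auto simp: coeff)
    ultimately have "(\<Sum>T\<in>UNIV. matrix_coeff T S ?k * matrix_coeff \<epsilon>1 T g) * F g *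
      ((\<Sum>T\<in>UNIV. matrix_coeff S T (matrix_inv ?k) * matrix_coeff T \<epsilon>4 (matrix_inv g ** h)) * G (matrix_inv g ** h)) =
      (matrix_coeff (\<sigma> ` S) S ?k * matrix_coeff S (\<sigma> ` S) (matrix_inv ?k)) *
      (twist F \<epsilon>1 (\<sigma> ` S) g * twist G (\<sigma> ` S) \<epsilon>4 (matrix_inv g ** h))"
      by (simp add: twist_def)
    then show "(\<Sum>T\<in>UNIV. matrix_coeff T S ?k * matrix_coeff \<epsilon>1 T g) * F g *
      ((\<Sum>T\<in>UNIV. matrix_coeff S T (matrix_inv ?k) * matrix_coeff T \<epsilon>4 (matrix_inv g ** h)) * G (matrix_inv g ** h)) =
      twist F \<epsilon>1 (\<sigma> ` S) g * twist G (\<sigma> ` S) \<epsilon>4 (matrix_inv g ** h)"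
      by (simp only: matrix_coeff_perm_matrix_inv[OF \<sigma>] mult_1_left)
  qed
  then show ?thesis by (simp add: conv_def)
qed

text \<open>The symmetric group is transitive on subsets of a given size, so all middle indices of
  the same degree become comparable.\<close>

lemma bij_extending:
  fixes S T :: "'a::finite set"
  assumes "card S = card T"
  obtains \<sigma> where "bij \<sigma>" "\<sigma> ` S = T"
proof -
  obtain f where f: "bij_betw f S T"
    using assms finite_same_card_bij[of S T] by auto
  have "card (- S) = card (- T)"
    using assms by (simp add: Compl_eq_Diff_UNIV card_Diff_subset)
  then obtain f' where f': "bij_betw f' (- S) (- T)"
    using finite_same_card_bij[of "- S" "- T"] by auto
  define \<sigma> where "\<sigma> x = (if x \<in> S then f x else f' x)" for x
  have "bij_betw \<sigma> S T" "bij_betw \<sigma> (- S) (- T)"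
    using f f' bij_betw_cong[of S \<sigma> f T] bij_betw_cong[of "- S" \<sigma> f' "- T"] by (auto simp: \<sigma>_def)
  then have "bij_betw \<sigma> (S \<union> - S) (T \<union> - T)"
    by (intro bij_betw_combine) auto
  then show thesis
    using \<open>bij_betw \<sigma> S T\<close> by (intro that[of \<sigma>]) (auto simp: bij_betw_def)
qed

lemma AE_sum_conv_twist:
  assumes FG: "F \<in> hecke" "G \<in> hecke"
  shows "AE h in haar_GL. (\<Sum>S\<in>UNIV. conv (twist F \<epsilon>1 S) (twist G S \<epsilon>4) h) = twist (conv F G) \<epsilon>1 \<epsilon>4 h"
proof -
  \<comment> \<open>Moving the sum inside the integral is the only place where an exceptional null
    set arises.\<close>
  have "AE h in haar_GL. \<forall>S\<in>UNIV. integrable haar_GL (\<lambda>g. twist F \<epsilon>1 S g * twist G S \<epsilon>4 (matrix_inv g ** h))"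
    by (intro AE_finite_allI AE_integrable_conv_kernel heckeD FG) simp
  moreover have "AE h in haar_GL. h \<in> GL"
    by (rule AE_I2) simp
  ultimately show ?thesis
  proof eventually_elim
    case (elim h)
    have "(\<Sum>S\<in>UNIV. conv (twist F \<epsilon>1 S) (twist G S \<epsilon>4) h) =
      (LINT g|haar_GL. (\<Sum>S\<in>UNIV. twist F \<epsilon>1 S g * twist G S \<epsilon>4 (matrix_inv g ** h)))"
      unfolding conv_def using elim by (subst Bochner_Integration.integral_sum) auto
    also have "\<dots> = (LINT g|haar_GL. matrix_coeff \<epsilon>1 \<epsilon>4 h * (F g * G (matrix_inv g ** h)))"
    proof (rule Bochner_Integration.integral_cong[OF refl])
      fix g :: "'a mat" assume "g \<in> space haar_GL"
      then have "g ** (matrix_inv g ** h) = h"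
        by (simp add: matrix_mul_assoc matrix_inv_GL)
      then have "matrix_coeff \<epsilon>1 \<epsilon>4 h = (\<Sum>S\<in>UNIV. matrix_coeff \<epsilon>1 S g * matrix_coeff S \<epsilon>4 (matrix_inv g ** h))"
        using matrix_coeff_mult[of \<epsilon>1 \<epsilon>4 g "matrix_inv g ** h"] by simp
      then show "(\<Sum>S\<in>UNIV. twist F \<epsilon>1 S g * twist G S \<epsilon>4 (matrix_inv g ** h)) =
        matrix_coeff \<epsilon>1 \<epsilon>4 h * (F g * G (matrix_inv g ** h))"
        by (simp add: twist_def sum_distrib_left sum_distrib_right mult_ac)
    qed
    also have "\<dots> = twist (conv F G) \<epsilon>1 \<epsilon>4 h"
      by (simp add: twist_def conv_def)
    finally show ?case .
  qed
qed

text \<open>The middle indices of degree \<open>card \<epsilon>1\<close> contribute equally and all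
  others contribute 0, whence the division by their number. The four-index form is the
  multiplication table of the whole algebra \<open>hecke_W\<close>, and the maximality argument
  needs it off the diagonal.\<close>

lemma AE_conv_twist:
  fixes \<epsilon>1 \<epsilon>2 \<epsilon>3 \<epsilon>4 :: "'n::{finite,linorder} set"
  assumes FG: "F \<in> hecke" "G \<in> hecke" and card: "card \<epsilon>1 = card \<epsilon>2"
  shows "AE h in haar_GL. conv (twist F \<epsilon>1 \<epsilon>2) (twist G \<epsilon>3 \<epsilon>4) h =
    (if \<epsilon>2 = \<epsilon>3 then 1 else 0) / of_nat (card {S :: 'n set. card S = card \<epsilon>1}) * twist (conv F G) \<epsilon>1 \<epsilon>4 h"
proof (cases "\<epsilon>2 = \<epsilon>3")
  case False
  then show ?thesis by (intro AE_I2) (simp add: conv_twist_neq FG)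
next
  case True
  let ?d = "of_nat (card {S :: 'n set. card S = card \<epsilon>1}) :: complex"
  have "{S :: 'n set. card S = card \<epsilon>1} \<noteq> {}" by blast
  then have d: "?d \<noteq> 0" by simp
  have "AE h in haar_GL. h \<in> GL"
    by (rule AE_I2) simp
  with AE_sum_conv_twist[OF FG, of \<epsilon>1 \<epsilon>4] show ?thesis
  proof eventually_elim
    case (elim h)
    have summand: "conv (twist F \<epsilon>1 S) (twist G S \<epsilon>4) h =
      (if card S = card \<epsilon>1 then conv (twist F \<epsilon>1 \<epsilon>2) (twist G \<epsilon>2 \<epsilon>4) h else 0)" for S
    proof (cases "card S = card \<epsilon>1")
      case True
      then obtain \<sigma> where \<sigma>: "bij \<sigma>" "\<sigma> ` S = \<epsilon>2" using card bij_extending by metis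
      then show ?thesis using True conv_twist_perm[OF FG elim(2) \<sigma>(1), of \<epsilon>1 S \<epsilon>4] by simp
    next
      case False
      then show ?thesis by (simp add: twist_eq_0 conv_def)
    qed
    have "twist (conv F G) \<epsilon>1 \<epsilon>4 h = (\<Sum>S\<in>UNIV. conv (twist F \<epsilon>1 S) (twist G S \<epsilon>4) h)"
      by (rule elim(1)[symmetric])
    also have "\<dots> = (\<Sum>S\<in>(UNIV :: 'n set set). if card S = card \<epsilon>1 then conv (twist F \<epsilon>1 \<epsilon>2) (twist G \<epsilon>2 \<epsilon>4) h else 0)"
      by (rule sum.cong[OF refl]) (rule summand)
    also have "\<dots> = ?d * conv (twist F \<epsilon>1 \<epsilon>2) (twist G \<epsilon>2 \<epsilon>4) h"
      by (simp add: sum.If_cases)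
    finally show ?case using d True by simp
  qed
qed

text \<open>Bi-invariance must hold pointwise and comes from substituting \<open>k1 ** x\<close>.
  For integrability, the matrix coefficient times \<open>conv F G\<close> agrees almost everywhere
  with a finite sum of convolutions of integrable twists.\<close>

lemma conv_in_hecke:
  assumes FG: "F \<in> hecke" "G \<in> hecke"
  shows "conv F G \<in> hecke"
  unfolding hecke_def
proof (intro CollectI conjI allI impI ballI)
  fix k1 k2 g :: "'a mat"
  assume k: "orthogonal_matrix k1" "orthogonal_matrix k2" and g: "g \<in> GL"
  have h: "k1 ** g ** k2 \<in> GL" by (simp add: GL_mult orthogonal_GL(1) k g)
  have "conv F G (k1 ** g ** k2) =
    (LINT x|haar_GL. F (k1 ** x) * G (matrix_inv (k1 ** x) ** (k1 ** g ** k2)))"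
    by (intro conv_eq_preserving haar_preserving_maps orthogonal_GL k h measurable_hecke FG)
  also have "\<dots> = conv F G g"
    unfolding conv_def
  proof (rule Bochner_Integration.integral_cong[OF refl])
    fix x :: "'a mat" assume "x \<in> space haar_GL"
    then have x: "x \<in> GL" "matrix_inv x ** g \<in> GL" by (auto intro: GL_mult matrix_inv_GL g)
    have "matrix_inv (k1 ** x) ** (k1 ** g ** k2) = matrix_inv x ** (matrix_inv k1 ** k1) ** g ** k2"
      by (simp add: matrix_inv_mult_GL x orthogonal_GL k matrix_mul_assoc)
    also have "\<dots> = matrix_inv x ** g ** k2"
      by (simp add: matrix_inv_GL orthogonal_GL(1) k)
    finally show "F (k1 ** x) * G (matrix_inv (k1 ** x) ** (k1 ** g ** k2)) = F x * G (matrix_inv x ** g)"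
      by (simp add: heckeD(2)[OF FG(1) k(1) x(1)] heckeD(3)[OF FG(2) k(2) x(2)])
  qed
  finally show "conv F G (k1 ** g ** k2) = conv F G g" .
next
  fix \<epsilon> \<epsilon>' :: "'a set"
  have [measurable]: "conv F G \<in> borel_measurable haar_GL"
    by (intro borel_measurable_conv measurable_hecke FG)
  have [measurable]: "matrix_coeff \<epsilon> \<epsilon>' \<in> borel_measurable haar_GL"
    by (intro measurable_haar_GL_continuous continuous_on_matrix_coeff)
  have "integrable haar_GL (\<lambda>h. \<Sum>S\<in>UNIV. conv (twist F \<epsilon> S) (twist G S \<epsilon>') h)"
    by (intro Bochner_Integration.integrable_sum integrable_conv heckeD FG)
  then show "integrable haar_GL (\<lambda>h. matrix_coeff \<epsilon> \<epsilon>' h * conv F G h)"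
    by (rule integrable_cong_AE_imp) (use AE_sum_conv_twist[OF FG, of \<epsilon> \<epsilon>'] in \<open>auto simp: twist_def\<close>)
qed

subsection \<open>Commutativity of the spherical Hecke algebra\<close>

text \<open>A Givens rotation in the coordinates \<open>i\<close> and \<open>j\<close>, with
  \<open>c\<close> and \<open>s\<close> in the roles of cosine and sine.\<close>

definition plane_rotation :: "'n \<Rightarrow> 'n \<Rightarrow> real \<Rightarrow> real \<Rightarrow> real^'n^'n" where
  "plane_rotation i j c s = (\<chi> a b. if a = i then (if b = i then c else if b = j then - s else 0)
     else if a = j then (if b = i then s else if b = j then c else 0) else if a = b then 1 else 0)"

lemma plane_rotation_mult:
  assumes "i \<noteq> j"
  shows "(plane_rotation i j c s ** X) $ a $ b =
    (if a = i then c * X $ i $ b - s * X $ j $ b else if a = j then s * X $ i $ b + c * X $ j $ b else X $ a $ b)"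
proof -
  have "(plane_rotation i j c s ** X) $ a $ b =
    (\<Sum>k\<in>UNIV. (if k = i then (if a = i then c else if a = j then s else 0) * X $ i $ b else 0) +
      (if k = j then (if a = i then - s else if a = j then c else 0) * X $ j $ b else 0) +
      (if k = a then (if a = i \<or> a = j then 0 else X $ a $ b) else 0))"
    unfolding matrix_matrix_mult_def vec_lambda_beta plane_rotation_def
    using assms by (intro sum.cong) auto
  then show ?thesis using assms by (simp add: sum.distrib)
qed

lemma orthogonal_plane_rotation:
  assumes ij: "i \<noteq> j" and cs: "c\<^sup>2 + s\<^sup>2 = 1"
  shows "orthogonal_matrix (plane_rotation i j c s)"
proof -
  have T: "transpose (plane_rotation i j c s) = plane_rotation i j c (- s)"
    using ij by (auto simp: plane_rotation_def transpose_def vec_eq_iff)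
  have "(plane_rotation i j c (- s) ** plane_rotation i j c s) $ a $ b = mat 1 $ a $ b" for a b
    unfolding plane_rotation_mult[OF ij]
    using ij cs by (auto simp: plane_rotation_def mat_def power2_eq_square algebra_simps)
  then show ?thesis
    by (simp add: orthogonal_matrix T vec_eq_iff)
qed

lemma matrix_mult_diff:
  fixes A :: "real^'n^'m" and C :: "real^'k^'n"
  shows "A ** (C - D) = A ** C - A ** D" "(A - B) ** C = A ** C - B ** C"
  by (simp_all add: vec_eq_iff matrix_matrix_mult_def sum_subtractf algebra_simps)

text \<open>The norm is the Frobenius norm: right multiplication acts on each row by an orthogonal
  map, and transposition reduces left multiplication to this.\<close>

lemma norm_orthogonal_mult:
  fixes X :: "real^'n^'n"
  assumes k: "orthogonal_matrix k"
  shows "norm (X ** k) = norm X" "norm (k ** X) = norm X"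
proof -
  have right: "norm (Y ** q) = norm Y" if q: "orthogonal_matrix q" for Y q :: "real^'n^'n"
  proof -
    have "orthogonal_transformation (\<lambda>v. transpose q *v v)"
      using q by (simp only: orthogonal_transformation_matrix matrix_of_matrix_vector_mul
          matrix_vector_mul_linear orthogonal_matrix_transpose simp_thms)
    then have "norm (transpose q *v v) = norm v" for v
      by (simp add: orthogonal_transformation)
    moreover have "(Y ** q) $ i = transpose q *v (Y $ i)" for i
      by (simp add: vec_eq_iff matrix_matrix_mult_def matrix_vector_mult_def transpose_def mult.commute)
    ultimately show ?thesis
      by (simp add: norm_vec_def)
  qed
  show "norm (X ** k) = norm X" by (rule right[OF k])
  have transpose: "norm (transpose Y) = norm Y" for Y :: "real^'n^'n"
    unfolding norm_vec_def L2_set_def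
    by (simp add: transpose_def sum_nonneg) (rule sum.swap)
  have "norm (k ** X) = norm (transpose X ** transpose k)"
    by (simp add: transpose flip: matrix_transpose_mul)
  also have "\<dots> = norm X"
    using k by (simp add: right transpose)
  finally show "norm (k ** X) = norm X" .
qed

lemma compact_orthogonal: "compact {k :: real^'n^'n. orthogonal_matrix k}"
  unfolding compact_eq_bounded_closed
proof
  have "norm k = norm (mat 1 :: real^'n^'n)" if "orthogonal_matrix k" for k :: "real^'n^'n"
    using norm_orthogonal_mult(1)[OF that, of "mat 1"] by simp
  then show "bounded {k :: real^'n^'n. orthogonal_matrix k}"
    by (auto intro!: boundedI)
  have "continuous_on UNIV (transpose :: real^'n^'n \<Rightarrow> _)"
    by (intro linear_continuous_on) (simp add: linear_transpose linear_linear)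
  then have "continuous_on UNIV (\<lambda>k :: real^'n^'n. transpose k ** k)"
    by (intro continuous_intros)
  then show "closed {k :: real^'n^'n. orthogonal_matrix k}"
    unfolding orthogonal_matrix by (intro closed_Collect_eq continuous_on_const)
qed

text \<open>A maximiser of the trace of \<open>k g\<close> over the orthogonal group makes \<open>k g\<close> symmetric.\<close>

lemma exists_orthogonal_symmetric:
  fixes g :: "real^'n^'n"
  obtains k where "orthogonal_matrix k" "transpose (k ** g) = k ** g"
proof -
  let ?tr = "\<lambda>X :: real^'n^'n. \<Sum>a\<in>UNIV. X $ a $ a"
  have "continuous_on {k. orthogonal_matrix k} (\<lambda>k. ?tr (k ** g))"
    by (intro continuous_intros)
  moreover have "{k :: real^'n^'n. orthogonal_matrix k} \<noteq> {}"
    using orthogonal_matrix_id by blast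
  ultimately obtain k where k: "orthogonal_matrix k"
    and max: "\<And>q. orthogonal_matrix q \<Longrightarrow> ?tr (q ** g) \<le> ?tr (k ** g)"
    using continuous_attains_sup[OF compact_orthogonal] by blast
  define p where "p = k ** g"
  have "p $ i $ j = p $ j $ i" if ij: "i \<noteq> j" for i j
  proof (rule ccontr)
    define D where "D = p $ i $ j - p $ j $ i"
    define T where "T = p $ i $ i + p $ j $ j"
    assume "p $ i $ j \<noteq> p $ j $ i"
    then have D: "D \<noteq> 0" by (simp add: D_def)
    \<comment> \<open>The half-angle parameter of the rotation. The trace changes by
      \<open>(2 * t * D - 2 * t\<^sup>2 * T) / (1 + t\<^sup>2)\<close>, and dividing
      \<open>D\<close> by \<open>\<bar>T\<bar> + 1\<close> makes \<open>t\<close> small enough for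
      the linear term to win, against maximality.\<close>
    define t where "t = D / (\<bar>T\<bar> + 1)"
    have "t\<^sup>2 \<ge> 0" by simp
    then have pos: "1 + t\<^sup>2 > 0" by linarith
    define c where "c = (1 - t\<^sup>2) / (1 + t\<^sup>2)"
    define s where "s = 2 * t / (1 + t\<^sup>2)"
    have "(1 - t\<^sup>2)\<^sup>2 + (2 * t)\<^sup>2 = (1 + t\<^sup>2)\<^sup>2" by algebra
    then have "c\<^sup>2 + s\<^sup>2 = 1"
      using pos by (simp add: c_def s_def power_divide flip: add_divide_distrib)
    then have "orthogonal_matrix (plane_rotation i j c s ** k)"
      by (intro orthogonal_matrix_mul orthogonal_plane_rotation ij k)
    from max[OF this] have "?tr (plane_rotation i j c s ** p) \<le> ?tr p"
      by (simp add: p_def matrix_mul_assoc)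
    also have "?tr (plane_rotation i j c s ** p) =
      (\<Sum>a\<in>UNIV. p $ a $ a + (if a = i then (c - 1) * p $ i $ i - s * p $ j $ i else 0) +
        (if a = j then s * p $ i $ j + (c - 1) * p $ j $ j else 0))"
      unfolding plane_rotation_mult[OF ij] using ij by (intro sum.cong) (auto simp: algebra_simps)
    also have "\<dots> = ?tr p + ((c - 1) * T + s * D)"
      by (simp add: sum.distrib T_def D_def algebra_simps)
    finally have "(c - 1) * T + s * D \<le> 0" by simp
    moreover have "c - 1 = - 2 * t\<^sup>2 / (1 + t\<^sup>2)"
      using pos by (simp add: c_def field_simps)
    ultimately have "(- 2 * t\<^sup>2 * T + 2 * t * D) / (1 + t\<^sup>2) \<le> 0"
      by (simp add: s_def diff_divide_distrib)
    then have "- 2 * t\<^sup>2 * T + 2 * t * D \<le> 0"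
      using pos by (simp add: divide_le_0_iff)
    then have "t * D \<le> t\<^sup>2 * T" by simp
    then have "t * D * (\<bar>T\<bar> + 1)\<^sup>2 \<le> t\<^sup>2 * T * (\<bar>T\<bar> + 1)\<^sup>2"
      by (rule mult_right_mono) simp
    then have "(t * (\<bar>T\<bar> + 1)) * D * (\<bar>T\<bar> + 1) \<le> (t * (\<bar>T\<bar> + 1))\<^sup>2 * T"
      by (simp add: power2_eq_square mult_ac)
    moreover have "t * (\<bar>T\<bar> + 1) = D" by (simp add: t_def)
    ultimately have "D\<^sup>2 * (\<bar>T\<bar> + 1) \<le> D\<^sup>2 * T"
      by (simp add: power2_eq_square)
    then have "\<bar>T\<bar> + 1 \<le> T" using D by (simp add: mult_le_cancel_left)
    then show False by linarith
  qed
  then have "transpose p = p"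
    by (auto simp: transpose_def vec_eq_iff) metis
  with k show thesis by (intro that[of k]) (simp_all add: p_def)
qed

text \<open>If \<open>k ** g\<close> is symmetric, then \<open>transpose g = k ** g ** k\<close>, so
  \<open>g\<close> and its transpose lie in the same double coset of the orthogonal group.\<close>

lemma hecke_transpose:
  assumes F: "F \<in> hecke" and g: "g \<in> GL"
  shows "F (transpose g) = F g"
proof -
  obtain k where k: "orthogonal_matrix k" "transpose (k ** g) = k ** g"
    by (rule exists_orthogonal_symmetric)
  have "transpose g = transpose g ** (transpose k ** k)"
    using k by (simp add: orthogonal_matrix)
  also have "\<dots> = k ** g ** k"
    using k(2) by (simp add: matrix_transpose_mul matrix_mul_assoc)
  finally show ?thesis by (simp add: heckeD(1)[OF F k(1) k(1) g])
qed

lemma conv_commute: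
  assumes FG: "F \<in> hecke" "G \<in> hecke" and h: "h \<in> GL"
  shows "conv F G h = conv G F h"
proof -
  have hT: "transpose h \<in> GL" using h by (simp add: GL_det)
  have "conv F G h = conv F G (transpose h)"
    by (rule hecke_transpose[OF conv_in_hecke[OF FG] h, symmetric])
  \<comment> \<open>The substitution sends \<open>g\<close> to the transpose of
    \<open>matrix_inv g ** h\<close>. It turns the argument of \<open>G\<close> into
    \<open>transpose g\<close>, and transposition invariance of \<open>F\<close> and
    \<open>G\<close> then leaves the two factors interchanged.\<close>
  also have "\<dots> = (LINT g|haar_GL. F (transpose (matrix_inv g ** h)) *
      G (matrix_inv (transpose (matrix_inv g ** h)) ** transpose h))"
    by (intro conv_eq_preserving haar_preserving_comp[OF haar_preserving_maps(4)] haar_preserving_inv_mult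
        hT h measurable_hecke FG)
  also have "\<dots> = conv G F h"
    unfolding conv_def
  proof (rule Bochner_Integration.integral_cong[OF refl])
    fix g :: "'a mat" assume "g \<in> space haar_GL"
    then have g: "g \<in> GL" by simp
    let ?x = "matrix_inv g ** h"
    have x: "?x \<in> GL" "transpose ?x \<in> GL" using g h by (auto simp: GL_det det_mul matrix_inv_GL(3)[unfolded GL_det])
    have "transpose h = transpose ?x ** transpose g"
      using g by (simp add: matrix_mul_assoc matrix_inv_GL flip: matrix_transpose_mul)
    then have "matrix_inv (transpose ?x) ** transpose h = matrix_inv (transpose ?x) ** transpose ?x ** transpose g"
      by (simp add: matrix_mul_assoc)
    also have "\<dots> = transpose g"
      using x by (simp add: matrix_inv_GL)
    finally show "F (transpose ?x) * G (matrix_inv (transpose ?x) ** transpose h) = G g * F ?x"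
      by (simp add: hecke_transpose FG g x)
  qed
  finally show ?thesis .
qed

subsection \<open>An approximate identity\<close>

text \<open>A neighbourhood of the whole orthogonal group, so that its indicator is bi-invariant.
  The bound on the determinant, which is 1 or -1 on that group, keeps the set away from singular
  matrices and its Haar measure finite.\<close>

definition near_orthogonal :: "real \<Rightarrow> (real^'n^'n) set" where
  "near_orthogonal \<delta> = {u. (\<exists>k. orthogonal_matrix k \<and> dist u k < \<delta>) \<and> \<bar>det u\<bar> > 1/2}"

lemma open_near_orthogonal: "open (near_orthogonal \<delta>)"
proof -
  have eq: "near_orthogonal \<delta> = (\<Union>k\<in>{k. orthogonal_matrix k}. ball k \<delta>) \<inter> {u. 1/2 < \<bar>det u\<bar>}"
    by (auto simp: near_orthogonal_def dist_commute)
  show ?thesis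
    unfolding eq by (intro open_Int open_UN ballI open_ball open_Collect_less continuous_intros)
qed

lemma near_orthogonal_GL: "near_orthogonal \<delta> \<subseteq> GL"
  by (auto simp: near_orthogonal_def GL_det)

lemma sets_near_orthogonal [measurable]: "near_orthogonal \<delta> \<in> sets haar_GL"
  unfolding sets_haar_GL
  by (subst sets_restrict_space_iff) (simp_all add: borel_open open_GL open_near_orthogonal near_orthogonal_GL)

lemma bounded_near_orthogonal: "bounded (near_orthogonal \<delta> :: (real^'n^'n) set)"
proof -
  have "norm u \<le> norm (mat 1 :: real^'n^'n) + \<delta>" if u: "u \<in> near_orthogonal \<delta>" for u :: "real^'n^'n"
  proof -
    obtain k where k: "orthogonal_matrix k" "dist u k < \<delta>"
      using u by (auto simp: near_orthogonal_def)
    have "norm u \<le> norm k + dist u k"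
      using norm_triangle_sub[of u k] by (simp add: dist_norm)
    then show ?thesis using k norm_orthogonal_mult(1)[OF k(1), of "mat 1"] by simp
  qed
  then show ?thesis by (auto intro!: boundedI)
qed

lemma emeasure_near_orthogonal:
  assumes "\<delta> > 0"
  shows "0 < emeasure haar_GL (near_orthogonal \<delta> :: (real^'n^'n) set)"
    and "emeasure haar_GL (near_orthogonal \<delta> :: (real^'n^'n) set) < \<infinity>"
proof -
  have "(mat 1 :: real^'n^'n) \<in> near_orthogonal \<delta>"
    using assms orthogonal_matrix_id by (auto simp: near_orthogonal_def intro!: exI[of _ "mat 1"])
  then show "0 < emeasure haar_GL (near_orthogonal \<delta> :: (real^'n^'n) set)"
    by (intro emeasure_haar_GL_open open_near_orthogonal near_orthogonal_GL)
  show "emeasure haar_GL (near_orthogonal \<delta> :: (real^'n^'n) set) < \<infinity>"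
    by (rule emeasure_haar_GL_bounded[where c = "1/2"])
      (auto simp: open_near_orthogonal bounded_near_orthogonal, simp add: near_orthogonal_def)
qed

lemma near_orthogonal_invariant:
  assumes k: "orthogonal_matrix k1" "orthogonal_matrix k2"
  shows "k1 ** u ** k2 \<in> near_orthogonal \<delta> \<longleftrightarrow> u \<in> near_orthogonal \<delta>"
proof -
  have imp: "k1 ** u ** k2 \<in> near_orthogonal \<delta>"
    if k: "orthogonal_matrix k1" "orthogonal_matrix k2" and u: "u \<in> near_orthogonal \<delta>" for k1 k2 u :: "real^'n^'n"
  proof -
    obtain q where q: "orthogonal_matrix q" "dist u q < \<delta>" "\<bar>det u\<bar> > 1/2"
      using u by (auto simp: near_orthogonal_def)
    have "k1 ** u ** k2 - k1 ** q ** k2 = k1 ** (u - q) ** k2"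
      by (simp add: matrix_mult_diff)
    then have "dist (k1 ** u ** k2) (k1 ** q ** k2) < \<delta>"
      using q k by (simp add: dist_norm norm_orthogonal_mult)
    moreover have "\<bar>det (k1 ** u ** k2)\<bar> > 1/2"
      using q(3) det_orthogonal_matrix[OF k(1)] det_orthogonal_matrix[OF k(2)]
      by (auto simp: det_mul)
    ultimately show ?thesis
      using q k by (auto simp: near_orthogonal_def intro!: exI[of _ "k1 ** q ** k2"] orthogonal_matrix_mul)
  qed
  show ?thesis
  proof
    assume "k1 ** u ** k2 \<in> near_orthogonal \<delta>"
    then have "matrix_inv k1 ** (k1 ** u ** k2) ** matrix_inv k2 \<in> near_orthogonal \<delta>"
      by (rule imp[OF orthogonal_GL(3)[OF k(1)] orthogonal_GL(3)[OF k(2)]])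
    moreover have "matrix_inv k1 ** (k1 ** u ** k2) ** matrix_inv k2 = u"
    proof -
      have "matrix_inv k1 ** (k1 ** u ** k2) ** matrix_inv k2 = (matrix_inv k1 ** k1) ** u ** (k2 ** matrix_inv k2)"
        by (simp add: matrix_mul_assoc)
      then show ?thesis by (simp add: matrix_inv_GL orthogonal_GL(1) k)
    qed
    ultimately show "u \<in> near_orthogonal \<delta>" by simp
  qed (rule imp[OF k])
qed

lemma indicator_near_orthogonal_hecke:
  assumes "\<delta> > 0"
  shows "(indicator (near_orthogonal \<delta>) :: ('n::{finite,linorder}) mat_fun) \<in> hecke"
  unfolding hecke_def
proof (intro CollectI conjI allI impI ballI)
  fix k1 k2 g :: "'n mat" assume "orthogonal_matrix k1" "orthogonal_matrix k2"
  then show "(indicator (near_orthogonal \<delta>) (k1 ** g ** k2) :: complex) = indicator (near_orthogonal \<delta>) g"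
    by (simp add: indicator_def near_orthogonal_invariant)
next
  fix \<epsilon> \<epsilon>' :: "'n set"
  have "compact (closure (near_orthogonal \<delta> :: 'n mat set))"
    using bounded_near_orthogonal by (simp add: compact_closure)
  then have "bounded (matrix_coeff \<epsilon> \<epsilon>' ` closure (near_orthogonal \<delta>))"
    by (intro compact_imp_bounded compact_continuous_image continuous_on_matrix_coeff)
  then obtain B where B: "\<And>u. u \<in> near_orthogonal \<delta> \<Longrightarrow> norm (matrix_coeff \<epsilon> \<epsilon>' u) \<le> B"
    using closure_subset by (fastforce simp: bounded_iff)
  have "integrable haar_GL (\<lambda>g. indicator (near_orthogonal \<delta>) g *\<^sub>R matrix_coeff \<epsilon> \<epsilon>' g)"
    using emeasure_near_orthogonal(2)[OF assms] B
    by (intro integrableI_bounded_set_indicator[where B = B] measurable_haar_GL_continuous continuous_on_matrix_coeff) auto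
  then show "integrable haar_GL (\<lambda>g. matrix_coeff \<epsilon> \<epsilon>' g * indicator (near_orthogonal \<delta>) g)"
    by (rule Bochner_Integration.integrable_cong[THEN iffD1, rotated -1]) (auto simp: indicator_def)
qed

section \<open>Hecke functions annihilating the whole algebra\<close>

text \<open>The convolution is transferred to the test function, where an approximate identity turns
  into an average. Boundedness of \<open>\<psi>\<close> keeps the double integral absolutely
  convergent.\<close>

lemma integral_conv_mult:
  fixes f1 f2 :: "('n::finite) mat_fun" and \<psi> :: "'n mat \<Rightarrow> real"
  assumes f: "integrable haar_GL f1" "integrable haar_GL f2"
    and \<psi>[measurable]: "\<psi> \<in> borel_measurable haar_GL" and bound: "\<And>g. \<bar>\<psi> g\<bar> \<le> 1"
  shows "(LINT h|haar_GL. conv f1 f2 h * \<psi> h) =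
    (LINT g|haar_GL. f1 g * (LINT u|haar_GL. f2 u * \<psi> (g ** u)))"
proof -
  interpret sigma_finite_measure "haar_GL :: 'n mat measure" by (rule sigma_finite_haar_GL)
  interpret P: pair_sigma_finite "haar_GL :: 'n mat measure" "haar_GL :: 'n mat measure" ..
  have [measurable]: "f1 \<in> borel_measurable haar_GL" "f2 \<in> borel_measurable haar_GL" using f by auto
  have int: "integrable (haar_GL \<Otimes>\<^sub>M haar_GL) (\<lambda>(g, h). f1 g * f2 (matrix_inv g ** h) * complex_of_real (\<psi> h))"
  proof (rule Bochner_Integration.integrable_bound[OF integrable_conv_kernel[OF f]])
    show "AE x in haar_GL \<Otimes>\<^sub>M haar_GL. norm (case x of (g, h) \<Rightarrow> f1 g * f2 (matrix_inv g ** h) * complex_of_real (\<psi> h))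
        \<le> norm (case x of (g, h) \<Rightarrow> f1 g * f2 (matrix_inv g ** h))"
      using bound by (intro AE_I2) (auto simp: norm_mult intro!: mult_left_le)
  qed measurable
  have "(LINT h|haar_GL. conv f1 f2 h * \<psi> h) =
    (LINT h|haar_GL. (LINT g|haar_GL. f1 g * f2 (matrix_inv g ** h) * complex_of_real (\<psi> h)))"
    unfolding conv_def by simp
  also have "\<dots> = (LINT g|haar_GL. (LINT h|haar_GL. f1 g * f2 (matrix_inv g ** h) * complex_of_real (\<psi> h)))"
    using P.Fubini_integral[OF int] by simp
  also have "\<dots> = (LINT g|haar_GL. f1 g * (LINT u|haar_GL. f2 u * \<psi> (g ** u)))"
  proof (rule Bochner_Integration.integral_cong[OF refl])
    fix g :: "'n mat" assume "g \<in> space haar_GL"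
    then have g: "g \<in> GL" and [measurable]: "g \<in> space haar_GL" by auto
    have [measurable]: "matrix_inv g \<in> space haar_GL" using g by (simp add: matrix_inv_GL)
    have "(LINT h|haar_GL. f1 g * f2 (matrix_inv g ** h) * complex_of_real (\<psi> h)) =
      (LINT u|haar_GL. f1 g * f2 (matrix_inv g ** (g ** u)) * complex_of_real (\<psi> (g ** u)))"
      by (rule haar_preserving_integral[OF haar_preserving_maps(1)[OF g], symmetric]) simp
    then show "(LINT h|haar_GL. f1 g * f2 (matrix_inv g ** h) * complex_of_real (\<psi> h)) =
      f1 g * (LINT u|haar_GL. f2 u * \<psi> (g ** u))"
      by (simp add: matrix_mul_assoc matrix_inv_GL g mult.assoc)
  qed
  finally show ?thesis .
qed

text \<open>For \<open>u\<close> in \<open>U j\<close> the matrix \<open>g ** u\<close> is close to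
  some \<open>g ** k\<close> with \<open>k\<close> orthogonal, and \<open>\<psi>\<close> takes the
  same value there as at \<open>g\<close>. The Lipschitz bound makes the error of order
  \<open>1 / Suc j\<close>.\<close>

lemma near_orthogonal_average_tendsto:
  fixes \<psi> :: "real^'n^'n \<Rightarrow> real" and g :: "real^'n^'n"
  assumes lipschitz: "\<And>x y. \<bar>\<psi> x - \<psi> y\<bar> \<le> L * dist x y" and L: "L \<ge> 0"
    and inv: "\<And>x k. orthogonal_matrix k \<Longrightarrow> \<psi> (x ** k) = \<psi> x"
    and [measurable]: "\<psi> \<in> borel_measurable haar_GL" and g: "g \<in> GL"
    and bound: "\<And>x. \<bar>\<psi> x\<bar> \<le> 1"
  defines "U j \<equiv> near_orthogonal (1 / Suc j) :: (real^'n^'n) set"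
  shows "(\<lambda>j. (LINT u|haar_GL. indicator (U j) u * \<psi> (g ** u)) / measure haar_GL (U j)) \<longlonglongrightarrow> \<psi> g"
proof -
  have [measurable]: "g \<in> space haar_GL" using g by simp
  have [measurable]: "U j \<in> sets haar_GL" for j by (simp add: U_def)
  have [simp]: "U j \<inter> GL = U j" for j
    using near_orthogonal_GL by (auto simp: U_def)
  have "bounded_linear (\<lambda>X::real^'n^'n. g ** X)"
    using linear_matrix_mult_left linear_linear by blast
  then obtain C where C: "C > 0" "\<And>X::real^'n^'n. norm (g ** X) \<le> norm X * C"
    using bounded_linear.pos_bounded by blast
  have fin: "emeasure haar_GL (U j) < \<infinity>" and pos: "measure haar_GL (U j) > 0" for j
  proof -
    show "emeasure haar_GL (U j) < \<infinity>"
      unfolding U_def by (rule emeasure_near_orthogonal) simp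
    moreover have "0 < emeasure haar_GL (U j)"
      unfolding U_def by (rule emeasure_near_orthogonal) simp
    ultimately show "measure haar_GL (U j) > 0"
      by (simp add: measure_def enn2real_positive_iff)
  qed
  have close: "\<bar>\<psi> (g ** u) - \<psi> g\<bar> \<le> L * C / Suc j" if u: "u \<in> U j" for u j
  proof -
    obtain k where k: "orthogonal_matrix k" "dist u k < 1 / Suc j"
      using u by (auto simp: U_def near_orthogonal_def)
    have "\<bar>\<psi> (g ** u) - \<psi> g\<bar> = \<bar>\<psi> (g ** u) - \<psi> (g ** k)\<bar>"
      by (simp add: inv k)
    also have "\<dots> \<le> L * dist (g ** u) (g ** k)" by (rule lipschitz)
    also have "\<dots> \<le> L * (C / Suc j)"
    proof (rule mult_left_mono[OF _ L])
      have "dist (g ** u) (g ** k) \<le> dist u k * C"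
        using C(2)[of "u - k"] by (simp add: dist_norm matrix_mult_diff)
      also have "\<dots> \<le> 1 / Suc j * C"
        using k C by (intro mult_right_mono) auto
      finally show "dist (g ** u) (g ** k) \<le> C / Suc j" by simp
    qed
    finally show ?thesis by simp
  qed
  have int: "integrable haar_GL (\<lambda>u. indicator (U j) u * (\<psi> (g ** u) - c))" for j c
  proof -
    have "integrable haar_GL (\<lambda>u. indicator (U j) u *\<^sub>R (\<psi> (g ** u) - c))"
    proof (rule integrableI_bounded_set_indicator[where B = "1 + \<bar>c\<bar>"])
      show "AE u in haar_GL. u \<in> U j \<longrightarrow> norm (\<psi> (g ** u) - c) \<le> 1 + \<bar>c\<bar>"
      proof (intro AE_I2 impI)
        fix u show "norm (\<psi> (g ** u) - c) \<le> 1 + \<bar>c\<bar>" using bound[of "g ** u"] by simp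
      qed
    qed (use fin[of j] in simp_all)
    then show ?thesis by simp
  qed
  have estimate: "\<bar>(LINT u|haar_GL. indicator (U j) u * \<psi> (g ** u)) / measure haar_GL (U j) - \<psi> g\<bar> \<le> L * C / Suc j" for j
  proof -
    have intU: "integrable haar_GL (indicator (U j) :: _ \<Rightarrow> real)"
      using fin[of j] by (intro integrable_real_indicator) auto
    have "(LINT u|haar_GL. indicator (U j) u * (\<psi> (g ** u) - \<psi> g)) =
      (LINT u|haar_GL. indicator (U j) u * (\<psi> (g ** u) - 0) - \<psi> g * indicator (U j) u)"
      by (intro Bochner_Integration.integral_cong) (auto simp: algebra_simps)
    also have "\<dots> = (LINT u|haar_GL. indicator (U j) u * \<psi> (g ** u)) - \<psi> g * measure haar_GL (U j)"
      using int[of j 0] intU by (subst Bochner_Integration.integral_diff) auto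
    finally have "\<bar>(LINT u|haar_GL. indicator (U j) u * \<psi> (g ** u)) - \<psi> g * measure haar_GL (U j)\<bar> =
      \<bar>LINT u|haar_GL. indicator (U j) u * (\<psi> (g ** u) - \<psi> g)\<bar>" by simp
    also have "\<dots> \<le> (LINT u|haar_GL. \<bar>indicator (U j) u * (\<psi> (g ** u) - \<psi> g)\<bar>)"
      by (rule integral_abs_bound)
    also have "\<dots> \<le> (LINT u|haar_GL. L * C / Suc j * indicator (U j) u)"
    proof (rule integral_mono)
      show "integrable haar_GL (\<lambda>u. \<bar>indicator (U j) u * (\<psi> (g ** u) - \<psi> g)\<bar>)"
        using int by (rule integrable_abs)
      show "integrable haar_GL (\<lambda>u. L * C / Suc j * indicator (U j) u)"
        using intU by (intro integrable_mult_right)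
      fix u
      show "\<bar>indicator (U j) u * (\<psi> (g ** u) - \<psi> g)\<bar> \<le> L * C / Suc j * indicator (U j) u"
        using close[of u j] by (auto simp: indicator_def)
    qed
    also have "\<dots> = L * C / Suc j * measure haar_GL (U j)" by simp
    finally have "\<bar>(LINT u|haar_GL. indicator (U j) u * \<psi> (g ** u)) - \<psi> g * measure haar_GL (U j)\<bar> / measure haar_GL (U j)
      \<le> L * C / Suc j"
      using pos[of j] by (simp add: pos_divide_le_eq)
    moreover have "(LINT u|haar_GL. indicator (U j) u * \<psi> (g ** u)) / measure haar_GL (U j) - \<psi> g =
      ((LINT u|haar_GL. indicator (U j) u * \<psi> (g ** u)) - \<psi> g * measure haar_GL (U j)) / measure haar_GL (U j)"
      using pos[of j] by (simp add: diff_divide_distrib)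
    ultimately show ?thesis
      using pos[of j] by simp
  qed
  have "(\<lambda>j. L * C / Suc j) \<longlonglongrightarrow> 0"
    using tendsto_mult_right_zero[OF LIMSEQ_inverse_real_of_nat, of "L * C"] by (simp add: divide_inverse)
  then show ?thesis
    by (rule Lim_null_comparison[THEN LIM_zero_cancel, rotated])
      (rule always_eventually, simp only: real_norm_def estimate simp_thms)
qed

text \<open>With \<open>G\<close> the indicator of \<open>U j\<close>, the vanishing convolution
  says that \<open>F\<close> integrates to 0 against the average \<open>q j\<close>. The averages
  are bounded by 1 and converge to \<open>\<psi>\<close>, so dominated convergence applies with
  majorant \<open>norm (F g)\<close>.\<close>

lemma integral_mult_lipschitz_eq_0:
  fixes F :: "('n::{finite,linorder}) mat_fun" and \<psi> :: "'n mat \<Rightarrow> real"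
  assumes F: "F \<in> hecke" and zero: "\<And>G. G \<in> hecke \<Longrightarrow> AE g in haar_GL. conv F G g = 0"
    and lipschitz: "\<And>x y. \<bar>\<psi> x - \<psi> y\<bar> \<le> L * dist x y" and L: "L \<ge> 0"
    and inv: "\<And>x k. orthogonal_matrix k \<Longrightarrow> \<psi> (x ** k) = \<psi> x"
    and [measurable]: "\<psi> \<in> borel_measurable haar_GL" and bound: "\<And>x. \<bar>\<psi> x\<bar> \<le> 1"
  shows "(LINT g|haar_GL. F g * \<psi> g) = 0"
proof -
  define U where "U j = (near_orthogonal (1 / Suc j) :: 'n mat set)" for j
  have [measurable]: "U j \<in> sets haar_GL" for j by (simp add: U_def)
  have [simp]: "U j \<inter> GL = U j" for j
    using near_orthogonal_GL by (auto simp: U_def)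
  define q where "q j g = (LINT u|haar_GL. indicator (U j) u * \<psi> (g ** u)) / measure haar_GL (U j)" for j g
  interpret sigma_finite_measure "haar_GL :: 'n mat measure" by (rule sigma_finite_haar_GL)
  have [measurable]: "F \<in> borel_measurable haar_GL" using F by (rule measurable_hecke)
  have [measurable]: "q j \<in> borel_measurable haar_GL" for j
  proof -
    have "(\<lambda>g. LINT u|haar_GL. indicator (U j) u * \<psi> (g ** u)) \<in> borel_measurable haar_GL"
      by (rule borel_measurable_lebesgue_integral) measurable
    then show ?thesis unfolding q_def[abs_def] by simp
  qed
  have fin: "emeasure haar_GL (U j) < \<infinity>" for j
    unfolding U_def by (rule emeasure_near_orthogonal) simp
  have q_le: "\<bar>q j g\<bar> \<le> 1" if "g \<in> GL" for j g
  proof -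
    have [measurable]: "g \<in> space haar_GL" using that by simp
    have intU: "integrable haar_GL (indicator (U j) :: _ \<Rightarrow> real)"
      using fin[of j] by (intro integrable_real_indicator) auto
    have "norm (LINT u|haar_GL. indicator (U j) u * \<psi> (g ** u)) \<le> (LINT u|haar_GL. indicator (U j) u)"
    proof (rule Bochner_Integration.integral_norm_bound_integral[OF _ intU])
      show "integrable haar_GL (\<lambda>u. indicator (U j) u * \<psi> (g ** u))"
        using bound by (intro Bochner_Integration.integrable_bound[OF intU]) (auto simp: indicator_def)
    qed (use bound in \<open>auto simp: indicator_def\<close>)
    then have "\<bar>LINT u|haar_GL. indicator (U j) u * \<psi> (g ** u)\<bar> \<le> measure haar_GL (U j)"
      by simp
    then show ?thesis
      by (simp add: q_def divide_le_eq)
  qed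
  have "(LINT g|haar_GL. F g * q j g) = 0" for j
  proof -
    let ?G = "indicator (U j) :: 'n mat_fun"
    have G: "?G \<in> hecke"
      unfolding U_def by (rule indicator_near_orthogonal_hecke) simp
    have "(LINT h|haar_GL. conv F ?G h * \<psi> h) = 0"
      using zero[OF G] by (intro integral_eq_zero_AE) auto
    then have "(LINT g|haar_GL. F g * (LINT u|haar_GL. ?G u * complex_of_real (\<psi> (g ** u)))) = 0"
      by (subst (asm) integral_conv_mult) (auto simp: heckeD(5)[OF F] heckeD(5)[OF G] bound)
    moreover have "(LINT u|haar_GL. ?G u * complex_of_real (\<psi> (g ** u))) =
      complex_of_real (LINT u|haar_GL. indicator (U j) u * \<psi> (g ** u))" for g
      by (simp add: indicator_def of_bool_def if_distrib[where f = "\<lambda>x. x * _"] if_distrib[where f = of_real]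
          flip: integral_complex_of_real cong: if_cong)
    ultimately show ?thesis
      by (simp add: q_def)
  qed
  moreover have "(\<lambda>j. LINT g|haar_GL. F g * complex_of_real (q j g)) \<longlonglongrightarrow> (LINT g|haar_GL. F g * complex_of_real (\<psi> g))"
  proof (rule integral_dominated_convergence[where w = "\<lambda>g. norm (F g)"])
    show "integrable haar_GL (\<lambda>g. norm (F g))" using heckeD(5)[OF F] by simp
    show "AE g in haar_GL. (\<lambda>j. F g * complex_of_real (q j g)) \<longlonglongrightarrow> F g * complex_of_real (\<psi> g)"
    proof (rule AE_I2)
      fix g :: "'n mat" assume "g \<in> space haar_GL"
      then have "(\<lambda>j. q j g) \<longlonglongrightarrow> \<psi> g"
        unfolding q_def U_def
        by (intro near_orthogonal_average_tendsto[OF lipschitz L inv]) (auto simp: bound)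
      then show "(\<lambda>j. F g * complex_of_real (q j g)) \<longlonglongrightarrow> F g * complex_of_real (\<psi> g)"
        by (intro tendsto_intros)
    qed
    show "AE g in haar_GL. norm (F g * complex_of_real (q j g)) \<le> norm (F g)" for j
      by (intro AE_I2) (auto simp: norm_mult q_le intro!: mult_left_le)
  qed measurable
  ultimately have "(\<lambda>j. 0) \<longlonglongrightarrow> (LINT g|haar_GL. F g * complex_of_real (\<psi> g))" by simp
  then show ?thesis
    using LIMSEQ_unique tendsto_const by blast
qed

text \<open>The tent functions \<open>max 0 (1 - m * infdist x E)\<close> are Lipschitz and tend to
  the indicator because \<open>E\<close> is closed. They are right invariant because right
  multiplication by an orthogonal matrix is an isometry preserving \<open>E\<close>.\<close>

lemma integral_closed_eq_0:
  fixes F :: "('n::{finite,linorder}) mat_fun" and E :: "'n mat set"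
  assumes F: "F \<in> hecke" and zero: "\<And>G. G \<in> hecke \<Longrightarrow> AE g in haar_GL. conv F G g = 0"
    and E: "closed E" "E \<noteq> {}" and inv: "\<And>x k. x \<in> E \<Longrightarrow> orthogonal_matrix k \<Longrightarrow> x ** k \<in> E"
  shows "(LINT g|haar_GL. F g * indicator E g) = 0"
proof -
  have infdist_le: "infdist (x ** k) E \<le> infdist x E" if k: "orthogonal_matrix k" for x k :: "'n mat"
  proof -
    obtain e where e: "e \<in> E" "infdist x E = dist x e"
      using infdist_attains_inf[OF E] by metis
    have "infdist (x ** k) E \<le> dist (x ** k) (e ** k)"
      by (rule infdist_le) (rule inv[OF e(1) k])
    also have "\<dots> = dist x e"
      by (simp add: dist_norm norm_orthogonal_mult[OF k] flip: matrix_mult_diff)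
    finally show ?thesis by (simp add: e)
  qed
  have infdist_inv: "infdist (x ** k) E = infdist x E" if k: "orthogonal_matrix k" for x k :: "'n mat"
  proof (rule antisym)
    have "infdist (x ** k ** matrix_inv k) E \<le> infdist (x ** k) E"
      by (rule infdist_le) (rule orthogonal_GL[OF k])
    then show "infdist x E \<le> infdist (x ** k) E"
      by (simp add: matrix_inv_GL orthogonal_GL(1)[OF k] flip: matrix_mul_assoc)
  qed (rule infdist_le[OF k])
  define \<psi> where "\<psi> m x = max 0 (1 - real m * infdist x E)" for m x
  have \<psi>_le: "\<bar>\<psi> m x\<bar> \<le> 1" for m x
    by (simp add: \<psi>_def infdist_nonneg)
  have [measurable]: "\<psi> m \<in> borel_measurable haar_GL" for m
    unfolding \<psi>_def by (intro measurable_haar_GL_continuous continuous_intros)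
  have [measurable]: "F \<in> borel_measurable haar_GL" using F by (rule measurable_hecke)
  have "(LINT g|haar_GL. F g * \<psi> m g) = 0" for m
  proof (rule integral_mult_lipschitz_eq_0[OF F zero, where L = "real m"])
    fix x y :: "'n mat"
    have "\<bar>\<psi> m x - \<psi> m y\<bar> \<le> \<bar>real m * infdist x E - real m * infdist y E\<bar>"
      unfolding \<psi>_def by linarith
    also have "\<dots> = real m * \<bar>infdist x E - infdist y E\<bar>"
      by (simp add: abs_mult flip: right_diff_distrib)
    also have "\<dots> \<le> real m * dist x y"
      by (intro mult_left_mono infdist_triangle_abs) simp
    finally show "\<bar>\<psi> m x - \<psi> m y\<bar> \<le> real m * dist x y" .
  qed (auto simp: \<psi>_le, simp add: \<psi>_def infdist_inv)
  moreover have "(\<lambda>m. LINT g|haar_GL. F g * complex_of_real (\<psi> m g)) \<longlonglongrightarrow> (LINT g|haar_GL. F g * indicator E g)"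
  proof (rule integral_dominated_convergence[where w = "\<lambda>g. norm (F g)"])
    show "integrable haar_GL (\<lambda>g. norm (F g))" using heckeD(5)[OF F] by simp
    show "(\<lambda>g. F g * indicator E g) \<in> borel_measurable haar_GL"
    proof -
      have "GL \<inter> E \<in> sets haar_GL"
        using E by (simp add: sets_haar_GL sets_restrict_space borel_closed)
      then have "(\<lambda>g. F g * indicator (GL \<inter> E) g) \<in> borel_measurable haar_GL" by measurable
      then show ?thesis
        by (rule measurable_cong[THEN iffD1, rotated]) (simp add: indicator_def)
    qed
    show "AE g in haar_GL. (\<lambda>m. F g * complex_of_real (\<psi> m g)) \<longlonglongrightarrow> F g * indicator E g"
    proof (rule AE_I2)
      fix g :: "'n mat"
      have "(\<lambda>m. \<psi> m g) \<longlonglongrightarrow> indicator E g"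
      proof (cases "g \<in> E")
        case True
        then show ?thesis by (simp add: \<psi>_def)
      next
        case False
        then have d: "infdist g E > 0"
          using E by (simp add: infdist_pos_not_in_closed)
        obtain N :: nat where "1 / infdist g E < real N" using reals_Archimedean2 by blast
        then have N: "1 \<le> real N * infdist g E" using d by (simp add: field_simps)
        have "eventually (\<lambda>m. \<psi> m g = indicator E g) sequentially"
          using eventually_ge_at_top[of N]
        proof eventually_elim
          case (elim m)
          have "real N * infdist g E \<le> real m * infdist g E"
            using elim d by (intro mult_right_mono) auto
          then show ?case using N False by (simp add: \<psi>_def)
        qed
        then show ?thesis by (rule tendsto_eventually)
      qed
      then have "(\<lambda>m. F g * complex_of_real (\<psi> m g)) \<longlonglongrightarrow> F g * complex_of_real (indicator E g)"
        by (intro tendsto_intros)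
      then show "(\<lambda>m. F g * complex_of_real (\<psi> m g)) \<longlonglongrightarrow> F g * indicator E g"
        by (simp add: indicator_def of_bool_def if_distrib[where f = of_real] cong: if_cong)
    qed
    show "AE g in haar_GL. norm (F g * complex_of_real (\<psi> m g)) \<le> norm (F g)" for m
      using \<psi>_le by (intro AE_I2) (auto simp: norm_mult intro!: mult_left_le)
  qed measurable
  ultimately have "(\<lambda>m. 0) \<longlonglongrightarrow> (LINT g|haar_GL. F g * indicator E g)" by simp
  then show ?thesis
    using LIMSEQ_unique tendsto_const by blast
qed

text \<open>Up to a null set, the region \<open>S\<close> where the real part is positive is a
  countable union of compact sets. Each is enlarged to a right-invariant compact set still inside
  \<open>S\<close>; there a positive function has integral 0, so that set is null.\<close>

lemma AE_Re_hecke_nonpos: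
  fixes F :: "('n::{finite,linorder}) mat_fun"
  assumes F: "F \<in> hecke" and zero: "\<And>G. G \<in> hecke \<Longrightarrow> AE g in haar_GL. conv F G g = 0"
  shows "AE g in haar_GL. Re (F g) \<le> 0"
proof -
  have [measurable]: "F \<in> borel_measurable haar_GL" using F by (rule measurable_hecke)
  define S where "S = {g \<in> space haar_GL. Re (F g) > 0}"
  have S_GL: "S \<subseteq> GL" by (auto simp: S_def)
  have "S \<in> sets haar_GL" unfolding S_def by measurable
  then have "S \<in> sets borel"
    by (auto simp: sets_haar_GL sets_restrict_space_iff open_GL)
  then have "S \<in> sets lebesgue" by (simp add: sets_completionI_sets)
  then obtain C T where C: "fsigma C" and T: "T \<in> null_sets lebesgue" and CT: "C \<union> T = S"
    by (rule lebesgue_set_almost_fsigma)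
  obtain K :: "nat \<Rightarrow> 'n mat set" where range_K: "range K \<subseteq> Collect compact" and CK: "C = (\<Union>n. K n)"
    using C by (auto simp: fsigma_Union_compact)
  then have K: "compact (K n)" for n by auto
  have "AE g in haar_GL. g \<notin> K n" for n
  proof (cases "K n = {}")
    case False
    \<comment> \<open>Multiplying by the compact orthogonal group preserves compactness, and right
      invariance of \<open>F\<close> keeps the result within \<open>S\<close>.\<close>
    define E where "E = (\<lambda>(x, k). x ** k) ` (K n \<times> {k. orthogonal_matrix k})"
    have "compact E"
      unfolding E_def
      by (intro compact_continuous_image compact_Times K compact_orthogonal)
        (auto simp: case_prod_beta' intro!: continuous_intros)
    then have closed: "closed E" by (rule compact_imp_closed)
    have KE: "K n \<subseteq> E"
      using orthogonal_matrix_id by (force simp: E_def image_iff)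
    have ES: "E \<subseteq> S"
    proof
      fix g assume "g \<in> E"
      then obtain x k where xk: "g = x ** k" "x \<in> K n" "orthogonal_matrix k" by (auto simp: E_def)
      have x: "x \<in> S" using xk CK CT by auto
      then have "x \<in> GL" using S_GL by auto
      then show "g \<in> S"
        using x xk heckeD(3)[OF F xk(3) \<open>x \<in> GL\<close>] by (simp add: S_def GL_mult orthogonal_GL(1))
    qed
    have E_sets[measurable]: "E \<in> sets haar_GL"
      using closed ES S_GL by (simp add: sets_haar_GL sets_restrict_space_iff open_GL borel_open borel_closed)
    have "(LINT g|haar_GL. F g * indicator E g) = 0"
    proof (rule integral_closed_eq_0[OF F zero closed])
      show "E \<noteq> {}" using False KE by auto
      fix x k :: "'n mat" assume "x \<in> E" "orthogonal_matrix k"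
      then obtain y q where "x = y ** q" "y \<in> K n" "orthogonal_matrix q" by (auto simp: E_def)
      then show "x ** k \<in> E"
        using \<open>orthogonal_matrix k\<close> unfolding E_def
        by (intro image_eqI[where x = "(y, q ** k)"]) (auto simp: matrix_mul_assoc orthogonal_matrix_mul)
    qed
    moreover have int: "integrable haar_GL (\<lambda>g. F g * indicator E g)"
      by (rule Bochner_Integration.integrable_bound[OF heckeD(5)[OF F]]) (auto simp: indicator_def)
    ultimately have "(LINT g|haar_GL. Re (F g * indicator E g)) = 0"
      using integral_Re[OF int] by simp
    then have "AE g in haar_GL. Re (F g * indicator E g) = 0"
      using ES by (subst (asm) integral_nonneg_eq_0_iff_AE[OF integrable_bounded_linear[OF bounded_linear_Re int]])
        (auto simp: indicator_def S_def intro!: AE_I2)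
    then have "AE g in haar_GL. g \<notin> E"
      by (rule eventually_mono) (use ES in \<open>auto simp: S_def indicator_def\<close>)
    then show ?thesis
      by (rule eventually_mono) (use KE in auto)
  qed simp
  then have "AE g in haar_GL. \<forall>n. g \<notin> K n"
    by (simp add: AE_all_countable)
  moreover have "AE g in haar_GL. g \<notin> T"
  proof -
    have "AE g in lebesgue. g \<notin> T" using T by (rule AE_not_in)
    then have "AE g in lborel. g \<notin> T" by (simp add: AE_completion_iff)
    then show ?thesis
      unfolding AE_haar_GL_iff by (rule eventually_mono) simp
  qed
  moreover have "AE g in haar_GL. g \<in> space haar_GL" by (rule AE_space)
  ultimately show ?thesis
  proof eventually_elim
    case (elim g)
    then have "g \<notin> S" using CT CK by auto
    then show ?case using elim by (auto simp: S_def)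
  qed
qed

lemma hecke_scale:
  assumes "F \<in> hecke"
  shows "(\<lambda>g. c * F g) \<in> hecke"
  using assms integrable_mult_right[of c haar_GL "\<lambda>g. matrix_coeff \<epsilon> \<epsilon>' g * F g" for \<epsilon> \<epsilon>']
  by (auto simp: hecke_def mult.left_commute[of _ c])

text \<open>The hypothesis survives scaling, so the one-sided bound can be applied to the multiples
  of \<open>F\<close> by the four fourth roots of unity.\<close>

lemma AE_hecke_eq_0:
  fixes F :: "('n::{finite,linorder}) mat_fun"
  assumes F: "F \<in> hecke" and zero: "\<And>G. G \<in> hecke \<Longrightarrow> AE g in haar_GL. conv F G g = 0"
  shows "AE g in haar_GL. F g = 0"
proof -
  have nonpos: "AE g in haar_GL. Re (c * F g) \<le> 0" for c
  proof (rule AE_Re_hecke_nonpos[OF hecke_scale[OF F]])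
    fix G :: "'n mat_fun" assume "G \<in> hecke"
    have "conv (\<lambda>g. c * F g) G g = c * conv F G g" for g
      by (simp add: conv_def mult.assoc)
    then show "AE g in haar_GL. conv (\<lambda>g. c * F g) G g = 0"
      using zero[OF \<open>G \<in> hecke\<close>] by simp
  qed
  show ?thesis
    using nonpos[of 1] nonpos[of "-1"] nonpos[of \<i>] nonpos[of "-\<i>"]
  proof eventually_elim
    case (elim g)
    then show ?case by (simp add: complex_eq_iff)
  qed
qed

subsection \<open>The twisted Hecke algebras\<close>

text \<open>A sign matrix is encoded by the set of its entries -1, so that sums over the group
  become sums over all subsets.\<close>

definition signs :: "('n::finite) set \<Rightarrow> 'n mat" where
  "signs A = (\<chi> i j. if i = j then if i \<in> A then -1 else 1 else 0)"

text \<open>The character by which \<open>signs A\<close> acts on the basis vector of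
  \<open>S\<close>, that is -1 to the power \<open>card (A \<inter> S)\<close>.\<close>

definition sign_char :: "('n::finite) set \<Rightarrow> 'n set \<Rightarrow> complex" where
  "sign_char A S = (\<Prod>i\<in>S. if i \<in> A then -1 else 1)"

lemma signs_in_sign_diag: "signs A \<in> sign_diag"
  by (simp add: signs_def sign_diag_def)

lemma sign_diag_eq_signs: "m \<in> sign_diag \<Longrightarrow> m = signs {i. m $ i $ i = -1}"
  by (auto simp: signs_def sign_diag_def vec_eq_iff)

lemma sign_char_square: "sign_char A S * sign_char A S = 1"
  unfolding sign_char_def prod.distrib[symmetric] by (rule prod.neutral) simp

lemma matrix_coeff_signs: "matrix_coeff S T (signs A) = (if S = T then sign_char A S else 0)"
proof -
  have "(\<Prod>i\<in>S. complex_of_real (signs A $ i $ i)) = sign_char A S"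
    unfolding sign_char_def by (rule prod.cong) (auto simp: signs_def)
  then show ?thesis
    by (cases "S = T") (simp_all add: matrix_coeff_sign_diag[OF signs_in_sign_diag])
qed

text \<open>Orthogonality of characters: flipping the sign at an index lying in exactly one of
  \<open>S\<close> and \<open>T\<close> permutes the group and negates every summand.\<close>

lemma sum_sign_char:
  fixes S T :: "'n::finite set"
  shows "(\<Sum>A\<in>UNIV. sign_char A S * sign_char A T) = (if S = T then of_nat (card (UNIV :: 'n set set)) else 0)"
proof (cases "S = T")
  case True
  then show ?thesis by (simp add: sign_char_square)
next
  case False
  then obtain i where i: "i \<in> S \<longleftrightarrow> i \<notin> T" by blast
  define flip where "flip A = (if i \<in> A then A - {i} else insert i A)" for A
  have flip_flip: "flip (flip A) = A" for A by (auto simp: flip_def)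
  have char: "sign_char (flip A) R = sign_char A R * (if i \<in> R then -1 else 1)" for A R
  proof -
    have "sign_char (flip A) R = (\<Prod>j\<in>R. (if j \<in> A then -1 else 1) * (if j = i then -1 else 1))"
      unfolding sign_char_def by (rule prod.cong) (auto simp: flip_def)
    then show ?thesis by (simp add: prod.distrib sign_char_def)
  qed
  have "(\<Sum>A\<in>UNIV. sign_char A S * sign_char A T) = (\<Sum>A\<in>UNIV. sign_char (flip A) S * sign_char (flip A) T)"
    by (rule sum.reindex_bij_witness[of _ flip flip]) (simp_all add: flip_flip)
  also have "\<dots> = (\<Sum>A\<in>UNIV. - (sign_char A S * sign_char A T))"
    using i by (intro sum.cong) (auto simp: char)
  also have "\<dots> = - (\<Sum>A\<in>UNIV. sign_char A S * sign_char A T)"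
    by (rule sum_negf)
  finally show ?thesis using False by simp
qed

lemma twist_signs:
  assumes F: "F \<in> hecke" and g: "g \<in> GL"
  shows "twist F \<epsilon> \<epsilon>' (signs A ** g ** signs B) = sign_char A \<epsilon> * sign_char B \<epsilon>' * twist F \<epsilon> \<epsilon>' g"
proof -
  have "F (signs A ** g ** signs B) = F g"
    by (intro heckeD(1)[OF F] sign_diag_orthogonal signs_in_sign_diag g)
  moreover have "matrix_coeff \<epsilon> \<epsilon>' (signs A ** g ** signs B) = sign_char A \<epsilon> * sign_char B \<epsilon>' * matrix_coeff \<epsilon> \<epsilon>' g"
    by (simp add: matrix_coeff_mult matrix_coeff_signs if_distrib[where f = "\<lambda>x. x * _"]
        if_distrib[where f = "\<lambda>x. _ * x"] mult_ac cong: if_cong)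
  ultimately show ?thesis by (simp add: twist_def)
qed

section \<open>Algebras attached to a relation between index sets\<close>

definition twist_sum ::
  "('n::{finite,linorder} set \<times> 'n set) set \<Rightarrow> ('n set \<Rightarrow> 'n set \<Rightarrow> 'n mat_fun) \<Rightarrow> 'n mat_fun" where
  "twist_sum Q \<Phi> g = (\<Sum>(\<epsilon>, \<epsilon>')\<in>Q. twist (\<Phi> \<epsilon> \<epsilon>') \<epsilon> \<epsilon>' g)"

text \<open>The relation \<open>Q\<close> is a parameter so that one set of lemmas covers
  \<open>hecke_W\<close>, where \<open>Q\<close> is equality of cardinality, and the diagonal part,
  where \<open>Q\<close> is \<open>Id\<close>.\<close>

definition twist_algebra :: "('n::{finite,linorder} set \<times> 'n set) set \<Rightarrow> 'n mat_fun set" where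
  "twist_algebra Q = ae_saturate (cfun.span {twist F \<epsilon> \<epsilon>' |F \<epsilon> \<epsilon>'. F \<in> hecke \<and> (\<epsilon>, \<epsilon>') \<in> Q})"

lemma sum_fun_apply: "(\<Sum>i\<in>A. f i) x = (\<Sum>i\<in>A. f i x)"
  by (induction A rule: infinite_finite_induct) simp_all

lemma subspace_hecke: "cfun.subspace hecke"
proof (rule cfun.subspaceI)
  show "0 \<in> hecke" by (simp add: hecke_def)
  show "F + G \<in> hecke" if "F \<in> hecke" "G \<in> hecke" for F G :: "'a mat_fun"
    using that by (auto simp: hecke_def algebra_simps intro!: Bochner_Integration.integrable_add)
  show "(\<lambda>g. c * F g) \<in> hecke" if "F \<in> hecke" for c and F :: "'a mat_fun"
    using that by (rule hecke_scale)
qed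

lemma zero_in_hecke: "0 \<in> hecke"
  using subspace_hecke by (rule cfun.subspace_0)

lemma twist_linear:
  "twist (F + G) \<epsilon> \<epsilon>' = twist F \<epsilon> \<epsilon>' + twist G \<epsilon> \<epsilon>'"
  "twist (\<lambda>g. c * F g) \<epsilon> \<epsilon>' = (\<lambda>g. c * twist F \<epsilon> \<epsilon>' g)"
  "twist 0 \<epsilon> \<epsilon>' = 0"
  by (simp_all add: fun_eq_iff twist_def algebra_simps)

text \<open>Twisting is linear and \<open>hecke\<close> is a subspace, so all terms with the same
  pair of indices merge. This gives a normal form with one Hecke function per pair.\<close>

lemma span_twist:
  "cfun.span {twist F \<epsilon> \<epsilon>' |F \<epsilon> \<epsilon>'. F \<in> hecke \<and> (\<epsilon>, \<epsilon>') \<in> Q} =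
    {twist_sum Q \<Phi> |\<Phi>. \<forall>\<epsilon> \<epsilon>'. \<Phi> \<epsilon> \<epsilon>' \<in> hecke}" (is "cfun.span ?X = ?Y")
proof
  have "cfun.subspace ?Y"
  proof (rule cfun.subspaceI)
    have "0 = twist_sum Q (\<lambda>_ _. 0)"
      by (simp add: fun_eq_iff twist_sum_def twist_linear(3))
    then show "0 \<in> ?Y" using zero_in_hecke by blast
  next
    fix x y assume "x \<in> ?Y" "y \<in> ?Y"
    then obtain \<Phi> \<Psi> where xy: "x = twist_sum Q \<Phi>" "y = twist_sum Q \<Psi>"
      and \<Phi>: "\<forall>\<epsilon> \<epsilon>'. \<Phi> \<epsilon> \<epsilon>' \<in> hecke" and \<Psi>: "\<forall>\<epsilon> \<epsilon>'. \<Psi> \<epsilon> \<epsilon>' \<in> hecke" by blast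
    have "x + y = twist_sum Q (\<lambda>\<epsilon> \<epsilon>'. \<Phi> \<epsilon> \<epsilon>' + \<Psi> \<epsilon> \<epsilon>')"
      by (simp add: fun_eq_iff xy twist_sum_def twist_linear(1) case_prod_beta' sum.distrib)
    then show "x + y \<in> ?Y"
      using \<Phi> \<Psi> cfun.subspace_add[OF subspace_hecke] by blast
  next
    fix c x assume "x \<in> ?Y"
    then obtain \<Phi> where x: "x = twist_sum Q \<Phi>" and \<Phi>: "\<forall>\<epsilon> \<epsilon>'. \<Phi> \<epsilon> \<epsilon>' \<in> hecke" by blast
    have "(\<lambda>g. c * x g) = twist_sum Q (\<lambda>\<epsilon> \<epsilon>' g. c * \<Phi> \<epsilon> \<epsilon>' g)"
      by (simp add: fun_eq_iff x twist_sum_def twist_linear(2) case_prod_beta' sum_distrib_left)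
    then show "(\<lambda>g. c * x g) \<in> ?Y"
      using \<Phi> hecke_scale by blast
  qed
  moreover have "?X \<subseteq> ?Y"
  proof clarify
    fix F :: "'a mat_fun" and \<epsilon> \<epsilon>' assume F: "F \<in> hecke" and Q: "(\<epsilon>, \<epsilon>') \<in> Q"
    let ?\<Phi> = "\<lambda>\<delta> \<delta>'. if (\<delta>, \<delta>') = (\<epsilon>, \<epsilon>') then F else 0"
    have "twist_sum Q ?\<Phi> g = twist F \<epsilon> \<epsilon>' g" for g
    proof -
      have "twist_sum Q ?\<Phi> g = (\<Sum>p\<in>Q. if p = (\<epsilon>, \<epsilon>') then twist F \<epsilon> \<epsilon>' g else 0)"
        unfolding twist_sum_def
      proof (rule sum.cong[OF refl])
        fix p
        show "(case p of (\<delta>, \<delta>') \<Rightarrow> twist (?\<Phi> \<delta> \<delta>') \<delta> \<delta>' g) = (if p = (\<epsilon>, \<epsilon>') then twist F \<epsilon> \<epsilon>' g else 0)"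
          by (cases p) (simp add: twist_linear(3))
      qed
      then show ?thesis using Q by simp
    qed
    then have "twist F \<epsilon> \<epsilon>' = twist_sum Q ?\<Phi>" by (simp add: fun_eq_iff)
    moreover have "\<forall>\<delta> \<delta>'. ?\<Phi> \<delta> \<delta>' \<in> hecke"
      using F by (simp add: zero_in_hecke)
    ultimately show "\<exists>\<Phi>. twist F \<epsilon> \<epsilon>' = twist_sum Q \<Phi> \<and> (\<forall>\<delta> \<delta>'. \<Phi> \<delta> \<delta>' \<in> hecke)" by blast
  qed
  ultimately show "cfun.span ?X \<subseteq> ?Y" by (intro cfun.span_minimal)
  show "?Y \<subseteq> cfun.span ?X"
  proof clarify
    fix \<Phi> :: "'a set \<Rightarrow> 'a set \<Rightarrow> 'a mat_fun" assume \<Phi>: "\<forall>\<epsilon> \<epsilon>'. \<Phi> \<epsilon> \<epsilon>' \<in> hecke"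
    have "twist_sum Q \<Phi> = (\<Sum>p\<in>Q. twist (\<Phi> (fst p) (snd p)) (fst p) (snd p))"
      by (simp add: fun_eq_iff twist_sum_def sum_fun_apply case_prod_beta')
    also have "\<dots> \<in> cfun.span ?X"
      using \<Phi> by (intro cfun.span_sum cfun.span_base) force
    finally show "twist_sum Q \<Phi> \<in> cfun.span ?X" .
  qed
qed

lemma twist_algebra_iff:
  "f \<in> twist_algebra Q \<longleftrightarrow> f \<in> borel_measurable haar_GL \<and>
    (\<exists>\<Phi>. (\<forall>\<epsilon> \<epsilon>'. \<Phi> \<epsilon> \<epsilon>' \<in> hecke) \<and> (AE g in haar_GL. f g = twist_sum Q \<Phi> g))"
  unfolding twist_algebra_def span_twist ae_saturate_def by blast

lemma integrable_twist_sum: "\<forall>\<epsilon> \<epsilon>'. \<Phi> \<epsilon> \<epsilon>' \<in> hecke \<Longrightarrow> integrable haar_GL (twist_sum Q \<Phi>)"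
  unfolding twist_sum_def[abs_def] case_prod_beta'
  by (intro Bochner_Integration.integrable_sum heckeD(4)) blast

lemma measurable_twist_sum: "\<forall>\<epsilon> \<epsilon>'. \<Phi> \<epsilon> \<epsilon>' \<in> hecke \<Longrightarrow> twist_sum Q \<Phi> \<in> borel_measurable haar_GL"
  by (rule borel_measurable_integrable) (rule integrable_twist_sum)

lemma AE_GL: "AE g in haar_GL. g \<in> GL"
  using AE_space[of haar_GL] by simp

lemma AE_conv_twist_sum:
  fixes \<Phi> \<Psi> :: "('n::{finite,linorder}) set \<Rightarrow> 'n set \<Rightarrow> 'n mat_fun"
  assumes \<Phi>: "\<forall>\<epsilon> \<epsilon>'. \<Phi> \<epsilon> \<epsilon>' \<in> hecke" and \<Psi>: "\<forall>\<epsilon> \<epsilon>'. \<Psi> \<epsilon> \<epsilon>' \<in> hecke"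
    and Q: "Q \<subseteq> {(\<epsilon>, \<epsilon>'). card \<epsilon> = card \<epsilon>'}"
  shows "AE h in haar_GL. conv (twist_sum Q \<Phi>) (twist_sum R \<Psi>) h =
    (\<Sum>p\<in>Q. \<Sum>q\<in>R. (if snd p = fst q then 1 else 0) / of_nat (card {S :: 'n set. card S = card (fst p)}) *
      twist (conv (\<Phi> (fst p) (snd p)) (\<Psi> (fst q) (snd q))) (fst p) (snd q) h)"
proof -
  have "AE h in haar_GL. conv (\<lambda>g. \<Sum>p\<in>Q. twist (\<Phi> (fst p) (snd p)) (fst p) (snd p) g)
      (\<lambda>g. \<Sum>q\<in>R. twist (\<Psi> (fst q) (snd q)) (fst q) (snd q) g) h =
    (\<Sum>p\<in>Q. \<Sum>q\<in>R. conv (twist (\<Phi> (fst p) (snd p)) (fst p) (snd p)) (twist (\<Psi> (fst q) (snd q)) (fst q) (snd q)) h)"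
    using \<Phi> \<Psi> by (intro conv_sum_AE heckeD(4)) auto
  moreover have "AE h in haar_GL. \<forall>p\<in>Q. \<forall>q\<in>R.
    conv (twist (\<Phi> (fst p) (snd p)) (fst p) (snd p)) (twist (\<Psi> (fst q) (snd q)) (fst q) (snd q)) h =
    (if snd p = fst q then 1 else 0) / of_nat (card {S :: 'n set. card S = card (fst p)}) *
      twist (conv (\<Phi> (fst p) (snd p)) (\<Psi> (fst q) (snd q))) (fst p) (snd q) h"
    using \<Phi> \<Psi> Q by (intro AE_finite_allI AE_conv_twist) auto
  ultimately show ?thesis
    unfolding twist_sum_def[abs_def] case_prod_beta' by eventually_elim simp
qed

text \<open>The product follows the pattern of matrix units: pairs \<open>p\<close> and
  \<open>q\<close> contribute only if \<open>snd p = fst q\<close>, and then at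
  \<open>(fst p, snd q)\<close>, which transitivity keeps in \<open>Q\<close>.\<close>

lemma conv_subalgebra_twist_algebra:
  fixes Q :: "('n::{finite,linorder} set \<times> 'n set) set"
  assumes Q: "Q \<subseteq> {(\<epsilon>, \<epsilon>'). card \<epsilon> = card \<epsilon>'}" and trans: "trans Q"
  shows "conv_subalgebra (twist_algebra Q)"
  unfolding conv_subalgebra_def
proof (intro conjI ballI)
  let ?X = "{twist F \<epsilon> \<epsilon>' |F \<epsilon> \<epsilon>'. F \<in> hecke \<and> (\<epsilon>, \<epsilon>') \<in> Q}"
  show "ae_saturate (twist_algebra Q) = twist_algebra Q"
  proof
    show "ae_saturate (twist_algebra Q) \<subseteq> twist_algebra Q"
    proof
      fix f assume "f \<in> ae_saturate (twist_algebra Q)"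
      then obtain h k where f: "f \<in> borel_measurable haar_GL" "AE g in haar_GL. f g = h g"
        and k: "k \<in> cfun.span ?X" "AE g in haar_GL. h g = k g"
        by (auto simp: twist_algebra_def ae_saturate_def)
      have "AE g in haar_GL. f g = k g" using f(2) k(2) by eventually_elim simp
      then show "f \<in> twist_algebra Q" using f k by (auto simp: twist_algebra_def ae_saturate_def)
    qed
    show "twist_algebra Q \<subseteq> ae_saturate (twist_algebra Q)"
      by (auto simp: ae_saturate_def twist_algebra_def)
  qed
  show "cfun.subspace (twist_algebra Q)"
  proof (rule cfun.subspaceI)
    show "0 \<in> twist_algebra Q"
      using cfun.span_zero[of ?X] by (auto simp: twist_algebra_def ae_saturate_def zero_fun_def intro!: bexI[of _ 0])
  next
    fix x y assume "x \<in> twist_algebra Q" "y \<in> twist_algebra Q"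
    then obtain x' y' where x: "x \<in> borel_measurable haar_GL" "x' \<in> cfun.span ?X" "AE g in haar_GL. x g = x' g"
      and y: "y \<in> borel_measurable haar_GL" "y' \<in> cfun.span ?X" "AE g in haar_GL. y g = y' g"
      by (auto simp: twist_algebra_def ae_saturate_def)
    have "AE g in haar_GL. (x + y) g = (x' + y') g"
      using x(3) y(3) by eventually_elim simp
    moreover have "x + y \<in> borel_measurable haar_GL"
      unfolding plus_fun_def using x y by simp
    ultimately show "x + y \<in> twist_algebra Q"
      unfolding twist_algebra_def ae_saturate_def using cfun.span_add[OF x(2) y(2)] by blast
  next
    fix c x assume "x \<in> twist_algebra Q"
    then obtain x' where x: "x \<in> borel_measurable haar_GL" "x' \<in> cfun.span ?X" "AE g in haar_GL. x g = x' g"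
      by (auto simp: twist_algebra_def ae_saturate_def)
    have "AE g in haar_GL. c * x g = c * x' g"
      using x(3) by eventually_elim simp
    moreover have "(\<lambda>g. c * x g) \<in> borel_measurable haar_GL"
      using x by simp
    ultimately show "(\<lambda>g. c * x g) \<in> twist_algebra Q"
      unfolding twist_algebra_def ae_saturate_def
      using cfun.span_scale[OF x(2), of c] by (intro CollectI conjI bexI[of _ "\<lambda>g. c * x' g"])
  qed
next
  let ?X = "{twist F \<epsilon> \<epsilon>' |F \<epsilon> \<epsilon>'. F \<in> hecke \<and> (\<epsilon>, \<epsilon>') \<in> Q}"
  fix f1 f2 assume "f1 \<in> twist_algebra Q" "f2 \<in> twist_algebra Q"
  then obtain \<Phi> \<Psi> where f: "f1 \<in> borel_measurable haar_GL" "f2 \<in> borel_measurable haar_GL"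
    and \<Phi>: "\<forall>\<epsilon> \<epsilon>'. \<Phi> \<epsilon> \<epsilon>' \<in> hecke" "AE g in haar_GL. f1 g = twist_sum Q \<Phi> g"
    and \<Psi>: "\<forall>\<epsilon> \<epsilon>'. \<Psi> \<epsilon> \<epsilon>' \<in> hecke" "AE g in haar_GL. f2 g = twist_sum Q \<Psi> g"
    unfolding twist_algebra_iff by blast
  define c :: "'n set \<times> 'n set \<Rightarrow> 'n set \<times> 'n set \<Rightarrow> complex"
    where "c p q = (if snd p = fst q then 1 else 0) / of_nat (card {S :: 'n set. card S = card (fst p)})"
    for p q :: "'n set \<times> 'n set"
  define t where "t p q = twist (\<lambda>g. c p q * conv (\<Phi> (fst p) (snd p)) (\<Psi> (fst q) (snd q)) g) (fst p) (snd q)" for p q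
  have "AE h in haar_GL. conv f1 f2 h = (\<Sum>p\<in>Q. \<Sum>q\<in>Q. t p q) h"
    using AE_conv_twist_sum[OF \<Phi>(1) \<Psi>(1) Q, of Q] AE_GL
  proof eventually_elim
    case (elim h)
    have "conv f1 f2 h = conv (twist_sum Q \<Phi>) (twist_sum Q \<Psi>) h"
      by (rule conv_cong_AE[OF \<Phi>(2) \<Psi>(2) elim(2) f measurable_twist_sum[OF \<Phi>(1)] measurable_twist_sum[OF \<Psi>(1)]])
    then show ?case
      unfolding sum_fun_apply t_def twist_linear(2) c_def using elim(1) by simp
  qed
  moreover have "(\<Sum>p\<in>Q. \<Sum>q\<in>Q. t p q) \<in> cfun.span ?X"
  proof (intro cfun.span_sum)
    fix p q assume pq: "p \<in> Q" "q \<in> Q"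
    show "t p q \<in> cfun.span ?X"
    proof (cases "snd p = fst q")
      case True
      then have "(fst p, snd q) \<in> Q"
        using pq trans by (metis prod.collapse transD)
      moreover have "(\<lambda>g. c p q * conv (\<Phi> (fst p) (snd p)) (\<Psi> (fst q) (snd q)) g) \<in> hecke"
        using \<Phi> \<Psi> by (intro hecke_scale conv_in_hecke) auto
      ultimately show ?thesis
        unfolding t_def by (intro cfun.span_base) blast
    next
      case False
      then have "t p q = 0" by (simp add: t_def c_def twist_def fun_eq_iff)
      then show ?thesis by (simp only: cfun.span_zero)
    qed
  qed
  moreover have "conv f1 f2 \<in> borel_measurable haar_GL" using f by (rule borel_measurable_conv)
  ultimately show "conv f1 f2 \<in> twist_algebra Q"
    unfolding twist_algebra_def ae_saturate_def by blast
qed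

text \<open>Distinct matrix coefficients are separated by translating on both sides with sign matrices.\<close>

lemma AE_twist_sum_component:
  fixes \<Phi> :: "('n::{finite,linorder}) set \<Rightarrow> 'n set \<Rightarrow> 'n mat_fun"
  assumes \<Phi>: "\<forall>\<epsilon> \<epsilon>'. \<Phi> \<epsilon> \<epsilon>' \<in> hecke" and zero: "AE g in haar_GL. twist_sum Q \<Phi> g = 0" and Q: "(\<epsilon>, \<epsilon>') \<in> Q"
  shows "AE g in haar_GL. twist (\<Phi> \<epsilon> \<epsilon>') \<epsilon> \<epsilon>' g = 0"
proof -
  have "AE g in haar_GL. twist_sum Q \<Phi> (signs A ** g ** signs B) = 0" for A B
    using haar_preserving_AE[OF haar_preserving_comp[OF haar_preserving_maps(2) haar_preserving_maps(1)] zero]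
      sign_diag_orthogonal(3)[OF signs_in_sign_diag] by blast
  then have "AE g in haar_GL. \<forall>A\<in>UNIV. \<forall>B\<in>UNIV. twist_sum Q \<Phi> (signs A ** g ** signs B) = 0"
    by (intro AE_finite_allI) auto
  with AE_GL show ?thesis
  proof eventually_elim
    case (elim g)
    let ?N = "of_nat (card (UNIV :: 'n set set)) :: complex"
    \<comment> \<open>Summing against both characters projects onto the component at
      \<open>(\<epsilon>, \<epsilon>')\<close>, up to the square of the order \<open>?N\<close> of
      the sign group.\<close>
    have "0 = (\<Sum>A\<in>UNIV. \<Sum>B\<in>UNIV. sign_char A \<epsilon> * sign_char B \<epsilon>' * twist_sum Q \<Phi> (signs A ** g ** signs B))"
      using elim(2) by simp
    also have "\<dots> = (\<Sum>A\<in>UNIV. \<Sum>B\<in>UNIV. \<Sum>p\<in>Q.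
      sign_char A \<epsilon> * sign_char A (fst p) * (sign_char B \<epsilon>' * sign_char B (snd p)) * twist (\<Phi> (fst p) (snd p)) (fst p) (snd p) g)"
      using \<Phi> elim(1) by (simp add: twist_sum_def case_prod_beta' twist_signs sum_distrib_left mult_ac)
    also have "\<dots> = (\<Sum>p\<in>Q. \<Sum>A\<in>UNIV. \<Sum>B\<in>UNIV.
      sign_char A \<epsilon> * sign_char A (fst p) * (sign_char B \<epsilon>' * sign_char B (snd p)) * twist (\<Phi> (fst p) (snd p)) (fst p) (snd p) g)"
      by (simp only: sum.swap[where B = Q])
    also have "\<dots> = (\<Sum>p\<in>Q. (\<Sum>A\<in>UNIV. sign_char A \<epsilon> * sign_char A (fst p)) *
      (\<Sum>B\<in>UNIV. sign_char B \<epsilon>' * sign_char B (snd p)) * twist (\<Phi> (fst p) (snd p)) (fst p) (snd p) g)"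
      unfolding sum_product by (simp only: sum_distrib_right)
    also have "\<dots> = (\<Sum>p\<in>Q. if p = (\<epsilon>, \<epsilon>') then ?N * ?N * twist (\<Phi> \<epsilon> \<epsilon>') \<epsilon> \<epsilon>' g else 0)"
      by (intro sum.cong) (auto simp: sum_sign_char)
    also have "\<dots> = ?N * ?N * twist (\<Phi> \<epsilon> \<epsilon>') \<epsilon> \<epsilon>' g"
      using Q by simp
    finally show ?case by simp
  qed
qed

text \<open>A single minor may vanish at an invertible matrix, but a whole row of the representing
  matrix cannot. Right translation by permutation matrices extends the vanishing to all of row
  \<open>\<epsilon>\<close>, and pairing that row with column \<open>\<epsilon>\<close> of the
  inverse recovers \<open>F\<close>.\<close>

lemma AE_hecke_eq_0_if_twist:
  fixes F :: "('n::{finite,linorder}) mat_fun"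
  assumes F: "F \<in> hecke" and card: "card \<epsilon> = card \<epsilon>'" and zero: "AE g in haar_GL. twist F \<epsilon> \<epsilon>' g = 0"
  shows "AE g in haar_GL. F g = 0"
proof -
  have "AE g in haar_GL. matrix_coeff \<epsilon> S g * F g = 0" if S: "card S = card \<epsilon>" for S
  proof -
    obtain \<sigma> where \<sigma>: "bij \<sigma>" "\<sigma> ` \<epsilon>' = S"
      using bij_extending[of \<epsilon>' S] S card by metis
    let ?k = "perm_matrix \<sigma>"
    have k: "orthogonal_matrix ?k" using \<sigma>(1) by (rule orthogonal_perm_matrix)
    have nonzero: "matrix_coeff S \<epsilon>' ?k \<noteq> 0"
      using matrix_coeff_perm_matrix_inv[OF \<sigma>(1), of \<epsilon>'] \<sigma>(2) by auto
    have "AE g in haar_GL. twist F \<epsilon> \<epsilon>' (g ** ?k) = 0"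
      using haar_preserving_AE[OF haar_preserving_maps(2)[OF orthogonal_GL(1)[OF k]] zero] .
    with AE_GL show ?thesis
    proof eventually_elim
      case (elim g)
      have "matrix_coeff \<epsilon> \<epsilon>' (g ** ?k) = (\<Sum>T\<in>UNIV. if T = S then matrix_coeff \<epsilon> S g * matrix_coeff S \<epsilon>' ?k else 0)"
        unfolding matrix_coeff_mult
        using matrix_coeff_perm_matrix[OF \<sigma>(1), of _ \<epsilon>'] \<sigma>(2) by (intro sum.cong) auto
      then have "matrix_coeff \<epsilon> S g * matrix_coeff S \<epsilon>' ?k * F g = 0"
        using elim by (simp add: twist_def heckeD(3)[OF F k])
      then show ?case using nonzero by auto
    qed
  qed
  then have "AE g in haar_GL. \<forall>S\<in>{S. card S = card \<epsilon>}. matrix_coeff \<epsilon> S g * F g = 0"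
    by (intro AE_finite_allI) auto
  with AE_GL show ?thesis
  proof eventually_elim
    case (elim g)
    have "F g = matrix_coeff \<epsilon> \<epsilon> (g ** matrix_inv g) * F g"
      using elim(1) by (simp add: matrix_inv_GL matrix_coeff_1)
    also have "\<dots> = (\<Sum>S\<in>UNIV. matrix_coeff \<epsilon> S g * F g * matrix_coeff S \<epsilon> (matrix_inv g))"
      by (simp add: matrix_coeff_mult sum_distrib_left sum_distrib_right mult_ac)
    also have "\<dots> = 0"
    proof (rule sum.neutral, rule ballI)
      fix S
      show "matrix_coeff \<epsilon> S g * F g * matrix_coeff S \<epsilon> (matrix_inv g) = 0"
        using elim(2) by (cases "card S = card \<epsilon>") (auto simp: matrix_coeff_eq_0)
    qed
    finally show ?case .
  qed
qed

lemma twist_sum_Id: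
  assumes "\<And>\<epsilon> \<epsilon>'. (\<epsilon>, \<epsilon>') \<in> Q \<Longrightarrow> \<epsilon> \<noteq> \<epsilon>' \<Longrightarrow> twist (\<Phi> \<epsilon> \<epsilon>') \<epsilon> \<epsilon>' g = 0" "Id \<subseteq> Q"
  shows "twist_sum Q \<Phi> g = twist_sum Id \<Phi> g"
  unfolding twist_sum_def using assms by (intro sum.mono_neutral_right) auto

lemma AE_twist_sum_Id:
  assumes "\<And>\<epsilon> \<epsilon>'. (\<epsilon>, \<epsilon>') \<in> Q \<Longrightarrow> \<epsilon> \<noteq> \<epsilon>' \<Longrightarrow> AE g in haar_GL. twist (\<Phi> \<epsilon> \<epsilon>') \<epsilon> \<epsilon>' g = 0" "Id \<subseteq> Q"
  shows "AE g in haar_GL. twist_sum Q \<Phi> g = twist_sum Id \<Phi> g"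
proof -
  have "AE g in haar_GL. \<forall>p\<in>Q - Id. twist (\<Phi> (fst p) (snd p)) (fst p) (snd p) g = 0"
  proof (intro AE_finite_allI)
    fix p assume "p \<in> Q - Id"
    then show "AE g in haar_GL. twist (\<Phi> (fst p) (snd p)) (fst p) (snd p) g = 0"
      using assms(1)[of "fst p" "snd p"] by (cases p) simp
  qed simp
  then show ?thesis
  proof (rule eventually_mono)
    fix g assume *: "\<forall>p\<in>Q - Id. twist (\<Phi> (fst p) (snd p)) (fst p) (snd p) g = 0"
    show "twist_sum Q \<Phi> g = twist_sum Id \<Phi> g"
    proof (rule twist_sum_Id[OF _ assms(2)])
      fix \<epsilon> \<epsilon>' assume "(\<epsilon>, \<epsilon>') \<in> Q" "\<epsilon> \<noteq> \<epsilon>'"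
      then show "twist (\<Phi> \<epsilon> \<epsilon>') \<epsilon> \<epsilon>' g = 0"
        using bspec[OF *, of "(\<epsilon>, \<epsilon>')"] by simp
    qed
  qed
qed

section \<open>Invariants of the sign group and maximality\<close>

lemma hecke_W_eq: "hecke_W = twist_algebra {(\<epsilon>, \<epsilon>'). card \<epsilon> = card \<epsilon>'}"
  by (simp add: hecke_W_def twist_algebra_def)

lemma twist_algebra_Id:
  "(twist_algebra Id :: ('n::{finite,linorder}) mat_fun set) = ae_saturate (cfun.span {twist F \<epsilon> \<epsilon> |F \<epsilon>. F \<in> hecke})"
proof -
  have "({twist F \<epsilon> \<epsilon>' |F \<epsilon> \<epsilon>'. F \<in> hecke \<and> (\<epsilon>, \<epsilon>') \<in> Id} :: 'n mat_fun set) = {twist F \<epsilon> \<epsilon> |F \<epsilon>. F \<in> hecke}"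
    by auto
  then show ?thesis by (simp only: twist_algebra_def)
qed

lemma hecke_W_M_eq: "(hecke_W_M :: ('n::{finite,linorder}) mat_fun set) = twist_algebra Id"
proof
  let ?P = "{(\<epsilon>, \<epsilon>'). card \<epsilon> = card (\<epsilon>' :: 'n set)}"
  show "(hecke_W_M :: 'n mat_fun set) \<subseteq> twist_algebra Id"
  proof
    fix f :: "'n mat_fun" assume "f \<in> hecke_W_M"
    then have inv: "\<And>m. m \<in> sign_diag \<Longrightarrow> AE g in haar_GL. f (m ** g ** matrix_inv m) = f g"
      and "f \<in> twist_algebra ?P"
      by (auto simp: hecke_W_M_def hecke_W_eq)
    then obtain \<Phi> where f: "f \<in> borel_measurable haar_GL"
      and \<Phi>: "\<forall>\<epsilon> \<epsilon>'. \<Phi> \<epsilon> \<epsilon>' \<in> hecke" "AE g in haar_GL. f g = twist_sum ?P \<Phi> g"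
      unfolding twist_algebra_iff by blast
    have "AE g in haar_GL. twist (\<Phi> \<epsilon> \<epsilon>') \<epsilon> \<epsilon>' g = 0" if P: "(\<epsilon>, \<epsilon>') \<in> ?P" and neq: "\<epsilon> \<noteq> \<epsilon>'" for \<epsilon> \<epsilon>'
    proof -
      obtain i where i: "i \<in> \<epsilon> \<longleftrightarrow> i \<notin> \<epsilon>'" using neq by blast
      let ?m = "signs {i} :: 'n mat"
      \<comment> \<open>Conjugation by \<open>?m\<close> multiplies each component by a product of
        two signs, and \<open>c\<close> is that product minus 1. Hence the change of
        \<open>f\<close> under conjugation is in normal form with Hecke functions scaled by
        \<open>c\<close>, and \<open>c \<epsilon> \<epsilon>'\<close> equals -2.\<close>
      define c where "c \<delta> \<delta>' = sign_char {i} \<delta> * sign_char {i} \<delta>' - 1" for \<delta> \<delta>' :: "'n set"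
      have "AE g in haar_GL. f (?m ** g ** ?m) = twist_sum ?P \<Phi> (?m ** g ** ?m)"
        using haar_preserving_AE[OF haar_preserving_comp[OF haar_preserving_maps(2) haar_preserving_maps(1)] \<Phi>(2)]
          sign_diag_orthogonal(3)[OF signs_in_sign_diag] by blast
      moreover have "AE g in haar_GL. f (?m ** g ** ?m) = f g"
        using inv[OF signs_in_sign_diag, of "{i}"] by (simp add: sign_diag_orthogonal(2)[OF signs_in_sign_diag])
      ultimately have "AE g in haar_GL. twist_sum ?P (\<lambda>\<delta> \<delta>' g. c \<delta> \<delta>' * \<Phi> \<delta> \<delta>' g) g = 0"
        using \<Phi>(2) AE_GL
      proof eventually_elim
        case (elim g)
        have "twist_sum ?P (\<lambda>\<delta> \<delta>' g. c \<delta> \<delta>' * \<Phi> \<delta> \<delta>' g) g =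
          (\<Sum>p\<in>?P. twist (\<Phi> (fst p) (snd p)) (fst p) (snd p) (?m ** g ** ?m) - twist (\<Phi> (fst p) (snd p)) (fst p) (snd p) g)"
          unfolding twist_sum_def case_prod_beta' twist_linear(2)
          using \<Phi>(1) elim(4) by (intro sum.cong) (simp_all add: twist_signs c_def algebra_simps)
        also have "\<dots> = twist_sum ?P \<Phi> (?m ** g ** ?m) - twist_sum ?P \<Phi> g"
          by (simp add: sum_subtractf twist_sum_def case_prod_beta')
        finally show ?case using elim by simp
      qed
      then have "AE g in haar_GL. twist (\<lambda>g. c \<epsilon> \<epsilon>' * \<Phi> \<epsilon> \<epsilon>' g) \<epsilon> \<epsilon>' g = 0"
        using \<Phi>(1) P by (intro AE_twist_sum_component[of "\<lambda>\<delta> \<delta>' g. c \<delta> \<delta>' * \<Phi> \<delta> \<delta>' g"]) (auto intro: hecke_scale)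
      moreover have "c \<epsilon> \<epsilon>' \<noteq> 0"
        using i by (auto simp: c_def sign_char_def)
      ultimately show ?thesis by (simp add: twist_linear(2))
    qed
    then have "AE g in haar_GL. twist_sum ?P \<Phi> g = twist_sum Id \<Phi> g"
      by (intro AE_twist_sum_Id) auto
    with \<Phi>(2) have "AE g in haar_GL. f g = twist_sum Id \<Phi> g"
      by eventually_elim simp
    then show "f \<in> twist_algebra Id"
      unfolding twist_algebra_iff using f \<Phi>(1) by blast
  qed
  show "twist_algebra Id \<subseteq> (hecke_W_M :: 'n mat_fun set)"
  proof
    fix f :: "'n mat_fun" assume "f \<in> twist_algebra Id"
    then obtain \<Phi> where f: "f \<in> borel_measurable haar_GL"
      and \<Phi>: "\<forall>\<epsilon> \<epsilon>'. \<Phi> \<epsilon> \<epsilon>' \<in> hecke" "AE g in haar_GL. f g = twist_sum Id \<Phi> g"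
      unfolding twist_algebra_iff by blast
    have "{twist F \<epsilon> \<epsilon>' |F \<epsilon> \<epsilon>'. F \<in> hecke \<and> (\<epsilon>, \<epsilon>') \<in> Id} \<subseteq>
      ({twist F \<epsilon> \<epsilon>' |F \<epsilon> \<epsilon>'. F \<in> hecke \<and> (\<epsilon>, \<epsilon>') \<in> ?P} :: 'n mat_fun set)"
      by auto
    from cfun.span_mono[OF this] have "f \<in> hecke_W"
      using \<open>f \<in> twist_algebra Id\<close> unfolding hecke_W_eq twist_algebra_def ae_saturate_def by blast
    moreover have "AE g in haar_GL. f (m ** g ** matrix_inv m) = f g" if m: "m \<in> sign_diag" for m
    proof -
      obtain A where A: "m = signs A" using sign_diag_eq_signs[OF m] ..
      have "AE g in haar_GL. f (m ** g ** m) = twist_sum Id \<Phi> (m ** g ** m)"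
        using haar_preserving_AE[OF haar_preserving_comp[OF haar_preserving_maps(2) haar_preserving_maps(1)] \<Phi>(2)]
          sign_diag_orthogonal(3)[OF m] by blast
      with \<Phi>(2) AE_GL show ?thesis
      proof eventually_elim
        case (elim g)
        have "twist_sum Id \<Phi> (m ** g ** m) = twist_sum Id \<Phi> g"
          unfolding twist_sum_def case_prod_beta' A
          using \<Phi>(1) elim(2) by (intro sum.cong) (auto simp: twist_signs sign_char_square)
        then show ?case using elim by (simp add: sign_diag_orthogonal(2)[OF m])
      qed
    qed
    ultimately show "f \<in> hecke_W_M" by (simp add: hecke_W_M_def)
  qed
qed

lemma conv_commutative_twist_algebra_Id: "conv_commutative (twist_algebra Id :: ('n::{finite,linorder}) mat_fun set)"
  unfolding conv_commutative_def
proof (intro ballI)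
  fix f1 f2 :: "'n mat_fun" assume "f1 \<in> twist_algebra Id" "f2 \<in> twist_algebra Id"
  then obtain \<Phi> \<Psi> where f: "f1 \<in> borel_measurable haar_GL" "f2 \<in> borel_measurable haar_GL"
    and \<Phi>: "\<forall>\<epsilon> \<epsilon>'. \<Phi> \<epsilon> \<epsilon>' \<in> hecke" "AE g in haar_GL. f1 g = twist_sum Id \<Phi> g"
    and \<Psi>: "\<forall>\<epsilon> \<epsilon>'. \<Psi> \<epsilon> \<epsilon>' \<in> hecke" "AE g in haar_GL. f2 g = twist_sum Id \<Psi> g"
    unfolding twist_algebra_iff by blast
  have card: "Id \<subseteq> {(\<epsilon>, \<epsilon>'). card \<epsilon> = card (\<epsilon>' :: 'n set)}" by auto
  show "AE g in haar_GL. conv f1 f2 g = conv f2 f1 g"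
    using AE_conv_twist_sum[OF \<Phi>(1) \<Psi>(1) card, of Id] AE_conv_twist_sum[OF \<Psi>(1) \<Phi>(1) card, of Id] AE_GL
  proof eventually_elim
    case (elim h)
    have "conv f1 f2 h = conv (twist_sum Id \<Phi>) (twist_sum Id \<Psi>) h"
      by (rule conv_cong_AE[OF \<Phi>(2) \<Psi>(2) elim(3) f measurable_twist_sum[OF \<Phi>(1)] measurable_twist_sum[OF \<Psi>(1)]])
    also have "\<dots> = conv (twist_sum Id \<Psi>) (twist_sum Id \<Phi>) h"
      unfolding elim(1,2)
      using \<Phi>(1) \<Psi>(1) elim(3)
      by (subst (2) sum.swap) (intro sum.cong refl, auto simp: twist_def conv_commute)
    also have "\<dots> = conv f2 f1 h"
      by (rule conv_cong_AE[OF \<Psi>(2) \<Phi>(2) elim(3) f(2,1) measurable_twist_sum[OF \<Psi>(1)] measurable_twist_sum[OF \<Phi>(1)], symmetric])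
    finally show ?case .
  qed
qed

lemma commuting_twist_algebra_subset:
  fixes A :: "('n::{finite,linorder}) mat_fun set"
  assumes A: "twist_algebra Id \<subseteq> A" "A \<subseteq> hecke_W" and comm: "conv_commutative A"
  shows "A \<subseteq> twist_algebra Id"
proof
  let ?P = "{(\<epsilon>, \<epsilon>'). card \<epsilon> = card (\<epsilon>' :: 'n set)}"
  let ?d = "\<lambda>\<epsilon>. of_nat (card {S :: 'n set. card S = card \<epsilon>}) :: complex"
  fix f assume f: "f \<in> A"
  then have "f \<in> twist_algebra ?P" using A by (auto simp: hecke_W_eq)
  then obtain \<Phi> where f_meas: "f \<in> borel_measurable haar_GL"
    and \<Phi>: "\<forall>\<epsilon> \<epsilon>'. \<Phi> \<epsilon> \<epsilon>' \<in> hecke" "AE g in haar_GL. f g = twist_sum ?P \<Phi> g"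
    unfolding twist_algebra_iff by blast
  have zero: "AE g in haar_GL. \<Phi> \<epsilon> \<epsilon>' g = 0" if P: "(\<epsilon>, \<epsilon>') \<in> ?P" and neq: "\<epsilon> \<noteq> \<epsilon>'" for \<epsilon> \<epsilon>'
  proof (rule AE_hecke_eq_0)
    show "\<Phi> \<epsilon> \<epsilon>' \<in> hecke" using \<Phi>(1) by blast
    fix G :: "'n mat_fun" assume G: "G \<in> hecke"
    \<comment> \<open>With this family, \<open>twist_sum Id \<Psi>\<close> is the single diagonal
      function \<open>twist G \<epsilon>' \<epsilon>'\<close>.\<close>
    define \<Psi> where "\<Psi> \<delta> \<delta>' = (if \<delta> = \<epsilon>' \<and> \<delta>' = \<epsilon>' then G else 0)" for \<delta> \<delta>'
    have \<Psi>: "\<forall>\<delta> \<delta>'. \<Psi> \<delta> \<delta>' \<in> hecke"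
      using G by (simp add: \<Psi>_def zero_in_hecke)
    have zero_conv: "conv F 0 = 0" "conv 0 F = 0" for F :: "'n mat_fun"
      by (simp_all add: fun_eq_iff conv_def)
    let ?G = "twist_sum Id \<Psi>"
    have "?G \<in> twist_algebra Id"
      unfolding twist_algebra_iff using \<Psi> measurable_twist_sum[OF \<Psi>] by blast
    then have "AE h in haar_GL. conv f ?G h = conv ?G f h"
      using comm f A unfolding conv_commutative_def by blast
    note commute = this
    \<comment> \<open>The commutator of \<open>f\<close> with \<open>?G\<close> in normal form: the
      first product occupies column \<open>\<epsilon>'\<close>, the second, with opposite sign,
      occupies row \<open>\<epsilon>'\<close>. At \<open>(\<epsilon>, \<epsilon>')\<close> with
      \<open>\<epsilon> \<noteq> \<epsilon>'\<close> only the first survives.\<close>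
    define \<Theta> where "\<Theta> \<delta> \<delta>' = (\<lambda>g. (if \<delta>' = \<epsilon>' then 1 / ?d \<delta> else 0) * conv (\<Phi> \<delta> \<epsilon>') G g) +
      (\<lambda>g. (if \<delta> = \<epsilon>' then - 1 / ?d \<delta> else 0) * conv G (\<Phi> \<epsilon>' \<delta>') g)" for \<delta> \<delta>'
    have \<Theta>: "\<forall>\<delta> \<delta>'. \<Theta> \<delta> \<delta>' \<in> hecke"
      unfolding \<Theta>_def using \<Phi>(1) G
      by (intro allI cfun.subspace_add[OF subspace_hecke] hecke_scale conv_in_hecke) auto
    have card: "Id \<subseteq> ?P" by auto
    have "AE h in haar_GL. twist_sum ?P \<Theta> h = 0"
      using commute AE_conv_twist_sum[OF \<Phi>(1) \<Psi> subset_refl, of Id] AE_conv_twist_sum[OF \<Psi> \<Phi>(1) card, of ?P] AE_GL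
    proof eventually_elim
      case (elim h)
      have "conv f ?G h = conv (twist_sum ?P \<Phi>) ?G h"
        by (rule conv_cong_AE[OF \<Phi>(2) AE_I2 elim(4) f_meas])
          (simp_all add: measurable_twist_sum \<Phi>(1) \<Psi>)
      moreover have "conv ?G f h = conv ?G (twist_sum ?P \<Phi>) h"
        by (rule conv_cong_AE[OF AE_I2 \<Phi>(2) elim(4) _ f_meas])
          (simp_all add: measurable_twist_sum \<Phi>(1) \<Psi>)
      ultimately have eq: "conv (twist_sum ?P \<Phi>) ?G h = conv ?G (twist_sum ?P \<Phi>) h"
        using elim(1) by simp
      have left: "conv (twist_sum ?P \<Phi>) ?G h =
        (\<Sum>p\<in>?P. if snd p = \<epsilon>' then 1 / ?d (fst p) * twist (conv (\<Phi> (fst p) \<epsilon>') G) (fst p) \<epsilon>' h else 0)"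
        unfolding elim(2)
      proof (rule sum.cong[OF refl])
        fix p
        have "(\<Sum>q\<in>Id. (if snd p = fst q then 1 else 0) / ?d (fst p) *
            twist (conv (\<Phi> (fst p) (snd p)) (\<Psi> (fst q) (snd q))) (fst p) (snd q) h) =
          (\<Sum>q\<in>Id. if q = (\<epsilon>', \<epsilon>') then (if snd p = \<epsilon>' then 1 / ?d (fst p) * twist (conv (\<Phi> (fst p) \<epsilon>') G) (fst p) \<epsilon>' h else 0) else 0)"
          by (intro sum.cong) (auto simp: \<Psi>_def zero_conv twist_linear)
        then show "(\<Sum>q\<in>Id. (if snd p = fst q then 1 else 0) / ?d (fst p) *
            twist (conv (\<Phi> (fst p) (snd p)) (\<Psi> (fst q) (snd q))) (fst p) (snd q) h) =
          (if snd p = \<epsilon>' then 1 / ?d (fst p) * twist (conv (\<Phi> (fst p) \<epsilon>') G) (fst p) \<epsilon>' h else 0)"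
          by simp
      qed
      have right: "conv ?G (twist_sum ?P \<Phi>) h =
        (\<Sum>q\<in>?P. if fst q = \<epsilon>' then 1 / ?d (fst q) * twist (conv G (\<Phi> \<epsilon>' (snd q))) (fst q) (snd q) h else 0)"
        unfolding elim(3)
      proof (subst sum.swap, rule sum.cong[OF refl])
        fix q
        have "(\<Sum>p\<in>Id. (if snd p = fst q then 1 else 0) / ?d (fst p) *
            twist (conv (\<Psi> (fst p) (snd p)) (\<Phi> (fst q) (snd q))) (fst p) (snd q) h) =
          (\<Sum>p\<in>Id. if p = (\<epsilon>', \<epsilon>') then (if fst q = \<epsilon>' then 1 / ?d (fst q) * twist (conv G (\<Phi> \<epsilon>' (snd q))) (fst q) (snd q) h else 0) else 0)"
          by (intro sum.cong) (auto simp: \<Psi>_def zero_conv twist_linear)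
        then show "(\<Sum>p\<in>Id. (if snd p = fst q then 1 else 0) / ?d (fst p) *
            twist (conv (\<Psi> (fst p) (snd p)) (\<Phi> (fst q) (snd q))) (fst p) (snd q) h) =
          (if fst q = \<epsilon>' then 1 / ?d (fst q) * twist (conv G (\<Phi> \<epsilon>' (snd q))) (fst q) (snd q) h else 0)"
          by simp
      qed
      have "twist_sum ?P \<Theta> h =
        (\<Sum>p\<in>?P. (if snd p = \<epsilon>' then 1 / ?d (fst p) * twist (conv (\<Phi> (fst p) \<epsilon>') G) (fst p) \<epsilon>' h else 0) -
          (if fst p = \<epsilon>' then 1 / ?d (fst p) * twist (conv G (\<Phi> \<epsilon>' (snd p))) (fst p) (snd p) h else 0))"
        unfolding twist_sum_def case_prod_beta' \<Theta>_def twist_linear by (intro sum.cong) auto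
      also have "\<dots> = 0"
        unfolding sum_subtractf left[symmetric] right[symmetric] using eq by simp
      finally show ?case .
    qed
    note component = AE_twist_sum_component[OF \<Theta> this P]
    have "\<Theta> \<epsilon> \<epsilon>' \<in> hecke" "card \<epsilon> = card \<epsilon>'" using \<Theta> P by auto
    from AE_hecke_eq_0_if_twist[OF this component]
    have "AE h in haar_GL. 1 / ?d \<epsilon> * conv (\<Phi> \<epsilon> \<epsilon>') G h = 0"
      using neq by (simp only: \<Theta>_def plus_fun_apply simp_thms if_True if_False mult_zero_left add_0_right)
    moreover have "?d \<epsilon> \<noteq> 0"
    proof -
      have "{S :: 'n set. card S = card \<epsilon>} \<noteq> {}" by blast
      then show ?thesis by simp
    qed
    ultimately show "AE h in haar_GL. conv (\<Phi> \<epsilon> \<epsilon>') G h = 0"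
      by (simp only: mult_eq_0_iff divide_eq_0_iff one_neq_zero simp_thms)
  qed
  have "AE g in haar_GL. twist (\<Phi> \<epsilon> \<epsilon>') \<epsilon> \<epsilon>' g = 0" if "(\<epsilon>, \<epsilon>') \<in> ?P" "\<epsilon> \<noteq> \<epsilon>'" for \<epsilon> \<epsilon>'
    using zero[OF that] by eventually_elim (simp add: twist_def)
  then have "AE g in haar_GL. twist_sum ?P \<Phi> g = twist_sum Id \<Phi> g"
    by (intro AE_twist_sum_Id) auto
  with \<Phi>(2) have "AE g in haar_GL. f g = twist_sum Id \<Phi> g"
    by eventually_elim simp
  then show "f \<in> twist_algebra Id"
    unfolding twist_algebra_iff using f_meas \<Phi>(1) by blast
qed

theorem proposition4p2:
  shows "conv_subalgebra (hecke_W :: ('n::{finite,linorder}) mat_fun set)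
    \<and> (hecke_W_M :: 'n mat_fun set) =
        ae_saturate (cfun.span {twist F \<epsilon> \<epsilon> |F \<epsilon>. F \<in> hecke})
    \<and> maximal_commutative_subalgebra (hecke_W_M :: 'n mat_fun set) hecke_W
    \<and> (\<forall>(\<epsilon>1 :: 'n set) (\<epsilon>2 :: 'n set). \<forall>F\<in>hecke. \<forall>G\<in>hecke. AE g in haar_GL.
         conv (twist F \<epsilon>1 \<epsilon>1) (twist G \<epsilon>2 \<epsilon>2) g =
           (if \<epsilon>1 = \<epsilon>2 then 1 else 0) / of_nat (vec.dim (ext_power (card \<epsilon>1) :: 'n ext set))
             * twist (conv F G) \<epsilon>1 \<epsilon>1 g)"
proof (intro conjI allI ballI)
  show "conv_subalgebra (hecke_W :: 'n mat_fun set)"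
    unfolding hecke_W_eq by (rule conv_subalgebra_twist_algebra) (auto simp: trans_def)
  show "(hecke_W_M :: 'n mat_fun set) = ae_saturate (cfun.span {twist F \<epsilon> \<epsilon> |F \<epsilon>. F \<in> hecke})"
    unfolding hecke_W_M_eq by (rule twist_algebra_Id)
  have "conv_subalgebra (twist_algebra Id :: 'n mat_fun set)"
    by (rule conv_subalgebra_twist_algebra) (auto simp: trans_def)
  moreover have "(hecke_W_M :: 'n mat_fun set) \<subseteq> hecke_W"
    by (auto simp: hecke_W_M_def)
  ultimately show "maximal_commutative_subalgebra (hecke_W_M :: 'n mat_fun set) hecke_W"
    unfolding maximal_commutative_subalgebra_def hecke_W_M_eq
    using conv_commutative_twist_algebra_Id commuting_twist_algebra_subset by blast
next
  fix \<epsilon>1 \<epsilon>2 :: "'n set" and F G :: "'n mat_fun"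
  assume FG: "F \<in> hecke" "G \<in> hecke"
  show "AE g in haar_GL. conv (twist F \<epsilon>1 \<epsilon>1) (twist G \<epsilon>2 \<epsilon>2) g =
    (if \<epsilon>1 = \<epsilon>2 then 1 else 0) / of_nat (vec.dim (ext_power (card \<epsilon>1) :: 'n ext set)) * twist (conv F G) \<epsilon>1 \<epsilon>1 g"
    using AE_conv_twist[OF FG, of \<epsilon>1 \<epsilon>1 \<epsilon>2 \<epsilon>2] unfolding dim_ext_power
    by (cases "\<epsilon>1 = \<epsilon>2") simp_all
qed

end
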